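(* Let $n\ge1$ and $\alpha\in\mathbb{R}\setminus\pi\mathbb{Z}$. Let $\Delta_j$ be the classical Littlewood--Paley operators and $\Delta_j^\alpha=M_\alpha^{-1}\Delta_jM_\alpha$. Then there is a constant $C$, independent of $j$ and $k$, such that for all $j,k\in\mathbb{Z}$, $$\|D_k^\alpha\Delta_j^\alpha\|_{L^2(\mathbb{R}^n)\to L^2(\mathbb{R}^n)}=\|\Delta_j^\alpha D_k^\alpha\|_{L^2(\mathbb{R}^n)\to L^2(\mathbb{R}^n)}\le C\,2^{-\frac12|j-k|}.$$
   Context: $M_\alpha f(x)=e^{i\pi|x|^2\cot\alpha}f(x)$ and $M_\alpha^{-1}$ is multiplication by $e^{-i\pi|x|^2\cot\alpha}$. Littlewood--Paley operators: fix $\varphi\in C_c^\infty(\mathbb{R}^n\setminus\{0\})$ supported in $\{\frac12\le|\xi|\le2\}$ with $\sum_{j\in\mathbb{Z}}\varphi(2^{-j}\xi)=1$ for $\xi\ne0$, and set $\Delta_jf:=(\varphi(2^{-j}\cdot)\widehat f)^\vee$, with $\widehat f(\xi)=\int_{\mathbb{R}^n}e^{-2\pi ix\cdot\xi}f(x)\,dx$ and $\vee$ its inverse. $E_k$ is the classical dyadic conditional expectation: $E_kg(x)$ is the average of $g$ over the dyadic cube of side length $2^{-k}$ containing $x$; $D_k:=E_k-E_{k-1}$, and $D_k^\alpha:=M_\alpha^{-1}D_kM_\alpha$. *)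

theory Defs
  imports "HOL-Analysis.Analysis"
begin

definition square_integrable :: "(real ^ 'n \<Rightarrow> complex) \<Rightarrow> bool" where
  "square_integrable f \<longleftrightarrow>
     f \<in> borel_measurable lborel \<and> integrable lborel (\<lambda>x. (cmod (f x))\<^sup>2)"

definition L2_norm :: "(real ^ 'n \<Rightarrow> complex) \<Rightarrow> real" where
  "L2_norm f = sqrt (\<integral>x. (cmod (f x))\<^sup>2 \<partial>lborel)"

definition L2_converges ::
  "(nat \<Rightarrow> real ^ 'n \<Rightarrow> complex) \<Rightarrow> (real ^ 'n \<Rightarrow> complex) \<Rightarrow> bool" where
  "L2_converges F f \<longleftrightarrow> (\<forall>m. square_integrable (F m)) \<and> square_integrable f \<and>
     (\<lambda>m. L2_norm (\<lambda>x. F m x - f x)) \<longlonglongrightarrow> 0"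

text \<open>The least bound of an operator on \<open>L\<^sup>2\<close>, given by its action on representatives.
  The infimum is taken in the extended nonnegative reals, so the norm of an operator that is
  unbounded, or that does not map \<open>L\<^sup>2\<close> to itself, is \<open>\<infinity>\<close>.\<close>

definition L2_op_norm ::
  "((real ^ 'n \<Rightarrow> complex) \<Rightarrow> (real ^ 'n \<Rightarrow> complex)) \<Rightarrow> ennreal" where
  "L2_op_norm T = Inf {ennreal B | B. 0 \<le> B \<and>
     (\<forall>f. square_integrable f \<longrightarrow> square_integrable (T f) \<and> L2_norm (T f) \<le> B * L2_norm f)}"

definition fourier :: "(real ^ 'n \<Rightarrow> complex) \<Rightarrow> real ^ 'n \<Rightarrow> complex" where
  "fourier f \<xi> = (\<integral>x. cis (- 2 * pi * (x \<bullet> \<xi>)) * f x \<partial>lborel)"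

definition inv_fourier :: "(real ^ 'n \<Rightarrow> complex) \<Rightarrow> real ^ 'n \<Rightarrow> complex" where
  "inv_fourier g x = (\<integral>\<xi>. cis (2 * pi * (x \<bullet> \<xi>)) * g \<xi> \<partial>lborel)"

text \<open>For \<open>f\<close> in \<open>L\<^sup>2\<close> the Fourier integral need not converge; the transform is the continuous
  extension of \<^const>\<open>fourier\<close> from \<open>L\<^sup>1 \<inter> L\<^sup>2\<close>. It is determined up to a null set.\<close>

definition is_fourier_L2 ::
  "(real ^ 'n \<Rightarrow> complex) \<Rightarrow> (real ^ 'n \<Rightarrow> complex) \<Rightarrow> bool" where
  "is_fourier_L2 f g \<longleftrightarrow>
     (\<forall>F. (\<forall>m. integrable lborel (F m)) \<and> L2_converges F f \<longrightarrow>
          L2_converges (\<lambda>m. fourier (F m)) g)"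

definition fourier_L2 :: "(real ^ 'n \<Rightarrow> complex) \<Rightarrow> real ^ 'n \<Rightarrow> complex" where
  "fourier_L2 f = (SOME g. is_fourier_L2 f g)"

fun C_diff :: "nat \<Rightarrow> (real ^ 'n \<Rightarrow> complex) \<Rightarrow> bool" where
  "C_diff 0 f \<longleftrightarrow> continuous_on UNIV f"
| "C_diff (Suc r) f \<longleftrightarrow> (\<forall>x. f differentiable (at x)) \<and>
     (\<forall>v. C_diff r (\<lambda>x. frechet_derivative f (at x) v))"

definition supp :: "(real ^ 'n \<Rightarrow> complex) \<Rightarrow> (real ^ 'n) set" where
  "supp f = closure {x. f x \<noteq> 0}"

text \<open>The test functions on the open set \<open>U\<close>, identified with their extensions by zero.\<close>

definition Cc_smooth :: "(real ^ 'n) set \<Rightarrow> (real ^ 'n \<Rightarrow> complex) \<Rightarrow> bool" where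
  "Cc_smooth U f \<longleftrightarrow> (\<forall>r. C_diff r f) \<and> compact (supp f) \<and> supp f \<subseteq> U"

definition LP_function :: "(real ^ 'n \<Rightarrow> complex) \<Rightarrow> bool" where
  "LP_function \<phi> \<longleftrightarrow> Cc_smooth (- {0}) \<phi> \<and> supp \<phi> \<subseteq> {\<xi>. 1 / 2 \<le> norm \<xi> \<and> norm \<xi> \<le> 2} \<and>
     (\<forall>\<xi>. \<xi> \<noteq> 0 \<longrightarrow> ((\<lambda>j::int. \<phi> ((2 powi (- j)) *\<^sub>R \<xi>)) has_sum 1) UNIV)"

text \<open>For \<open>f\<close> in \<open>L\<^sup>2\<close> and \<open>\<phi>\<close> bounded with compact support, the function inverted here is in
  \<open>L\<^sup>1 \<inter> L\<^sup>2\<close>, so its inverse transform is given by the integral.\<close>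

definition LP_op ::
  "(real ^ 'n \<Rightarrow> complex) \<Rightarrow> int \<Rightarrow> (real ^ 'n \<Rightarrow> complex) \<Rightarrow> real ^ 'n \<Rightarrow> complex" where
  "LP_op \<phi> j f = inv_fourier (\<lambda>\<xi>. \<phi> ((2 powi (- j)) *\<^sub>R \<xi>) * fourier_L2 f \<xi>)"

definition dyadic_cube :: "int \<Rightarrow> int ^ 'n \<Rightarrow> (real ^ 'n) set" where
  "dyadic_cube k m = {y. \<forall>i. 2 powi (- k) * real_of_int (m $ i) \<le> y $ i \<and>
                             y $ i < 2 powi (- k) * (real_of_int (m $ i) + 1)}"

definition dyadic_cube_at :: "int \<Rightarrow> real ^ 'n \<Rightarrow> (real ^ 'n) set" where
  "dyadic_cube_at k x = (THE Q. Q \<in> range (dyadic_cube k) \<and> x \<in> Q)"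

lemma mem_dyadic_cube_iff: "x \<in> dyadic_cube k m \<longleftrightarrow> m = (\<chi> i. \<lfloor>2 powi k * x $ i\<rfloor>)"
proof -
  have "(2 powi (- k) * real_of_int a \<le> t \<and> t < 2 powi (- k) * (real_of_int a + 1)) \<longleftrightarrow>
        a = \<lfloor>2 powi k * t\<rfloor>" for a t
    by (auto simp: power_int_minus field_simps eq_commute[of a] floor_eq_iff)
  then show ?thesis
    by (simp add: dyadic_cube_def vec_eq_iff)
qed

lemma dyadic_cube_at_eq: "dyadic_cube_at k x = dyadic_cube k (\<chi> i. \<lfloor>2 powi k * x $ i\<rfloor>)"
  unfolding dyadic_cube_at_def by (rule the_equality) (auto simp: mem_dyadic_cube_iff)

definition cond_exp_op :: "int \<Rightarrow> (real ^ 'n \<Rightarrow> complex) \<Rightarrow> real ^ 'n \<Rightarrow> complex" where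
  "cond_exp_op k g x = (LINT y:dyadic_cube_at k x|lborel. g y) /
                       complex_of_real (measure lborel (dyadic_cube_at k x))"

definition mart_diff_op :: "int \<Rightarrow> (real ^ 'n \<Rightarrow> complex) \<Rightarrow> real ^ 'n \<Rightarrow> complex" where
  "mart_diff_op k g x = cond_exp_op k g x - cond_exp_op (k - 1) g x"

definition chirp :: "real \<Rightarrow> (real ^ 'n \<Rightarrow> complex) \<Rightarrow> real ^ 'n \<Rightarrow> complex" where
  "chirp \<alpha> f x = cis (pi * (norm x)\<^sup>2 * cot \<alpha>) * f x"

definition chirp_inv :: "real \<Rightarrow> (real ^ 'n \<Rightarrow> complex) \<Rightarrow> real ^ 'n \<Rightarrow> complex" where
  "chirp_inv \<alpha> f x = cis (- (pi * (norm x)\<^sup>2 * cot \<alpha>)) * f x"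

definition frac_LP_op ::
  "(real ^ 'n \<Rightarrow> complex) \<Rightarrow> real \<Rightarrow> int \<Rightarrow> (real ^ 'n \<Rightarrow> complex) \<Rightarrow> real ^ 'n \<Rightarrow> complex" where
  "frac_LP_op \<phi> \<alpha> j = chirp_inv \<alpha> \<circ> LP_op \<phi> j \<circ> chirp \<alpha>"

definition frac_mart_diff_op ::
  "real \<Rightarrow> int \<Rightarrow> (real ^ 'n \<Rightarrow> complex) \<Rightarrow> real ^ 'n \<Rightarrow> complex" where
  "frac_mart_diff_op \<alpha> k = chirp_inv \<alpha> \<circ> mart_diff_op k \<circ> chirp \<alpha>"

end

(* The chirps are unimodular, so only the classical operators D_k and Delta_j matter. As D_k is
   self-adjoint and the adjoint of Delta_j has the conjugate symbol, whose modulus is the same, the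
   Plancherel theorem turns a bound for D_k Delta_j into the same bound for Delta_j D_k and
   conversely.

   For j < k the output of Delta_j has frequencies at most 2^(j+1), so its translates by vectors of
   length O(2^(-k)) differ from it by O(2^(j-k)) in norm, and a Poincare inequality on cubes that uses
   translates in place of derivatives bounds (1 - E_k) Delta_j.

   For j >= k, h = D_k g is constant on cubes of side 2^(-k). With t = 2^(-j-4), the function
   h(. + t e_i) - h lives on strips that fill a fraction t 2^k of the space, so its squared norm is
   O(2^(k-j)) |h|^2. On the Fourier side this is the norm of (exp(2 pi i t xi_i) - 1) h^, and on the
   annulus |xi| ~ 2^j one of these n factors is bounded below. *)
theory Submission
  imports Defs "HOL-Probability.Characteristic_Functions"
begin

subsection \<open>Square-integrable functions\<close>

text \<open>The exponent 1/2 comes from the jumps of \<open>D_k g\<close> across cell faces: a shift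
  of size t alters it on a share of space proportional to t, so the squared norm gains
  \<open>2^(k-j)\<close> and the norm only the square root. For j < k there are no jumps, the
  estimate gives the full factor \<open>2^(j-k)\<close>, and this is weakened. Each regime needs a
  particular operator to act first: Delta_j to supply band-limited functions, D_k to supply
  functions constant on cells. The equality of norms is what joins the two estimates. Duality alone
  does not give it, because the adjoint of D_k Delta_j carries the conjugate symbol and phi may be
  complex valued. \<open>fourier_L2\<close> is a Hilbert choice, fixed only up to null sets, so no
  pointwise algebra (not even linearity) is available for it. Identities are proved for integrable
  approximants, where the transform is an integral, and passed to the limit in norm. That such a
  choice exists rests on completeness of the space and on Plancherel for integrable functions; the
  latter is obtained by Gaussian regularisation and continuity of translations.\<close>

lemma square_integrable_measurable [measurable_dest]:
  "square_integrable f \<Longrightarrow> f \<in> borel_measurable borel"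
  by (simp add: square_integrable_def)

lemma square_integrable_integrable:
  "square_integrable f \<Longrightarrow> integrable lborel (\<lambda>x. (cmod (f x))\<^sup>2)"
  by (simp add: square_integrable_def)

lemma L2_norm_nonneg [simp]: "0 \<le> L2_norm f"
  by (simp add: L2_norm_def)

lemma L2_norm_power2: "(L2_norm f)\<^sup>2 = (\<integral>x. (cmod (f x))\<^sup>2 \<partial>lborel)"
  by (simp add: L2_norm_def)

lemma square_integrable_bound:
  assumes "f \<in> borel_measurable borel" "integrable lborel h" "\<And>x. (cmod (f x))\<^sup>2 \<le> h x"
  shows "square_integrable f"
proof -
  have "integrable lborel (\<lambda>x. (cmod (f x))\<^sup>2)"
    by (rule Bochner_Integration.integrable_bound[OF assms(2)])
       (use assms(1) in \<open>auto intro!: AE_I2 order_trans[OF assms(3) abs_ge_self]\<close>)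
  then show ?thesis
    using assms(1) by (simp add: square_integrable_def)
qed

lemma L2_norm_le:
  assumes [measurable]: "f \<in> borel_measurable borel" and "square_integrable g"
    and le: "\<And>x. cmod (f x) \<le> c * cmod (g x)" and "0 \<le> c"
  shows "square_integrable f \<and> L2_norm f \<le> c * L2_norm g"
proof
  have le': "(cmod (f x))\<^sup>2 \<le> c\<^sup>2 * (cmod (g x))\<^sup>2" for x
    using power_mono[OF le, of x 2] by (simp add: power_mult_distrib)
  have i: "integrable lborel (\<lambda>x. c\<^sup>2 * (cmod (g x))\<^sup>2)"
    using assms(2) by (simp add: square_integrable_integrable)
  show f: "square_integrable f"
    by (rule square_integrable_bound[OF _ i le']) measurable
  have "(L2_norm f)\<^sup>2 \<le> (\<integral>x. c\<^sup>2 * (cmod (g x))\<^sup>2 \<partial>lborel)"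
    unfolding L2_norm_power2
    by (rule integral_mono[OF square_integrable_integrable[OF f] i le'])
  also have "\<dots> = (c * L2_norm g)\<^sup>2"
    by (simp add: L2_norm_power2 power_mult_distrib)
  finally show "L2_norm f \<le> c * L2_norm g"
    by (rule power2_le_imp_le) (use \<open>0 \<le> c\<close> in auto)
qed

lemma L2_norm_cmod_cong:
  assumes "f \<in> borel_measurable borel" "square_integrable g" "\<And>x. cmod (f x) = cmod (g x)"
  shows "square_integrable f" "L2_norm f = L2_norm g"
  using L2_norm_le[OF assms(1,2), of 1] assms by (auto simp: L2_norm_def)

lemma borel_measurable_cnj [measurable (raw)]:
  "f \<in> borel_measurable M \<Longrightarrow> (\<lambda>x. cnj (f x)) \<in> borel_measurable M"
  by (rule borel_measurable_continuous_on[of cnj]) (auto intro: continuous_intros)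

lemma square_integrable_cnj [intro]: "square_integrable f \<Longrightarrow> square_integrable (\<lambda>x. cnj (f x))"
  by (rule L2_norm_cmod_cong(1)) (auto dest: square_integrable_measurable)

lemma square_integrable_uminus [intro]: "square_integrable f \<Longrightarrow> square_integrable (\<lambda>x. - f x)"
  by (rule L2_norm_cmod_cong(1)) (auto dest: square_integrable_measurable)

lemma norm_add_power2_le: "(norm (a + b))\<^sup>2 \<le> 2 * (norm a)\<^sup>2 + 2 * (norm b :: real)\<^sup>2"
proof -
  have "(norm (a + b))\<^sup>2 \<le> (norm a + norm b)\<^sup>2"
    by (intro power_mono norm_triangle_ineq) auto
  also have "\<dots> \<le> 2 * (norm a)\<^sup>2 + 2 * (norm b)\<^sup>2"
    using sum_squares_bound[of "norm a" "norm b"] by (simp add: power2_sum)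
  finally show ?thesis .
qed

lemma square_integrable_add [intro]:
  assumes "square_integrable f" "square_integrable g"
  shows "square_integrable (\<lambda>x. f x + g x)"
proof (rule square_integrable_bound)
  show "(cmod (f x + g x))\<^sup>2 \<le> 2 * (cmod (f x))\<^sup>2 + 2 * (cmod (g x))\<^sup>2" for x
    by (rule norm_add_power2_le)
qed (use assms in \<open>auto simp: square_integrable_integrable dest: square_integrable_measurable\<close>)

lemma square_integrable_diff [intro]:
  "square_integrable f \<Longrightarrow> square_integrable g \<Longrightarrow> square_integrable (\<lambda>x. f x - g x)"
  using square_integrable_add[OF _ square_integrable_uminus, of f g] by simp

lemma square_integrable_bounded_mult:
  assumes [measurable]: "h \<in> borel_measurable borel"
    and "\<And>x. cmod (h x) \<le> c" and "square_integrable f"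
  shows "square_integrable (\<lambda>x. h x * f x)" "L2_norm (\<lambda>x. h x * f x) \<le> c * L2_norm f"
proof -
  have [measurable]: "f \<in> borel_measurable borel"
    using assms(3) by measurable
  have "0 \<le> c" using assms(2)[of undefined] norm_ge_zero order_trans by blast
  then show "square_integrable (\<lambda>x. h x * f x)" "L2_norm (\<lambda>x. h x * f x) \<le> c * L2_norm f"
    using L2_norm_le[of "\<lambda>x. h x * f x" f c] assms(2,3)
    by (auto simp: norm_mult mult_right_mono)
qed

lemma square_integrable_indicator_cball: "square_integrable (indicator (cball 0 r))"
  unfolding square_integrable_def
proof
  have *: "(\<lambda>x. (cmod (indicator (cball 0 r) x))\<^sup>2) = (indicator (cball 0 r) :: _ \<Rightarrow> real)"
    by (auto simp: indicator_def)
  show "integrable lborel (\<lambda>x. (cmod (indicator (cball 0 r) x))\<^sup>2)"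
    unfolding * by (simp add: integrable_indicator_iff) (metis bounded_cball emeasure_bounded_finite infinity_ennreal_def)
qed (auto intro!: borel_measurable_indicator)

text \<open>Only finiteness is at stake, so \<open>|ab| <= |a|^2 + |b|^2\<close> suffices; the sharp
  bound is Cauchy-Schwarz.\<close>

lemma integrable_mult_L2:
  assumes f: "square_integrable f" and g: "square_integrable g"
  shows "integrable lborel (\<lambda>x. f x * g x)"
proof (rule Bochner_Integration.integrable_bound)
  show "integrable lborel (\<lambda>x. (cmod (f x))\<^sup>2 + (cmod (g x))\<^sup>2)"
    using assms by (simp add: square_integrable_integrable)
  show "(\<lambda>x. f x * g x) \<in> borel_measurable lborel"
    using f g by measurable
  have "cmod (f x * g x) \<le> (cmod (f x))\<^sup>2 + (cmod (g x))\<^sup>2" for x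
    using sum_squares_bound[of "cmod (f x)" "cmod (g x)"]
      mult_nonneg_nonneg[OF norm_ge_zero[of "f x"] norm_ge_zero[of "g x"]]
    unfolding norm_mult by linarith
  then show "AE x in lborel. norm (f x * g x) \<le> norm ((cmod (f x))\<^sup>2 + (cmod (g x))\<^sup>2)"
    by (simp add: order_trans[OF _ abs_ge_self])
qed

text \<open>Taken from the version for nonnegative extended integrals; finiteness of every term then
  allows the return to real numbers.\<close>

lemma Cauchy_Schwarz_L2:
  assumes f: "square_integrable f" and g: "square_integrable g"
  shows "(\<integral>x. cmod (f x) * cmod (g x) \<partial>lborel) \<le> L2_norm f * L2_norm g"
proof -
  have [measurable]: "f \<in> borel_measurable borel" "g \<in> borel_measurable borel"
    using f g by measurable
  have i: "integrable lborel (\<lambda>x. cmod (f x) * cmod (g x))"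
    using integrable_norm[OF integrable_mult_L2[OF f g]] by (simp add: norm_mult)
  let ?I = "\<integral>x. cmod (f x) * cmod (g x) \<partial>lborel"
  have "ennreal (?I\<^sup>2) = (\<integral>\<^sup>+x. ennreal (cmod (f x)) * ennreal (cmod (g x)) \<partial>lborel)\<^sup>2"
    by (simp flip: ennreal_mult' ennreal_power add: nn_integral_eq_integral[OF i])
  also have "\<dots> \<le> (\<integral>\<^sup>+x. ennreal (cmod (f x)) ^ 2 \<partial>lborel) * (\<integral>\<^sup>+x. ennreal (cmod (g x)) ^ 2 \<partial>lborel)"
    by (rule Cauchy_Schwarz_nn_integral) measurable
  also have "\<dots> = ennreal ((L2_norm f)\<^sup>2) * ennreal ((L2_norm g)\<^sup>2)"
    using nn_integral_eq_integral[OF square_integrable_integrable[OF f]]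
      nn_integral_eq_integral[OF square_integrable_integrable[OF g]]
    by (simp add: L2_norm_power2 ennreal_power)
  also have "\<dots> = ennreal ((L2_norm f * L2_norm g)\<^sup>2)"
    by (simp add: power_mult_distrib ennreal_mult)
  finally have "?I\<^sup>2 \<le> (L2_norm f * L2_norm g)\<^sup>2"
    by (subst (asm) ennreal_le_iff) auto
  then show ?thesis
    by (rule power2_le_imp_le) auto
qed

lemma L2_norm_triangle:
  assumes f: "square_integrable f" and g: "square_integrable g"
  shows "L2_norm (\<lambda>x. f x + g x) \<le> L2_norm f + L2_norm g"
proof (rule power2_le_imp_le)
  have i: "integrable lborel (\<lambda>x. cmod (f x) * cmod (g x))"
    using integrable_norm[OF integrable_mult_L2[OF f g]] by (simp add: norm_mult)
  note ii = square_integrable_integrable[OF f] square_integrable_integrable[OF g] i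
  have "(L2_norm (\<lambda>x. f x + g x))\<^sup>2 \<le>
      (\<integral>x. (cmod (f x))\<^sup>2 + (cmod (g x))\<^sup>2 + 2 * (cmod (f x) * cmod (g x)) \<partial>lborel)"
    unfolding L2_norm_power2
  proof (rule integral_mono)
    show "(cmod (f x + g x))\<^sup>2 \<le> (cmod (f x))\<^sup>2 + (cmod (g x))\<^sup>2 + 2 * (cmod (f x) * cmod (g x))" for x
      using power_mono[OF norm_triangle_ineq[of "f x" "g x"], of 2] by (simp add: power2_sum)
  qed (use ii f g in \<open>auto intro: square_integrable_integrable\<close>)
  also have "\<dots> \<le> (L2_norm f)\<^sup>2 + (L2_norm g)\<^sup>2 + 2 * (L2_norm f * L2_norm g)"
    using ii Cauchy_Schwarz_L2[OF f g] by (simp add: L2_norm_power2)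
  finally show "(L2_norm (\<lambda>x. f x + g x))\<^sup>2 \<le> (L2_norm f + L2_norm g)\<^sup>2"
    by (simp add: power2_sum)
qed auto

lemma L2_norm_minus_commute: "L2_norm (\<lambda>x. f x - g x) = L2_norm (\<lambda>x. g x - f x)"
  by (simp add: L2_norm_def norm_minus_commute)

lemma L2_norm_triangle_diff:
  assumes "square_integrable f" "square_integrable g"
  shows "L2_norm (\<lambda>x. f x - g x) \<le> L2_norm f + L2_norm g"
  using L2_norm_triangle[OF assms(1) square_integrable_uminus[OF assms(2)]]
  by (simp add: L2_norm_def)

lemma L2_norm_triangle_via:
  assumes "square_integrable f" "square_integrable g" "square_integrable h"
  shows "L2_norm (\<lambda>x. f x - h x) \<le> L2_norm (\<lambda>x. f x - g x) + L2_norm (\<lambda>x. g x - h x)"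
  using L2_norm_triangle[of "\<lambda>x. f x - g x" "\<lambda>x. g x - h x"] assms by auto

lemma L2_norm_reverse_triangle:
  assumes f: "square_integrable f" and g: "square_integrable g"
  shows "\<bar>L2_norm f - L2_norm g\<bar> \<le> L2_norm (\<lambda>x. f x - g x)"
  using L2_norm_triangle[OF square_integrable_diff[OF f g] g]
    L2_norm_triangle[OF square_integrable_diff[OF g f] f] L2_norm_minus_commute[of f g]
  by simp

section \<open>Inner product and convergence in norm\<close>

definition L2_inner ::
  "(real ^ 'n \<Rightarrow> complex) \<Rightarrow> (real ^ 'n \<Rightarrow> complex) \<Rightarrow> complex" where
  "L2_inner f g = (\<integral>x. f x * cnj (g x) \<partial>lborel)"

lemma L2_inner_commute: "L2_inner g f = cnj (L2_inner f g)"
proof -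
  have "cnj (L2_inner f g) = (\<integral>x. cnj (f x * cnj (g x)) \<partial>lborel)"
    unfolding L2_inner_def by (rule Bochner_Integration.integral_cnj[symmetric])
  then show ?thesis
    by (simp add: L2_inner_def mult.commute)
qed

lemma L2_inner_self: "L2_inner f f = complex_of_real ((L2_norm f)\<^sup>2)"
  by (simp add: L2_inner_def L2_norm_power2 complex_norm_square[symmetric] flip: integral_complex_of_real of_real_power)

lemma cmod_L2_inner_le:
  assumes f: "square_integrable f" and g: "square_integrable g"
  shows "cmod (L2_inner f g) \<le> L2_norm f * L2_norm g"
proof -
  have "cmod (L2_inner f g) \<le> (\<integral>x. cmod (f x * cnj (g x)) \<partial>lborel)"
    unfolding L2_inner_def by (rule integral_norm_bound)
  also have "\<dots> \<le> L2_norm f * L2_norm g"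
    using Cauchy_Schwarz_L2[OF f g] by (simp add: norm_mult)
  finally show ?thesis .
qed

lemma L2_inner_diff_left:
  assumes "square_integrable f" "square_integrable g" "square_integrable h"
  shows "L2_inner (\<lambda>x. f x - g x) h = L2_inner f h - L2_inner g h"
  using integrable_mult_L2[OF assms(1) square_integrable_cnj[OF assms(3)]]
    integrable_mult_L2[OF assms(2) square_integrable_cnj[OF assms(3)]]
  by (simp add: L2_inner_def left_diff_distrib)

lemma L2_inner_diff_right:
  assumes "square_integrable f" "square_integrable g" "square_integrable h"
  shows "L2_inner h (\<lambda>x. f x - g x) = L2_inner h f - L2_inner h g"
  using L2_inner_diff_left[OF assms] by (metis L2_inner_commute complex_cnj_diff)

lemma L2_convergesD:
  assumes "L2_converges F f"
  shows "square_integrable (F m)" "square_integrable f" "(\<lambda>m. L2_norm (\<lambda>x. F m x - f x)) \<longlonglongrightarrow> 0"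
  using assms by (auto simp: L2_converges_def)

lemma L2_converges_norm:
  assumes "L2_converges F f"
  shows "(\<lambda>m. L2_norm (F m)) \<longlonglongrightarrow> L2_norm f"
  by (rule Lim_null_comparison[THEN LIM_zero_cancel, OF _ L2_convergesD(3)[OF assms]])
     (auto intro!: always_eventually L2_norm_reverse_triangle L2_convergesD(1,2)[OF assms])

lemma L2_converges_inner:
  assumes F: "L2_converges F f" and G: "L2_converges G g"
  shows "(\<lambda>m. L2_inner (F m) (G m)) \<longlonglongrightarrow> L2_inner f g"
proof (rule LIM_zero_cancel, rule Lim_null_comparison)
  note F' = L2_convergesD[OF F] and G' = L2_convergesD[OF G]
  have "L2_inner (F m) (G m) - L2_inner f g =
      L2_inner (\<lambda>x. F m x - f x) (G m) + L2_inner f (\<lambda>x. G m x - g x)" for m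
    by (simp add: L2_inner_diff_left L2_inner_diff_right F' G')
  then show "\<forall>\<^sub>F m in sequentially. cmod (L2_inner (F m) (G m) - L2_inner f g) \<le>
      L2_norm (\<lambda>x. F m x - f x) * L2_norm (G m) + L2_norm f * L2_norm (\<lambda>x. G m x - g x)"
    by (auto intro!: always_eventually norm_triangle_mono cmod_L2_inner_le square_integrable_diff F' G')
  show "(\<lambda>m. L2_norm (\<lambda>x. F m x - f x) * L2_norm (G m) + L2_norm f * L2_norm (\<lambda>x. G m x - g x))
      \<longlonglongrightarrow> 0"
    by (auto intro!: tendsto_eq_intros F'(3) G'(3) L2_converges_norm[OF G])
qed

lemma L2_norm_tendsto_0I:
  fixes F :: "nat \<Rightarrow> real ^ 'n \<Rightarrow> complex"
  assumes [measurable]: "\<And>m. F m \<in> borel_measurable borel"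
    and lim: "AE x in lborel. (\<lambda>m. F m x) \<longlonglongrightarrow> 0"
    and g: "integrable lborel g" "\<And>m x. (cmod (F m x))\<^sup>2 \<le> g x"
  shows "(\<lambda>m. L2_norm (F m)) \<longlonglongrightarrow> 0"
proof -
  have "(\<lambda>m. \<integral>x. (cmod (F m x))\<^sup>2 \<partial>lborel) \<longlonglongrightarrow> (\<integral>x. (0::real) \<partial>(lborel :: (real ^ 'n) measure))"
  proof (rule integral_dominated_convergence[where w=g])
    show "AE x in lborel. (\<lambda>m. (cmod (F m x))\<^sup>2) \<longlonglongrightarrow> 0"
      using lim by eventually_elim (auto intro!: tendsto_eq_intros)
  qed (use g in auto)
  then show ?thesis
    unfolding L2_norm_def using tendsto_real_sqrt by fastforce
qed

lemma L2_converges_dominated: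
  assumes [measurable]: "\<And>m. F m \<in> borel_measurable borel" and f: "square_integrable f"
    and lim: "AE x in lborel. (\<lambda>m. F m x) \<longlonglongrightarrow> f x"
    and g: "square_integrable g" "\<And>m x. cmod (F m x) \<le> cmod (g x)"
  shows "L2_converges F f"
proof -
  have F: "square_integrable (F m)" for m
    using L2_norm_le[of "F m" g 1] g by auto
  have "(\<lambda>m. L2_norm (\<lambda>x. F m x - f x)) \<longlonglongrightarrow> 0"
  proof (rule L2_norm_tendsto_0I)
    show "AE x in lborel. (\<lambda>m. F m x - f x) \<longlonglongrightarrow> 0"
      using lim by eventually_elim (auto intro!: tendsto_eq_intros)
    show "(cmod (F m x - f x))\<^sup>2 \<le> 2 * (cmod (g x))\<^sup>2 + 2 * (cmod (f x))\<^sup>2" for m x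
    proof -
      have "(cmod (F m x))\<^sup>2 \<le> (cmod (g x))\<^sup>2"
        by (rule power_mono[OF g(2)]) simp
      moreover have "(cmod (F m x - f x))\<^sup>2 \<le> 2 * (cmod (F m x))\<^sup>2 + 2 * (cmod (f x))\<^sup>2"
        using norm_add_power2_le[of "F m x" "- f x"] by simp
      ultimately show ?thesis by linarith
    qed
  qed (use square_integrable_measurable[OF f] square_integrable_integrable[OF f]
      square_integrable_integrable[OF g(1)] in auto)
  then show ?thesis
    using F f by (auto simp: L2_converges_def)
qed

text \<open>Restricting to a ball of finite measure makes \<open>f\<close> integrable, and dominated
  convergence recovers \<open>f\<close>. These truncations are the approximants behind every later
  statement about \<open>fourier_L2\<close>.\<close>

lemma L2_approx_integrable:
  assumes f: "square_integrable f"
  defines "F \<equiv> \<lambda>m::nat. \<lambda>x. indicator (cball 0 (real m)) x * f x"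
  shows "\<And>m. integrable lborel (F m)" "L2_converges F f"
proof -
  show "integrable lborel (F m)" for m
    unfolding F_def by (rule integrable_mult_L2[OF square_integrable_indicator_cball f])
  have [measurable]: "f \<in> borel_measurable borel" using f by measurable
  show "L2_converges F f"
  proof (rule L2_converges_dominated[OF _ f _ f])
    show "F m \<in> borel_measurable borel" for m
      unfolding F_def by (intro borel_measurable_times borel_measurable_indicator) auto
    have "(\<lambda>m. F m x) \<longlonglongrightarrow> f x" for x
    proof (rule tendsto_eventually)
      show "\<forall>\<^sub>F m in sequentially. F m x = f x"
        unfolding eventually_sequentially
      proof (intro exI allI impI)
        fix m assume "nat \<lceil>norm x\<rceil> \<le> m"
        then have "norm x \<le> real m" by linarith
        then show "F m x = f x" by (simp add: F_def)
      qed
    qed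
    then show "AE x in lborel. (\<lambda>m. F m x) \<longlonglongrightarrow> f x" by simp
    show "cmod (F m x) \<le> cmod (f x)" for m x
      by (auto simp: F_def indicator_def)
  qed
qed

subsection \<open>Completeness and continuity of translations\<close>

text \<open>One substitution rule for translations (\<open>c = 1\<close>), the reflection
  (\<open>c = -1\<close>) and the rescaling of Gaussians (\<open>c = a\<close>).\<close>

lemma lborel_affine_change:
  fixes f :: "'a::euclidean_space \<Rightarrow> 'b::{banach, second_countable_topology}"
  assumes c: "c \<noteq> 0" and f: "f \<in> borel_measurable borel"
  shows "integrable lborel f \<longleftrightarrow> integrable lborel (\<lambda>x. f (t + c *\<^sub>R x))" (is ?I)
    and "integral\<^sup>L lborel f = \<bar>c\<bar> ^ DIM('a) *\<^sub>R (\<integral>x. f (t + c *\<^sub>R x) \<partial>lborel)" (is ?E)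
proof -
  have eq: "(lborel :: 'a measure) =
      density (distr lborel borel (\<lambda>x. t + c *\<^sub>R x)) (\<lambda>_. ennreal (\<bar>c\<bar> ^ DIM('a)))"
    using lborel_affine[OF c, of t] by simp
  have "integrable lborel f \<longleftrightarrow>
      integrable (density (distr lborel borel (\<lambda>x. t + c *\<^sub>R x)) (\<lambda>_. ennreal (\<bar>c\<bar> ^ DIM('a)))) f"
    using eq by simp
  also have "\<dots> \<longleftrightarrow> integrable lborel (\<lambda>x. (\<bar>c\<bar> ^ DIM('a)) *\<^sub>R f (t + c *\<^sub>R x))"
    using f by (simp add: integrable_density integrable_distr_eq)
  also have "\<dots> \<longleftrightarrow> integrable lborel (\<lambda>x. f (t + c *\<^sub>R x))"
    using integrable_scaleR_right[of "inverse (\<bar>c\<bar> ^ DIM('a))" lborel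
        "\<lambda>x. (\<bar>c\<bar> ^ DIM('a)) *\<^sub>R f (t + c *\<^sub>R x)"] c
    by auto
  finally show ?I .
  have "integral\<^sup>L lborel f =
      integral\<^sup>L (density (distr lborel borel (\<lambda>x. t + c *\<^sub>R x)) (\<lambda>_. ennreal (\<bar>c\<bar> ^ DIM('a)))) f"
    using eq by simp
  then show ?E
    using c f by (simp add: integral_density integral_distr)
qed

lemma L2_affine:
  assumes c: "\<bar>c\<bar> = 1" and f: "square_integrable f"
  shows "square_integrable (\<lambda>x. f (t + c *\<^sub>R x))" "L2_norm (\<lambda>x. f (t + c *\<^sub>R x)) = L2_norm f"
proof -
  have [measurable]: "f \<in> borel_measurable borel"
    using f by measurable
  have c0: "c \<noteq> 0" using c by auto
  have m: "(\<lambda>x. (cmod (f x))\<^sup>2) \<in> borel_measurable borel"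
    by measurable
  show "square_integrable (\<lambda>x. f (t + c *\<^sub>R x))"
    using square_integrable_integrable[OF f] lborel_affine_change(1)[OF c0 m, of t]
    by (simp add: square_integrable_def)
  show "L2_norm (\<lambda>x. f (t + c *\<^sub>R x)) = L2_norm f"
    using lborel_affine_change(2)[OF c0 m, of t] c by (simp add: L2_norm_def)
qed

lemma L2_translation:
  assumes f: "square_integrable f"
  shows "square_integrable (\<lambda>x. f (x + h))" "L2_norm (\<lambda>x. f (x + h)) = L2_norm f"
  using L2_affine[OF _ f, of 1 h] by (simp_all add: add.commute)

lemma L2_reflection:
  assumes f: "square_integrable f"
  shows "square_integrable (\<lambda>x. f (- x))" "L2_norm (\<lambda>x. f (- x)) = L2_norm f"
  using L2_affine[OF _ f, of "-1" 0] by simp_all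

lemma nn_integral_L2_norm:
  assumes "square_integrable f"
  shows "(\<integral>\<^sup>+x. ennreal ((cmod (f x))\<^sup>2) \<partial>lborel) = ennreal ((L2_norm f)\<^sup>2)"
  using nn_integral_eq_integral[OF square_integrable_integrable[OF assms]]
  by (simp add: L2_norm_power2)

lemma L2_normI_nn_integral:
  assumes [measurable]: "f \<in> borel_measurable borel" and "0 \<le> e"
    and le: "(\<integral>\<^sup>+x. ennreal ((cmod (f x))\<^sup>2) \<partial>lborel) \<le> ennreal (e\<^sup>2)"
  shows "square_integrable f \<and> L2_norm f \<le> e"
proof
  have "integrable lborel (\<lambda>x. (cmod (f x))\<^sup>2)"
    using le by (intro integrableI_bounded) (auto simp: le_less_trans[OF _ ennreal_less_top])
  then show f: "square_integrable f"
    by (simp add: square_integrable_def)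
  have "(L2_norm f)\<^sup>2 \<le> e\<^sup>2"
    using le unfolding nn_integral_L2_norm[OF f] by simp
  then show "L2_norm f \<le> e"
    using \<open>0 \<le> e\<close> by (rule power2_le_imp_le)
qed

text \<open>Fatou applied to squared moduli. In the completeness proof it turns a bound on
  differences along a sequence into a bound on the difference from its pointwise limit.\<close>

lemma L2_norm_Fatou:
  assumes u: "\<And>k::nat. square_integrable (u k)" "\<forall>\<^sub>F k in sequentially. L2_norm (u k) \<le> e"
    and [measurable]: "v \<in> borel_measurable borel"
    and lim: "AE x in lborel. (\<lambda>k. u k x) \<longlonglongrightarrow> v x" and "0 \<le> e"
  shows "square_integrable v \<and> L2_norm v \<le> e"
proof (rule L2_normI_nn_integral)
  have [measurable]: "u k \<in> borel_measurable borel" for k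
    using u(1) by measurable
  have "(\<integral>\<^sup>+x. ennreal ((cmod (v x))\<^sup>2) \<partial>lborel) =
      (\<integral>\<^sup>+x. liminf (\<lambda>k. ennreal ((cmod (u k x))\<^sup>2)) \<partial>lborel)"
  proof (rule nn_integral_cong_AE)
    show "AE x in lborel. ennreal ((cmod (v x))\<^sup>2) = liminf (\<lambda>k. ennreal ((cmod (u k x))\<^sup>2))"
      using lim
    proof eventually_elim
      case (elim x)
      then have "(\<lambda>k. ennreal ((cmod (u k x))\<^sup>2)) \<longlonglongrightarrow> ennreal ((cmod (v x))\<^sup>2)"
        by (intro tendsto_intros)
      then show ?case
        by (rule lim_imp_Liminf[OF sequentially_bot, symmetric])
    qed
  qed
  also have "\<dots> \<le> liminf (\<lambda>k. \<integral>\<^sup>+x. ennreal ((cmod (u k x))\<^sup>2) \<partial>lborel)"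
    by (rule nn_integral_liminf) measurable
  also have "\<dots> \<le> liminf (\<lambda>k::nat. ennreal (e\<^sup>2))"
    by (rule Liminf_mono, use u(2) in eventually_elim)
       (simp add: nn_integral_L2_norm[OF u(1)] power_mono)
  finally show "(\<integral>\<^sup>+x. ennreal ((cmod (v x))\<^sup>2) \<partial>lborel) \<le> ennreal (e\<^sup>2)"
    by (simp add: Liminf_const)
qed fact+

text \<open>Riesz-Fischer: a rapidly Cauchy subsequence converges almost everywhere, and Fatou shows
  that its pointwise limit is also the limit in norm of the whole sequence.\<close>

lemma L2_complete:
  assumes F: "\<And>m::nat. square_integrable (F m)"
    and Cauchy: "\<And>e. 0 < e \<Longrightarrow> \<exists>N. \<forall>m\<ge>N. \<forall>n\<ge>N. L2_norm (\<lambda>x. F m x - F n x) < e"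
  shows "\<exists>g. L2_converges F g"
proof -
  have [measurable]: "F m \<in> borel_measurable borel" for m
    using F by measurable
  have "\<exists>N. \<forall>m\<ge>N. \<forall>n\<ge>N. L2_norm (\<lambda>x. F m x - F n x) < (1 / 2) ^ k" for k :: nat
    by (rule Cauchy) simp
  then obtain N where N: "\<And>k m n. m \<ge> N k \<Longrightarrow> n \<ge> N k \<Longrightarrow> L2_norm (\<lambda>x. F m x - F n x) < (1 / 2) ^ k"
    by metis
  \<comment> \<open>Summing the thresholds makes \<open>r\<close> monotone and at least
    \<open>N k\<close> at each \<open>k\<close>; the summand \<open>k\<close> makes it
    unbounded.\<close>
  define r where "r k = k + (\<Sum>i\<le>k. N i)" for k
  have rN: "N k \<le> r k" for k
    unfolding r_def by (rule trans_le_add2) (rule member_le_sum, auto)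
  have rk: "k \<le> r k" "r k \<le> r (Suc k)" for k
    by (auto simp: r_def)
  define d where "d k x = F (r (Suc k)) x - F (r k) x" for k x
  have d: "square_integrable (d k)" for k
    unfolding d_def by (intro square_integrable_diff F)
  have [measurable]: "d k \<in> borel_measurable borel" for k
    using d by measurable
  have dk: "L2_norm (d k) \<le> (1 / 2) ^ k" for k
    using N[of k "r (Suc k)" "r k"] rN[of k] rk(2)[of k] unfolding d_def
    by (meson le_trans less_imp_le)
  \<comment> \<open>The squared norms decay like \<open>4^-k\<close>, so the weight
    \<open>2^k\<close> still leaves a convergent series. Where the weighted sum is a finite
    \<open>S\<close>, each increment is at most \<open>sqrt S * 2^(-k/2)\<close>, which is
    summable.\<close>
  have "(\<integral>\<^sup>+x. (\<Sum>k. ennreal (2 ^ k) * ennreal ((cmod (d k x))\<^sup>2)) \<partial>lborel) =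
      (\<Sum>k. ennreal (2 ^ k) * ennreal ((L2_norm (d k))\<^sup>2))"
    by (subst nn_integral_suminf) (auto simp: nn_integral_cmult nn_integral_L2_norm[OF d])
  also have "\<dots> \<le> (\<Sum>k. ennreal ((1 / 2) ^ k))"
  proof (intro suminf_le summableI)
    fix k
    have "2 ^ k * (L2_norm (d k))\<^sup>2 \<le> 2 ^ k * ((1 / 2) ^ k)\<^sup>2"
      by (intro mult_left_mono power_mono dk) auto
    also have "\<dots> = (1 / 2) ^ k"
      by (simp add: power2_eq_square power_one_over)
    finally show "ennreal (2 ^ k) * ennreal ((L2_norm (d k))\<^sup>2) \<le> ennreal ((1 / 2) ^ k)"
      by (simp flip: ennreal_mult')
  qed
  also have "\<dots> = ennreal (\<Sum>k. (1 / 2) ^ k)"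
    by (rule suminf_ennreal2) (auto intro: summable_geometric)
  also have "\<dots> < \<infinity>"
    by simp
  finally have "AE x in lborel. (\<Sum>k. ennreal (2 ^ k) * ennreal ((cmod (d k x))\<^sup>2)) \<noteq> \<infinity>"
    by (intro nn_integral_PInf_AE) auto
  then have conv: "AE x in lborel. convergent (\<lambda>k. F (r k) x)"
  proof eventually_elim
    case (elim x)
    define S where "S = enn2real (\<Sum>k. ennreal (2 ^ k) * ennreal ((cmod (d k x))\<^sup>2))"
    have S: "ennreal S = (\<Sum>k. ennreal (2 ^ k) * ennreal ((cmod (d k x))\<^sup>2))"
      unfolding S_def using elim by (simp add: less_top)
    have S0: "0 \<le> S"
      by (simp add: S_def)
    have "cmod (d k x) \<le> sqrt S * (1 / sqrt 2) ^ k" for k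
    proof -
      have sqrt_pow: "(sqrt 2 ^ k)\<^sup>2 = (2::real) ^ k"
        by (metis mult.commute power_mult real_sqrt_pow2 zero_le_numeral)
      have "ennreal (2 ^ k * (cmod (d k x))\<^sup>2) \<le> ennreal S"
        unfolding S using sum_le_suminf[of "\<lambda>k. ennreal (2 ^ k) * ennreal ((cmod (d k x))\<^sup>2)" "{k}"]
        by (simp add: ennreal_mult' summableI)
      then have "2 ^ k * (cmod (d k x))\<^sup>2 \<le> S"
        using S0 by simp
      then have "(cmod (d k x))\<^sup>2 \<le> (sqrt S * (1 / sqrt 2) ^ k)\<^sup>2"
        using S0 sqrt_pow by (simp add: power_mult_distrib power_divide field_simps)
      then show ?thesis
        by (rule power2_le_imp_le) (simp add: S0)
    qed
    moreover have "summable (\<lambda>k. sqrt S * (1 / sqrt 2) ^ k)"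
      by (intro summable_mult summable_geometric) simp
    ultimately have "summable (\<lambda>k. d k x)"
      by (rule summable_comparison_test'[where N=0, rotated])
    then have "convergent (\<lambda>k. (\<Sum>i<k. d i x) + F (r 0) x)"
      by (intro convergent_add convergent_const) (simp add: summable_iff_convergent)
    moreover have "(\<Sum>i<k. d i x) + F (r 0) x = F (r k) x" for k
      unfolding d_def by (subst sum_lessThan_telescope) simp
    ultimately show ?case
      by simp
  qed
  \<comment> \<open>Where the subsequence diverges, \<open>lim\<close> is an unspecified value; such
    points form a null set.\<close>
  define g where "g x = lim (\<lambda>k. F (r k) x)" for x
  have [measurable]: "g \<in> borel_measurable borel"
    unfolding g_def by measurable
  have lim: "AE x in lborel. (\<lambda>k. F (r k) x) \<longlonglongrightarrow> g x"
    using conv by eventually_elim (simp add: g_def convergent_LIMSEQ_iff)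
  have *: "square_integrable (\<lambda>x. F n x - g x) \<and> L2_norm (\<lambda>x. F n x - g x) \<le> e"
    if "0 \<le> e" "\<And>m. m \<ge> n \<Longrightarrow> L2_norm (\<lambda>x. F n x - F m x) \<le> e" for n e
  proof (rule L2_norm_Fatou[where u="\<lambda>k x. F n x - F (r k) x"])
    show "\<forall>\<^sub>F k in sequentially. L2_norm (\<lambda>x. F n x - F (r k) x) \<le> e"
      using rk(1) that(2) by (auto simp: eventually_sequentially intro!: exI[of _ n] intro: le_trans)
    show "AE x in lborel. (\<lambda>k. F n x - F (r k) x) \<longlonglongrightarrow> F n x - g x"
      using lim by eventually_elim (intro tendsto_intros)
  qed (use that in \<open>auto intro: square_integrable_diff F\<close>)
  show ?thesis
  proof (intro exI)
    obtain N1 where N1: "\<forall>m\<ge>N1. \<forall>n\<ge>N1. L2_norm (\<lambda>x. F m x - F n x) < 1"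
      using Cauchy[of 1] by auto
    have "square_integrable (\<lambda>x. F N1 x - g x)"
      using *[of 1 N1] N1 by (auto simp: less_imp_le)
    then have "square_integrable (\<lambda>x. F N1 x - (F N1 x - g x))"
      by (rule square_integrable_diff[OF F])
    then have g: "square_integrable g"
      by simp
    have "(\<lambda>m. L2_norm (\<lambda>x. F m x - g x)) \<longlonglongrightarrow> 0"
    proof (rule LIMSEQ_I)
      fix e :: real assume "0 < e"
      then obtain N where "\<forall>m\<ge>N. \<forall>n\<ge>N. L2_norm (\<lambda>x. F m x - F n x) < e / 2"
        using Cauchy[of "e / 2"] by auto
      then have "L2_norm (\<lambda>x. F n x - g x) \<le> e / 2" if "n \<ge> N" for n
        using *[of "e / 2" n] that \<open>0 < e\<close> by (meson half_gt_zero le_trans less_imp_le)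
      then show "\<exists>N. \<forall>n\<ge>N. norm (L2_norm (\<lambda>x. F n x - g x) - 0) < e"
        using \<open>0 < e\<close> by (intro exI[of _ N]) fastforce
    qed
    then show "L2_converges F g"
      using F g by (simp add: L2_converges_def)
  qed
qed

section \<open>Density of continuous functions and continuity of translations\<close>

lemma continuous_compact_support_L2:
  assumes cont: "continuous_on UNIV g" and zero: "\<And>x. R < norm x \<Longrightarrow> g x = 0"
  shows "square_integrable g" "\<exists>B\<ge>0. \<forall>x. cmod (g x) \<le> B * cmod (indicator (cball 0 R) x)"
proof -
  have "compact (g ` cball 0 R)"
    by (intro compact_continuous_image continuous_on_subset[OF cont]) auto
  then obtain B where B: "\<And>x. x \<in> cball 0 R \<Longrightarrow> cmod (g x) \<le> B" "0 < B"
    using bounded_pos[of "g ` cball 0 R"] compact_imp_bounded by blast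
  then have le: "cmod (g x) \<le> B * cmod (indicator (cball 0 R) x)" for x
    using zero[of x] by (cases "norm x \<le> R") auto
  then show "\<exists>B\<ge>0. \<forall>x. cmod (g x) \<le> B * cmod (indicator (cball 0 R) x)"
    using B(2) by (auto intro!: exI[of _ B])
  show "square_integrable g"
    using L2_norm_le[OF borel_measurable_continuous_onI[OF cont] square_integrable_indicator_cball le]
      B(2) by simp
qed

text \<open>Truncate \<open>f\<close> in space and in size, then use that a measurable function is
  an almost everywhere limit of continuous ones. These are cut down to a common bound and a common
  support, so that dominated convergence gives convergence in norm.\<close>

lemma L2_dense_continuous:
  assumes f: "square_integrable f" and "0 < e"
  shows "\<exists>g R. continuous_on UNIV g \<and> (\<forall>x. R < norm x \<longrightarrow> g x = 0) \<and> L2_norm (\<lambda>x. f x - g x) < e"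
proof -
  have fm [measurable]: "f \<in> borel_measurable borel"
    using f by measurable
  define T where "T m x = (if norm x \<le> real m \<and> cmod (f x) \<le> real m then f x else 0)" for m x
  have Tm [measurable]: "T m \<in> borel_measurable borel" for m
    unfolding T_def by measurable
  have "L2_converges T f"
  proof (rule L2_converges_dominated[OF Tm f _ f])
    have "(\<lambda>m. T m x) \<longlonglongrightarrow> f x" for x
    proof (rule tendsto_eventually)
      show "\<forall>\<^sub>F m in sequentially. T m x = f x"
        unfolding eventually_sequentially
      proof (intro exI allI impI)
        fix m assume "nat \<lceil>max (norm x) (cmod (f x))\<rceil> \<le> m"
        then have "max (norm x) (cmod (f x)) \<le> real m" by linarith
        then show "T m x = f x" by (simp add: T_def)
      qed
    qed
    then show "AE x in lborel. (\<lambda>m. T m x) \<longlonglongrightarrow> f x" by simp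
  qed (simp add: T_def)
  from order_tendstoD(2)[OF L2_convergesD(3)[OF this], of "e / 2"] \<open>0 < e\<close>
  obtain m0 where m0: "\<And>m. m \<ge> m0 \<Longrightarrow> L2_norm (\<lambda>x. T m x - f x) < e / 2"
    by (auto simp: eventually_sequentially)
  \<comment> \<open>The successor makes \<open>m\<close> positive, which keeps the quotient in
    \<open>clip\<close> from degenerating to 0/0.\<close>
  define m where "m = Suc m0"
  have m: "L2_norm (\<lambda>x. T m x - f x) < e / 2" "0 < real m"
    using m0 by (auto simp: m_def)
  have T: "square_integrable (T m)"
    using L2_convergesD(1)[OF \<open>L2_converges T f\<close>] .
  have "T m \<in> borel_measurable lebesgue"
    by (rule measurable_completion) (use Tm in simp)
  then have "T m measurable_on UNIV"
    by (simp add: measurable_on_iff_borel_measurable)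
  then obtain N g where N: "negligible N" and g: "\<And>n. continuous_on UNIV (g n)"
    and lim: "\<And>x. x \<notin> N \<Longrightarrow> (\<lambda>n. g n x) \<longlonglongrightarrow> T m x"
    unfolding measurable_on_def by auto
  \<comment> \<open>The radial retraction onto the disc of radius \<open>m\<close>: continuous,
    bounded, and the identity on all values of \<open>T m\<close>.\<close>
  define clip :: "complex \<Rightarrow> complex" where "clip z = (real m / max (real m) (cmod z)) *\<^sub>R z" for z
  have clip: "continuous_on UNIV clip"
    unfolding clip_def using m(2) by (auto intro!: continuous_intros)
  have clip_le: "cmod (clip z) \<le> real m" for z
    using m(2) by (auto simp: clip_def max_def field_simps)
  \<comment> \<open>Equal to 1 on the ball of radius \<open>m\<close>, outside which
    \<open>T m\<close> vanishes, and 0 outside the ball of radius \<open>m + 1\<close>.\<close>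
  define cutoff :: "real ^ 'a \<Rightarrow> real" where "cutoff x = max 0 (min 1 (real m + 1 - norm x))" for x
  have cutoff: "continuous_on UNIV cutoff"
    unfolding cutoff_def by (intro continuous_intros)
  define G where "G n x = cutoff x *\<^sub>R clip (g n x)" for n x
  have G: "continuous_on UNIV (G n)" for n
    unfolding G_def by (intro continuous_intros cutoff continuous_on_compose2[OF clip g]) auto
  have G0: "G n x = 0" if "real m + 1 < norm x" for n x
    using that by (simp add: G_def cutoff_def)
  have "L2_converges G (T m)"
  proof (rule L2_converges_dominated[OF borel_measurable_continuous_onI[OF G] T])
    have "AE x in lebesgue. x \<notin> N"
      using N by (intro AE_not_in) (simp add: negligible_iff_null_sets)
    then have "AE x in lborel. x \<notin> N"
      by (simp add: AE_completion_iff)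
    then show "AE x in lborel. (\<lambda>n. G n x) \<longlonglongrightarrow> T m x"
    proof eventually_elim
      case (elim x)
      have "(\<lambda>n. clip (g n x)) \<longlonglongrightarrow> clip (T m x)"
        using continuous_on_tendsto_compose[OF clip lim[OF elim]] by simp
      then have "(\<lambda>n. G n x) \<longlonglongrightarrow> cutoff x *\<^sub>R clip (T m x)"
        unfolding G_def by (intro tendsto_intros)
      moreover have "cutoff x *\<^sub>R clip (T m x) = T m x"
        using m(2) by (auto simp: T_def cutoff_def clip_def max_def)
      ultimately show ?case by simp
    qed
    show "square_integrable (\<lambda>x. of_nat m * indicator (cball 0 (real m + 1)) x)"
      by (rule square_integrable_bounded_mult(1)[OF _ _ square_integrable_indicator_cball, where c="real m"])
         auto
    show "cmod (G n x) \<le> cmod (of_nat m * indicator (cball 0 (real m + 1)) x)" for n x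
    proof (cases "norm x \<le> real m + 1")
      case True
      have "cmod (G n x) \<le> 1 * real m"
        unfolding G_def norm_scaleR by (intro mult_mono clip_le) (auto simp: cutoff_def)
      then show ?thesis using True by (simp add: norm_mult)
    qed (use G0 in auto)
  qed
  from order_tendstoD(2)[OF L2_convergesD(3)[OF this], of "e / 2"] \<open>0 < e\<close>
  obtain n where n: "L2_norm (\<lambda>x. G n x - T m x) < e / 2"
    by (auto simp: eventually_sequentially)
  have Gn: "square_integrable (G n)"
    by (rule continuous_compact_support_L2(1)[OF G G0])
  have "L2_norm (\<lambda>x. f x - G n x) \<le> L2_norm (\<lambda>x. f x - T m x) + L2_norm (\<lambda>x. T m x - G n x)"
    by (intro L2_norm_triangle_via f T Gn)
  then have "L2_norm (\<lambda>x. f x - G n x) < e"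
    using m(1) n by (simp add: L2_norm_minus_commute[of f "T m"] L2_norm_minus_commute[of "T m" "G n"])
  then show ?thesis
    using G G0 by blast
qed

text \<open>Translations are isometries, so the error of replacing \<open>f\<close> by a continuous
  compactly supported \<open>g\<close> is the same for every shift; for \<open>g\<close> dominated
  convergence applies.\<close>

lemma L2_translation_continuous:
  fixes f :: "real ^ 'n \<Rightarrow> complex"
  assumes f: "square_integrable f" and h: "h \<longlonglongrightarrow> 0"
  shows "(\<lambda>n. L2_norm (\<lambda>x. f (x + h n) - f x)) \<longlonglongrightarrow> 0"
proof (rule LIMSEQ_I)
  fix e :: real assume "0 < e"
  then obtain g R where g: "continuous_on UNIV g" "\<And>x. R < norm x \<Longrightarrow> g x = 0"
    and fg: "L2_norm (\<lambda>x. f x - g x) < e / 3"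
    using L2_dense_continuous[OF f, of "e / 3"] by auto
  have gL2: "square_integrable g"
    by (rule continuous_compact_support_L2(1)[OF g])
  have [measurable]: "g \<in> borel_measurable borel"
    using gL2 by measurable
  obtain B where B: "0 \<le> B" "\<And>x. cmod (g x) \<le> B * cmod (indicator (cball 0 R) x)"
    using continuous_compact_support_L2(2)[OF g] by auto
  obtain N1 where N1: "\<And>n. n \<ge> N1 \<Longrightarrow> norm (h n) < 1"
    using order_tendstoD(2)[OF tendsto_norm_zero[OF h], of 1] by (auto simp: eventually_sequentially)
  \<comment> \<open>Starting at index \<open>N1\<close> keeps all shifts shorter than 1, so one ball
    of radius \<open>R + 1\<close> carries every difference and the dominating function is
    independent of \<open>n\<close>.\<close>
  have "(\<lambda>n. L2_norm (\<lambda>x. g (x + h (n + N1)) - g x)) \<longlonglongrightarrow> 0"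
  proof (rule L2_norm_tendsto_0I)
    have "(\<lambda>n. g (x + h (n + N1)) - g x) \<longlonglongrightarrow> g (x + 0) - g x" for x
      by (intro tendsto_intros continuous_on_tendsto_compose[OF g(1)] LIMSEQ_ignore_initial_segment[OF h])
         auto
    then show "AE x in lborel. (\<lambda>n. g (x + h (n + N1)) - g x) \<longlonglongrightarrow> 0"
      by simp
    show "integrable lborel (\<lambda>x :: real ^ 'n. (2 * B)\<^sup>2 * (cmod (indicator (cball 0 (R + 1)) x))\<^sup>2)"
      by (rule integrable_mult_right) (rule square_integrable_integrable[OF square_integrable_indicator_cball])
    have gB: "cmod (g y) \<le> B" for y
      using B(2)[of y] B(1) by (cases "y \<in> cball 0 R") auto
    show "(cmod (g (x + h (n + N1)) - g x))\<^sup>2 \<le> (2 * B)\<^sup>2 * (cmod (indicator (cball 0 (R + 1)) x))\<^sup>2" for n x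
    proof (cases "norm x \<le> R + 1")
      case True
      have "cmod (g (x + h (n + N1)) - g x) \<le> B + B"
        by (intro order_trans[OF norm_triangle_ineq4] add_mono gB)
      then have "(cmod (g (x + h (n + N1)) - g x))\<^sup>2 \<le> (2 * B)\<^sup>2"
        by (intro power_mono) auto
      then show ?thesis using True by simp
    next
      case False
      have "norm x \<le> norm (x + h (n + N1)) + norm (h (n + N1))"
        using norm_triangle_ineq4[of "x + h (n + N1)" "h (n + N1)"] by simp
      then have "R < norm (x + h (n + N1))"
        using False N1[of "n + N1"] by simp
      then show ?thesis using False g(2) by simp
    qed
  qed measurable
  then obtain N2 where N2: "\<And>n. n \<ge> N2 \<Longrightarrow> L2_norm (\<lambda>x. g (x + h (n + N1)) - g x) < e / 3"
    using order_tendstoD(2)[of _ 0 sequentially "e / 3"] \<open>0 < e\<close> by (auto simp: eventually_sequentially)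
  have "L2_norm (\<lambda>x. f (x + h n) - f x) < e" if "n \<ge> N2 + N1" for n
  proof -
    have le_diff: "N2 \<le> n - N1" and n_eq: "n - N1 + N1 = n"
      using that by auto
    note t = L2_translation(1)[of _ "h n"]
    have "L2_norm (\<lambda>x. f (x + h n) - f x) \<le> L2_norm (\<lambda>x. f (x + h n) - g (x + h n)) +
        L2_norm (\<lambda>x. g (x + h n) - f x)"
      by (intro L2_norm_triangle_via t f gL2)
    also have "L2_norm (\<lambda>x. g (x + h n) - f x) \<le>
        L2_norm (\<lambda>x. g (x + h n) - g x) + L2_norm (\<lambda>x. g x - f x)"
      by (intro L2_norm_triangle_via t f gL2)
    also have "L2_norm (\<lambda>x. f (x + h n) - g (x + h n)) = L2_norm (\<lambda>x. f x - g x)"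
      by (rule L2_translation(2)[OF square_integrable_diff[OF f gL2]])
    also have "L2_norm (\<lambda>x. g x - f x) = L2_norm (\<lambda>x. f x - g x)"
      by (rule L2_norm_minus_commute)
    finally show ?thesis
      using fg N2[of "n - N1", OF le_diff] n_eq by simp
  qed
  then show "\<exists>N. \<forall>n\<ge>N. norm (L2_norm (\<lambda>x. f (x + h n) - f x) - 0) < e"
    by (intro exI[of _ "N2 + N1"]) simp
qed

subsection \<open>Plancherel theorem\<close>

lemma borel_measurable_cis [measurable (raw)]:
  "f \<in> borel_measurable M \<Longrightarrow> (\<lambda>x. cis (f x)) \<in> borel_measurable M"
  by (rule borel_measurable_continuous_on[of cis]) (auto intro: continuous_intros)

text \<open>Normalised so that \<open>a = 1\<close> has integral 1 and is its own Fourier transform.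
  As \<open>a\<close> decreases to 0 the function increases to 1.\<close>

definition gaussian :: "real \<Rightarrow> 'a::euclidean_space \<Rightarrow> real" where
  "gaussian a x = exp (- (pi * a\<^sup>2 * (norm x)\<^sup>2))"

lemma gaussian_measurable [measurable]: "gaussian a \<in> borel_measurable borel"
  unfolding gaussian_def by measurable

lemma gaussian_bounds: "0 < gaussian a x" "gaussian a x \<le> 1"
  by (simp_all add: gaussian_def)

text \<open>The characteristic function of the standard normal law after rescaling: \<open>c\<close>
  turns \<open>x^2 / 2\<close> into \<open>pi * a^2 * s^2\<close>, and \<open>t\<close> turns the
  phase \<open>t * x\<close> into \<open>2 * pi * z * s\<close>.\<close>

lemma gaussian_real_fourier:
  assumes "0 < a"
  shows "integrable lborel (\<lambda>s::real. cis (2 * pi * (z * s)) * complex_of_real (exp (- (pi * a\<^sup>2 * s\<^sup>2))))"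
    and "(\<integral>s. cis (2 * pi * (z * s)) * complex_of_real (exp (- (pi * a\<^sup>2 * s\<^sup>2))) \<partial>lborel) =
      complex_of_real (exp (- (pi * z\<^sup>2 / a\<^sup>2)) / a)"
proof -
  define c where "c = sqrt (2 * pi) * a"
  define t where "t = sqrt (2 * pi) * z / a"
  define h where "h x = std_normal_density x *\<^sub>R iexp (t * x)" for x
  have c: "c \<noteq> 0" "\<bar>c\<bar> = c"
    using assms by (auto simp: c_def)
  have hm: "h \<in> borel_measurable borel"
    unfolding h_def by measurable
  interpret prob_space std_normal_distribution
    by (rule prob_space_normal_density) simp
  have "integrable std_normal_distribution (\<lambda>x. iexp (t * x))"
    by (rule integrable_const_bound[where B=1]) auto
  then have hi: "integrable lborel h"
    unfolding h_def by (subst (asm) integrable_density) auto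
  have hI: "integral\<^sup>L lborel h = complex_of_real (exp (- (t\<^sup>2) / 2))"
    using char_std_normal_distribution unfolding char_def h_def fun_eq_iff
    by (subst (asm) integral_density) auto
  have hs: "h (0 + c *\<^sub>R s) = complex_of_real (1 / sqrt (2 * pi)) *
      (cis (2 * pi * (z * s)) * complex_of_real (exp (- (pi * a\<^sup>2 * s\<^sup>2))))" for s
  proof -
    have "t * (c * s) = 2 * pi * (z * s)"
      using assms by (simp add: t_def c_def field_simps flip: power2_eq_square)
    then have phase: "iexp (t * (c * s)) = cis (2 * pi * (z * s))"
      by (simp only: cis_conv_exp)
    have "(c * s)\<^sup>2 = 2 * (pi * a\<^sup>2 * s\<^sup>2)"
      by (simp add: c_def power_mult_distrib)
    then show ?thesis
      unfolding h_def real_scaleR_def add_0_left phase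
      by (simp add: std_normal_density_def scaleR_conv_of_real)
  qed
  have t2: "t\<^sup>2 / 2 = pi * z\<^sup>2 / a\<^sup>2"
    by (simp add: t_def power_mult_distrib power_divide)
  have "integrable lborel (\<lambda>s. complex_of_real (1 / sqrt (2 * pi)) *
      (cis (2 * pi * (z * s)) * complex_of_real (exp (- (pi * a\<^sup>2 * s\<^sup>2)))))"
    using hi lborel_affine_change(1)[OF c(1) hm, of 0] unfolding hs by blast
  then have "integrable lborel (\<lambda>s. complex_of_real (sqrt (2 * pi)) * (complex_of_real (1 / sqrt (2 * pi)) *
      (cis (2 * pi * (z * s)) * complex_of_real (exp (- (pi * a\<^sup>2 * s\<^sup>2))))))"
    by (rule integrable_mult_right)
  moreover have "complex_of_real (sqrt (2 * pi)) * (complex_of_real (1 / sqrt (2 * pi)) * w) = w" for w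
    by simp
  ultimately show "integrable lborel (\<lambda>s. cis (2 * pi * (z * s)) * complex_of_real (exp (- (pi * a\<^sup>2 * s\<^sup>2))))"
    by (simp only:)
  show "(\<integral>s. cis (2 * pi * (z * s)) * complex_of_real (exp (- (pi * a\<^sup>2 * s\<^sup>2))) \<partial>lborel) =
      complex_of_real (exp (- (pi * z\<^sup>2 / a\<^sup>2)) / a)"
    using lborel_affine_change(2)[OF c(1) hm, of 0] assms t2
    unfolding hs hI integral_mult_right_zero c(2) by (simp add: c_def field_simps scaleR_conv_of_real)
qed

text \<open>Lebesgue measure is the image of a product of one-dimensional measures, so a tensor
  product integrates factor by factor. It lifts the Gaussian integral to all dimensions.\<close>

lemma lborel_integral_prod:
  fixes f :: "'a::euclidean_space \<Rightarrow> real \<Rightarrow> complex"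
  assumes f: "\<And>b. b \<in> Basis \<Longrightarrow> integrable lborel (f b)"
  shows "integrable lborel (\<lambda>x. \<Prod>b\<in>Basis. f b (x \<bullet> b))"
    and "(\<integral>x. (\<Prod>b\<in>Basis. f b (x \<bullet> b)) \<partial>lborel) = (\<Prod>b\<in>Basis. integral\<^sup>L lborel (f b))"
proof -
  interpret product_sigma_finite "\<lambda>_::'a. lborel :: real measure"
    by standard
  have fm: "\<And>b. b \<in> Basis \<Longrightarrow> f b \<in> borel_measurable borel"
    using f by (auto dest: borel_measurable_integrable)
  have m: "(\<lambda>x::'a. \<Prod>b\<in>Basis. f b (x \<bullet> b)) \<in> borel_measurable borel"
    by (intro borel_measurable_prod measurable_compose[OF _ fm]) auto
  have T: "(\<lambda>g. \<Sum>b\<in>Basis. g b *\<^sub>R b) \<in> (\<Pi>\<^sub>M b\<in>(Basis :: 'a set). lborel) \<rightarrow>\<^sub>M (borel :: 'a measure)"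
    by measurable
  have eq: "(lborel :: 'a measure) = distr (\<Pi>\<^sub>M b\<in>Basis. lborel) borel (\<lambda>g. \<Sum>b\<in>Basis. g b *\<^sub>R b)"
    by (rule lborel_eq)
  show "integrable lborel (\<lambda>x::'a. \<Prod>b\<in>Basis. f b (x \<bullet> b))"
    unfolding eq using product_integrable_prod[OF finite_Basis f]
    by (subst integrable_distr_eq[OF T m]) simp
  show "(\<integral>x. (\<Prod>b\<in>Basis. f b ((x::'a) \<bullet> b)) \<partial>lborel) = (\<Prod>b\<in>Basis. integral\<^sup>L lborel (f b))"
    unfolding eq using product_integral_prod[OF finite_Basis f]
    by (subst integral_distr[OF T m]) simp
qed

lemma gaussian_fourier:
  fixes z :: "'a::euclidean_space"
  assumes "0 < a"
  shows "integrable lborel (\<lambda>x. cis (2 * pi * (z \<bullet> x)) * complex_of_real (gaussian a x))"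
    and "(\<integral>x. cis (2 * pi * (z \<bullet> x)) * complex_of_real (gaussian a x) \<partial>lborel) =
      complex_of_real (gaussian (1 / a) z / a ^ DIM('a))"
proof -
  have eq: "cis (2 * pi * (z \<bullet> x)) * complex_of_real (gaussian a x) =
      (\<Prod>b\<in>Basis. cis (2 * pi * ((z \<bullet> b) * (x \<bullet> b))) * complex_of_real (exp (- (pi * a\<^sup>2 * (x \<bullet> b)\<^sup>2))))" for x
  proof -
    have "cis (2 * pi * (z \<bullet> x)) = (\<Prod>b\<in>Basis. cis (2 * pi * ((z \<bullet> b) * (x \<bullet> b))))"
      unfolding cis_conv_exp exp_sum[OF finite_Basis, symmetric]
      by (subst euclidean_inner[of z x]) (simp add: sum_distrib_left)
    moreover have "gaussian a x = (\<Prod>b\<in>Basis. exp (- (pi * a\<^sup>2 * (x \<bullet> b)\<^sup>2)))"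
      unfolding gaussian_def exp_sum[OF finite_Basis, symmetric] power2_norm_eq_inner
      by (subst euclidean_inner[of x x]) (simp add: sum_distrib_left sum_negf power2_eq_square)
    ultimately show ?thesis
      by (simp add: prod.distrib)
  qed
  note real = gaussian_real_fourier[OF assms]
  show "integrable lborel (\<lambda>x. cis (2 * pi * (z \<bullet> x)) * complex_of_real (gaussian a x))"
    unfolding eq by (rule lborel_integral_prod(1)) (rule real(1))
  have "(\<integral>x. cis (2 * pi * (z \<bullet> x)) * complex_of_real (gaussian a x) \<partial>lborel) =
      (\<Prod>b\<in>(Basis :: 'a set). complex_of_real (exp (- (pi * (z \<bullet> b)\<^sup>2 / a\<^sup>2)) / a))"
    unfolding eq by (subst lborel_integral_prod(2)) (simp_all only: real)
  also have "\<dots> = complex_of_real ((\<Prod>b\<in>(Basis :: 'a set). exp (- (pi * (z \<bullet> b)\<^sup>2 / a\<^sup>2))) / a ^ DIM('a))"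
    by (simp add: prod_dividef)
  also have "(\<Prod>b\<in>(Basis :: 'a set). exp (- (pi * (z \<bullet> b)\<^sup>2 / a\<^sup>2))) = gaussian (1 / a) z"
    unfolding gaussian_def exp_sum[OF finite_Basis, symmetric] power2_norm_eq_inner
    by (subst euclidean_inner[of z z])
       (simp add: sum_distrib_left sum_negf power2_eq_square sum_divide_distrib)
  finally show "(\<integral>x. cis (2 * pi * (z \<bullet> x)) * complex_of_real (gaussian a x) \<partial>lborel) =
      complex_of_real (gaussian (1 / a) z / a ^ DIM('a))" .
qed

lemma gaussian_integrable: "0 < a \<Longrightarrow> integrable lborel (gaussian a :: 'a::euclidean_space \<Rightarrow> real)"
  using gaussian_fourier(1)[of a "0 :: 'a"] by (simp add: complex_of_real_integrable_eq)

lemma gaussian_integral: "integral\<^sup>L lborel (gaussian 1 :: 'a::euclidean_space \<Rightarrow> real) = 1"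
proof -
  have "complex_of_real (integral\<^sup>L lborel (gaussian 1 :: 'a \<Rightarrow> real)) = complex_of_real 1"
    using gaussian_fourier(2)[of 1 "0 :: 'a"] unfolding integral_complex_of_real[symmetric]
    by (simp add: gaussian_def)
  then show ?thesis
    by (simp only: of_real_eq_iff)
qed

lemma integrable_cis_mult:
  fixes f :: "'a::euclidean_space \<Rightarrow> complex"
  assumes f: "integrable lborel f" and [measurable]: "\<theta> \<in> borel_measurable borel"
  shows "integrable lborel (\<lambda>x. cis (\<theta> x) * f x)"
proof (rule Bochner_Integration.integrable_bound[OF f])
  show "(\<lambda>x. cis (\<theta> x) * f x) \<in> borel_measurable lborel"
    using borel_measurable_integrable[OF f] by simp
qed (simp add: norm_mult)

text \<open>The multiplication formula that moves a Fourier transform from one factor to the other.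
  The constant \<open>c\<close> is left free so that both signs of the phase are covered.\<close>

lemma Fubini_cis:
  fixes p q :: "'a::euclidean_space \<Rightarrow> complex"
  assumes p: "integrable lborel p" and q: "integrable lborel q"
  shows "(\<integral>x. p x * (\<integral>y. cis (c * (x \<bullet> y)) * q y \<partial>lborel) \<partial>lborel) =
    (\<integral>y. q y * (\<integral>x. cis (c * (x \<bullet> y)) * p x \<partial>lborel) \<partial>lborel)"
proof -
  have [measurable]: "p \<in> borel_measurable borel" "q \<in> borel_measurable borel"
    using p q by (auto dest: borel_measurable_integrable)
  have "integrable (lborel \<Otimes>\<^sub>M lborel) (\<lambda>(x, y). p x * (cis (c * (x \<bullet> y)) * q y))"
  proof (rule lborel_pair.Fubini_integrable)
    show "(\<lambda>(x, y). p x * (cis (c * (x \<bullet> y)) * q y)) \<in> borel_measurable (lborel \<Otimes>\<^sub>M lborel)"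
      by measurable
    have "integrable lborel (\<lambda>x. cmod (p x) * (\<integral>y. cmod (q y) \<partial>lborel))"
      using p by simp
    then show "integrable lborel (\<lambda>x. \<integral>y. cmod (case (x, y) of (x, y) \<Rightarrow> p x * (cis (c * (x \<bullet> y)) * q y)) \<partial>lborel)"
      by (simp add: norm_mult)
    show "AE x in lborel. integrable lborel (\<lambda>y. case (x, y) of (x, y) \<Rightarrow> p x * (cis (c * (x \<bullet> y)) * q y))"
      by (auto intro!: AE_I2 integrable_mult_right integrable_cis_mult[OF q])
  qed
  from lborel_pair.Fubini_integral[OF this]
  have "(\<integral>y. \<integral>x. p x * (cis (c * (x \<bullet> y)) * q y) \<partial>lborel \<partial>lborel) =
      (\<integral>x. \<integral>y. p x * (cis (c * (x \<bullet> y)) * q y) \<partial>lborel \<partial>lborel)" .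
  also have "(\<integral>y. \<integral>x. p x * (cis (c * (x \<bullet> y)) * q y) \<partial>lborel \<partial>lborel) =
      (\<integral>y. \<integral>x. q y * (cis (c * (x \<bullet> y)) * p x) \<partial>lborel \<partial>lborel)"
    by (simp only: mult_ac)
  finally show ?thesis
    by simp
qed

section \<open>Plancherel for integrable square-integrable functions\<close>

lemma fourier_measurable [measurable]:
  assumes [measurable]: "f \<in> borel_measurable borel"
  shows "fourier f \<in> borel_measurable borel"
  unfolding fourier_def by measurable

lemma cmod_fourier_le:
  assumes "integrable lborel f"
  shows "cmod (fourier f \<xi>) \<le> (\<integral>x. cmod (f x) \<partial>lborel)"
proof -
  have "cmod (fourier f \<xi>) \<le> (\<integral>x. cmod (cis (- 2 * pi * (x \<bullet> \<xi>)) * f x) \<partial>lborel)"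
    unfolding fourier_def by (rule integral_norm_bound)
  then show ?thesis
    by (simp add: norm_mult)
qed

text \<open>The Gaussian weight makes Fubini applicable before \<^term>\<open>fourier u\<close> is known to be square
  integrable; it disappears in the limit \<open>a \<rightarrow> 0\<close>.\<close>

lemma gaussian_weighted_Plancherel:
  fixes u :: "real ^ 'n \<Rightarrow> complex"
  assumes i: "integrable lborel u" and u: "square_integrable u" and a: "0 < a"
  shows "integrable lborel (\<lambda>\<xi>. (cmod (fourier u \<xi>))\<^sup>2 * gaussian a \<xi>)"
    and "complex_of_real (\<integral>\<xi>. (cmod (fourier u \<xi>))\<^sup>2 * gaussian a \<xi> \<partial>lborel) =
      (\<integral>w. complex_of_real (gaussian 1 w) * L2_inner u (\<lambda>x. u (x + a *\<^sub>R w)) \<partial>lborel)"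
proof -
  have [measurable]: "u \<in> borel_measurable borel"
    using u by measurable
  define B where "B = (\<integral>x. cmod (u x) \<partial>lborel)"
  have B: "cmod (fourier u \<xi>) \<le> B" for \<xi>
    unfolding B_def by (rule cmod_fourier_le[OF i])
  note g = gaussian_integrable[OF a, where 'a="real ^ 'n"]
  have gc: "integrable lborel (\<lambda>\<xi> :: real ^ 'n. complex_of_real (gaussian a \<xi>))"
    using g by (simp add: complex_of_real_integrable_eq)
  show "integrable lborel (\<lambda>\<xi>. (cmod (fourier u \<xi>))\<^sup>2 * gaussian a \<xi>)"
  proof (rule Bochner_Integration.integrable_bound)
    show "integrable lborel (\<lambda>\<xi> :: real ^ 'n. B\<^sup>2 * gaussian a \<xi>)"
      using g by simp
    show "AE \<xi> in lborel. norm ((cmod (fourier u \<xi>))\<^sup>2 * gaussian a \<xi>) \<le> norm (B\<^sup>2 * gaussian a \<xi>)"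
      using B by (auto simp: abs_mult gaussian_bounds less_imp_le intro!: AE_I2 mult_mono power_mono)
  qed measurable
  have gu: "integrable lborel (\<lambda>\<xi>. complex_of_real (gaussian a \<xi>) * cnj (fourier u \<xi>))"
  proof (rule Bochner_Integration.integrable_bound)
    show "integrable lborel (\<lambda>\<xi> :: real ^ 'n. B * gaussian a \<xi>)"
      using g by simp
    have "0 \<le> B" using B[of 0] norm_ge_zero order_trans by blast
    then show "AE \<xi> in lborel. norm (complex_of_real (gaussian a \<xi>) * cnj (fourier u \<xi>)) \<le> norm (B * gaussian a \<xi>)"
      using B by (auto simp: norm_mult abs_mult gaussian_bounds less_imp_le mult.commute[of B] intro!: AE_I2 mult_left_mono)
  qed measurable
  have cu: "integrable lborel (\<lambda>x. cnj (u x))"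
    using i by (rule Bochner_Integration.integrable_cnj)
  have cnj_fourier: "cnj (fourier u \<xi>) = (\<integral>y. cis (2 * pi * (\<xi> \<bullet> y)) * cnj (u y) \<partial>lborel)" for \<xi>
    unfolding fourier_def by (subst Bochner_Integration.integral_cnj[symmetric])
      (simp add: cis_cnj inner_commute)
  \<comment> \<open>Gaussian damping of the spectrum is Gaussian averaging in space: at
    \<open>x\<close> the result is the mean of \<open>cnj u\<close> over the points
    \<open>x + a w\<close>, with \<open>w\<close> distributed by the standard Gaussian.\<close>
  have inner: "(\<integral>\<xi>. cis (- 2 * pi * (\<xi> \<bullet> x)) * (complex_of_real (gaussian a \<xi>) * cnj (fourier u \<xi>)) \<partial>lborel) =
      (\<integral>w. cnj (u (x + a *\<^sub>R w)) * complex_of_real (gaussian 1 w) \<partial>lborel)" for x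
  proof -
    have "(\<integral>\<xi>. cis (- 2 * pi * (\<xi> \<bullet> x)) * (complex_of_real (gaussian a \<xi>) * cnj (fourier u \<xi>)) \<partial>lborel) =
        (\<integral>\<xi>. (cis (- 2 * pi * (\<xi> \<bullet> x)) * complex_of_real (gaussian a \<xi>)) *
          (\<integral>y. cis (2 * pi * (\<xi> \<bullet> y)) * cnj (u y) \<partial>lborel) \<partial>lborel)"
      by (simp only: cnj_fourier mult.assoc)
    also have "\<dots> = (\<integral>y. cnj (u y) * (\<integral>\<xi>. cis (2 * pi * (\<xi> \<bullet> y)) *
          (cis (- 2 * pi * (\<xi> \<bullet> x)) * complex_of_real (gaussian a \<xi>)) \<partial>lborel) \<partial>lborel)"
      by (rule Fubini_cis[OF integrable_cis_mult[OF gc] cu]) measurable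
    also have "\<dots> = (\<integral>y. cnj (u y) * complex_of_real (gaussian (1 / a) (y - x) / a ^ DIM(real ^ 'n)) \<partial>lborel)"
      unfolding gaussian_fourier(2)[OF a, symmetric] mult.assoc[symmetric] cis_mult
      by (simp add: inner_diff_left inner_commute algebra_simps)
    \<comment> \<open>Substitution \<open>y = x + a w\<close>; its Jacobian cancels the factor
      \<open>1 / a^n\<close> of the transformed Gaussian.\<close>
    also have "\<dots> = \<bar>a\<bar> ^ DIM(real ^ 'n) *\<^sub>R (\<integral>w. cnj (u (x + a *\<^sub>R w)) *
        complex_of_real (gaussian (1 / a) (x + a *\<^sub>R w - x) / a ^ DIM(real ^ 'n)) \<partial>lborel)"
      by (rule lborel_affine_change(2)) (use a in auto)
    also have "\<dots> = (\<integral>w. cnj (u (x + a *\<^sub>R w)) * complex_of_real (gaussian 1 w) \<partial>lborel)"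
    proof -
      have "gaussian (1 / a) (x + a *\<^sub>R w - x) = gaussian 1 w" for w
        using a by (simp add: gaussian_def power_mult_distrib power_divide)
      then show ?thesis
        using a by (simp add: scaleR_conv_of_real[where 'a=complex])
    qed
    finally show ?thesis .
  qed
  have "complex_of_real (\<integral>\<xi>. (cmod (fourier u \<xi>))\<^sup>2 * gaussian a \<xi> \<partial>lborel) =
      (\<integral>\<xi>. (complex_of_real (gaussian a \<xi>) * cnj (fourier u \<xi>)) * (\<integral>x. cis (- 2 * pi * (\<xi> \<bullet> x)) * u x \<partial>lborel) \<partial>lborel)"
  proof -
    have "(\<integral>x. cis (- 2 * pi * (\<xi> \<bullet> x)) * u x \<partial>lborel) = fourier u \<xi>" for \<xi>
      by (simp add: fourier_def inner_commute)
    then show ?thesis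
      unfolding integral_complex_of_real[symmetric]
      by (simp only: of_real_mult complex_norm_square mult_ac)
  qed
  also have "\<dots> = (\<integral>x. u x * (\<integral>\<xi>. cis (- 2 * pi * (\<xi> \<bullet> x)) * (complex_of_real (gaussian a \<xi>) * cnj (fourier u \<xi>)) \<partial>lborel) \<partial>lborel)"
    by (rule Fubini_cis[OF gu i])
  also have "\<dots> = (\<integral>x. \<integral>w. u x * (cnj (u (x + a *\<^sub>R w)) * complex_of_real (gaussian 1 w)) \<partial>lborel \<partial>lborel)"
    unfolding inner by simp
  \<comment> \<open>Absolute integrability on the product: by Cauchy-Schwarz and translation
    invariance the integral over \<open>x\<close> is at most the squared norm of \<open>u\<close>,
    uniformly in \<open>w\<close>, and the Gaussian is integrable in \<open>w\<close>.\<close>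
  also have "\<dots> = (\<integral>w. \<integral>x. u x * (cnj (u (x + a *\<^sub>R w)) * complex_of_real (gaussian 1 w)) \<partial>lborel \<partial>lborel)"
  proof (rule lborel_pair.Fubini_integral, rule lborel_pair.Fubini_integrable)
    note t = L2_translation[OF u]
    show "(\<lambda>(w, x). u x * (cnj (u (x + a *\<^sub>R w)) * complex_of_real (gaussian 1 w)))
        \<in> borel_measurable (lborel \<Otimes>\<^sub>M lborel)"
      by measurable
    have ii: "integrable lborel (\<lambda>x. u x * cnj (u (x + a *\<^sub>R w)))" for w
      by (intro integrable_mult_L2 square_integrable_cnj t u)
    show "AE w in lborel. integrable lborel (\<lambda>x. case (w, x) of (w, x) \<Rightarrow>
        u x * (cnj (u (x + a *\<^sub>R w)) * complex_of_real (gaussian 1 w)))"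
      using ii by (auto intro!: AE_I2 simp flip: mult.assoc)
    show "integrable lborel (\<lambda>w. \<integral>x. cmod (case (w, x) of (w, x) \<Rightarrow>
        u x * (cnj (u (x + a *\<^sub>R w)) * complex_of_real (gaussian 1 w))) \<partial>lborel)"
    proof (rule Bochner_Integration.integrable_bound)
      show "integrable lborel (\<lambda>w :: real ^ 'n. (L2_norm u * L2_norm u) * gaussian 1 w)"
        using gaussian_integrable[of 1, where 'a="real ^ 'n"] by simp
      have "(\<integral>x. cmod (u x) * (cmod (u (x + a *\<^sub>R w)) * gaussian 1 w) \<partial>lborel) \<le>
          L2_norm u * L2_norm u * gaussian 1 w" for w
      proof -
        have "(\<integral>x. cmod (u x) * (cmod (u (x + a *\<^sub>R w)) * gaussian 1 w) \<partial>lborel) =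
            (\<integral>x. cmod (u x) * cmod (u (x + a *\<^sub>R w)) \<partial>lborel) * gaussian 1 w"
          by (simp flip: mult.assoc)
        also have "\<dots> \<le> L2_norm u * L2_norm u * gaussian 1 w"
          using Cauchy_Schwarz_L2[OF u t(1), of "a *\<^sub>R w"]
          by (intro mult_right_mono) (auto simp: t gaussian_bounds less_imp_le)
        finally show ?thesis .
      qed
      then show "AE w in lborel. norm (\<integral>x. cmod (case (w, x) of (w, x) \<Rightarrow>
          u x * (cnj (u (x + a *\<^sub>R w)) * complex_of_real (gaussian 1 w))) \<partial>lborel) \<le>
          norm ((L2_norm u * L2_norm u) * gaussian 1 w)"
        by (auto simp: norm_mult gaussian_bounds less_imp_le abs_mult)
    qed measurable
  qed
  also have "\<dots> = (\<integral>w. complex_of_real (gaussian 1 w) * L2_inner u (\<lambda>x. u (x + a *\<^sub>R w)) \<partial>lborel)"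
    unfolding L2_inner_def integral_mult_right_zero[symmetric] by (simp only: mult_ac)
  finally show "complex_of_real (\<integral>\<xi>. (cmod (fourier u \<xi>))\<^sup>2 * gaussian a \<xi> \<partial>lborel) =
      (\<integral>w. complex_of_real (gaussian 1 w) * L2_inner u (\<lambda>x. u (x + a *\<^sub>R w)) \<partial>lborel)" .
qed

text \<open>Let \<open>a\<close> tend to 0 in the weighted identity. On the right, continuity of
  translations and dominated convergence give the squared norm of \<open>u\<close>. On the left the
  weights increase to 1, so monotone convergence yields integrability of the squared transform
  together with its integral.\<close>

theorem Plancherel_L1:
  fixes u :: "real ^ 'n \<Rightarrow> complex"
  assumes i: "integrable lborel u" and u: "square_integrable u"
  shows "square_integrable (fourier u)" "L2_norm (fourier u) = L2_norm u"
proof -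
  have [measurable]: "u \<in> borel_measurable borel"
    using u by measurable
  note t = L2_translation[OF u]
  \<comment> \<open>Any positive sequence decreasing to 0 serves; the monotonicity makes the
    Gaussian weights increase.\<close>
  define a :: "nat \<Rightarrow> real" where "a m = inverse (real (Suc m))" for m
  have a: "0 < a m" for m
    by (simp add: a_def)
  have a_lim: "a \<longlonglongrightarrow> 0"
    unfolding a_def by (rule LIMSEQ_inverse_real_of_nat)
  have a_mono: "a n \<le> a m" if "m \<le> n" for m n
    using that by (simp add: a_def field_simps)
  let ?I = "\<lambda>m. \<integral>\<xi>. (cmod (fourier u \<xi>))\<^sup>2 * gaussian (a m) \<xi> \<partial>lborel"
  have "(\<lambda>m. \<integral>w. complex_of_real (gaussian 1 w) * L2_inner u (\<lambda>x. u (x + a m *\<^sub>R w)) \<partial>lborel)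
      \<longlonglongrightarrow> (\<integral>w. complex_of_real (gaussian 1 (w :: real ^ 'n)) * L2_inner u u \<partial>lborel)"
  proof (rule integral_dominated_convergence[where w="\<lambda>w. L2_norm u * L2_norm u * gaussian 1 w"])
    show "integrable lborel (\<lambda>w :: real ^ 'n. L2_norm u * L2_norm u * gaussian 1 w)"
      using gaussian_integrable[of 1, where 'a="real ^ 'n"] by simp
    have "(\<lambda>m. L2_inner u (\<lambda>x. u (x + a m *\<^sub>R w))) \<longlonglongrightarrow> L2_inner u u" for w
    proof (rule L2_converges_inner)
      show "L2_converges (\<lambda>m. u) u"
        using u by (simp add: L2_converges_def L2_norm_def)
      have "(\<lambda>m. a m *\<^sub>R w) \<longlonglongrightarrow> 0"
        using tendsto_scaleR[OF a_lim tendsto_const[of w]] by simp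
      then show "L2_converges (\<lambda>m x. u (x + a m *\<^sub>R w)) u"
        using u t L2_translation_continuous[OF u] by (simp add: L2_converges_def)
    qed
    then show "AE w in lborel. (\<lambda>m. complex_of_real (gaussian 1 w) * L2_inner u (\<lambda>x. u (x + a m *\<^sub>R w)))
        \<longlonglongrightarrow> complex_of_real (gaussian 1 w) * L2_inner u u"
      by (intro AE_I2 tendsto_intros)
    have "cmod (L2_inner u (\<lambda>x. u (x + a m *\<^sub>R w))) \<le> L2_norm u * L2_norm u" for m w
      using cmod_L2_inner_le[OF u t(1), of "a m *\<^sub>R w"] by (simp add: t)
    then show "AE w in lborel. norm (complex_of_real (gaussian 1 w) * L2_inner u (\<lambda>x. u (x + a m *\<^sub>R w)))
        \<le> L2_norm u * L2_norm u * gaussian 1 w" for m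
      by (simp add: norm_mult gaussian_bounds less_imp_le mult.commute[of _ "gaussian 1 _"] mult_left_mono)
  qed (simp_all add: L2_inner_def)
  moreover have "(\<integral>w. complex_of_real (gaussian 1 (w :: real ^ 'n)) * L2_inner u u \<partial>lborel) =
      complex_of_real ((L2_norm u)\<^sup>2)"
    by (simp add: gaussian_integral L2_inner_self)
  ultimately have "(\<lambda>m. complex_of_real (?I m)) \<longlonglongrightarrow> complex_of_real ((L2_norm u)\<^sup>2)"
    by (simp only: gaussian_weighted_Plancherel(2)[OF i u a])
  then have lim: "?I \<longlonglongrightarrow> (L2_norm u)\<^sup>2"
    by (rule tendsto_of_real_iff[THEN iffD1])
  have mono: "AE \<xi> in lborel. mono (\<lambda>m. (cmod (fourier u \<xi>))\<^sup>2 * gaussian (a m) \<xi>)"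
  proof (intro AE_I2 monoI mult_left_mono)
    fix \<xi> m n assume "(m::nat) \<le> n"
    then show "gaussian (a m) \<xi> \<le> gaussian (a n) \<xi>"
      using power_mono[OF a_mono[of m n] less_imp_le[OF a[of n]], of 2]
      by (simp add: gaussian_def mult_right_mono)
  qed simp
  have pw: "AE \<xi> in lborel. (\<lambda>m. (cmod (fourier u \<xi>))\<^sup>2 * gaussian (a m) \<xi>) \<longlonglongrightarrow> (cmod (fourier u \<xi>))\<^sup>2"
  proof (rule AE_I2)
    fix \<xi> :: "real ^ 'n"
    have "(\<lambda>m. (cmod (fourier u \<xi>))\<^sup>2 * gaussian (a m) \<xi>) \<longlonglongrightarrow>
        (cmod (fourier u \<xi>))\<^sup>2 * exp (- (pi * 0\<^sup>2 * (norm \<xi>)\<^sup>2))"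
      unfolding gaussian_def by (intro tendsto_intros a_lim)
    then show "(\<lambda>m. (cmod (fourier u \<xi>))\<^sup>2 * gaussian (a m) \<xi>) \<longlonglongrightarrow> (cmod (fourier u \<xi>))\<^sup>2"
      by simp
  qed
  have m: "(\<lambda>\<xi>. (cmod (fourier u \<xi>))\<^sup>2) \<in> borel_measurable lborel"
    by measurable
  note conv = gaussian_weighted_Plancherel(1)[OF i u a] mono pw lim m
  show "square_integrable (fourier u)"
    using integrable_monotone_convergence[OF conv] by (simp add: square_integrable_def)
  show "L2_norm (fourier u) = L2_norm u"
    using integral_monotone_convergence[OF conv] by (simp add: L2_norm_def)
qed

text \<open>With invariance of the norm under reflection, this gives the inverse transform its
  isometry without a second Plancherel argument.\<close>

lemma inv_fourier_eq: "inv_fourier g x = fourier g (- x)"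
  by (simp add: inv_fourier_def fourier_def inner_commute)

lemma inv_fourier_measurable [measurable]:
  assumes [measurable]: "f \<in> borel_measurable borel"
  shows "inv_fourier f \<in> borel_measurable borel"
  unfolding inv_fourier_def by measurable

lemma inv_fourier_isometry:
  fixes g :: "real ^ 'n \<Rightarrow> complex"
  assumes "integrable lborel g" "square_integrable g"
  shows "square_integrable (inv_fourier g)" "L2_norm (inv_fourier g) = L2_norm g"
  using L2_reflection[OF Plancherel_L1(1)[OF assms]] Plancherel_L1(2)[OF assms]
  by (simp_all add: inv_fourier_eq[abs_def])

subsection \<open>The Fourier transform on square-integrable functions and multipliers\<close>

lemma fourier_diff:
  assumes "integrable lborel f" "integrable lborel g"
  shows "fourier (\<lambda>x. f x - g x) \<xi> = fourier f \<xi> - fourier g \<xi>"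
  using integrable_cis_mult[OF assms(1), of "\<lambda>x. - 2 * pi * (x \<bullet> \<xi>)"]
    integrable_cis_mult[OF assms(2), of "\<lambda>x. - 2 * pi * (x \<bullet> \<xi>)"]
  by (simp add: fourier_def right_diff_distrib)

lemma L2_norm_fourier_diff:
  assumes "integrable lborel f" "square_integrable f" "integrable lborel g" "square_integrable g"
  shows "L2_norm (\<lambda>\<xi>. fourier f \<xi> - fourier g \<xi>) = L2_norm (\<lambda>x. f x - g x)"
proof -
  have "fourier (\<lambda>x. f x - g x) = (\<lambda>\<xi>. fourier f \<xi> - fourier g \<xi>)"
    by (rule ext) (rule fourier_diff[OF assms(1,3)])
  then show ?thesis
    using Plancherel_L1(2)[of "\<lambda>x. f x - g x"] assms by (simp add: square_integrable_diff)
qed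

lemma L2_converges_Cauchy:
  assumes F: "L2_converges F f" and "0 < e"
  shows "\<exists>N. \<forall>m\<ge>N. \<forall>n\<ge>N. L2_norm (\<lambda>x. F m x - F n x) < e"
proof -
  note F' = L2_convergesD[OF F]
  obtain N where N: "\<And>m. m \<ge> N \<Longrightarrow> L2_norm (\<lambda>x. F m x - f x) < e / 2"
    using order_tendstoD(2)[OF F'(3), of "e / 2"] \<open>0 < e\<close> by (auto simp: eventually_sequentially)
  have "L2_norm (\<lambda>x. F m x - F n x) < e" if "m \<ge> N" "n \<ge> N" for m n
    using L2_norm_triangle_via[OF F'(1) F'(2) F'(1), of m n] N[OF that(1)] N[OF that(2)]
      L2_norm_minus_commute[of f "F n"] by simp
  then show ?thesis by blast
qed

text \<open>By Plancherel the transforms of the truncations form a Cauchy sequence, and completeness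
  supplies a limit. Any other sequence of integrable approximants differs from the truncations by a
  null sequence in norm, hence so do the transforms, and the limit is the same.\<close>

lemma is_fourier_L2_exists:
  assumes f: "square_integrable f"
  shows "\<exists>g. is_fourier_L2 f g"
proof -
  obtain F where i: "\<And>m. integrable lborel (F m)" and F: "L2_converges F f"
    by (rule that[OF L2_approx_integrable[OF f]])
  note F' = L2_convergesD[OF F]
  have "\<exists>g. L2_converges (\<lambda>m. fourier (F m)) g"
    by (rule L2_complete)
       (use Plancherel_L1(1)[OF i F'(1)] L2_converges_Cauchy[OF F]
         in \<open>simp_all add: L2_norm_fourier_diff[OF i F'(1) i F'(1)]\<close>)
  then obtain g where g: "L2_converges (\<lambda>m. fourier (F m)) g"
    by blast
  note g' = L2_convergesD[OF g]
  have "L2_converges (\<lambda>m. fourier (G m)) g"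
    if iG: "\<And>m. integrable lborel (G m)" and G: "L2_converges G f" for G
  proof -
    note G' = L2_convergesD[OF G]
    have FG: "square_integrable (fourier (G m))" for m
      by (rule Plancherel_L1(1)[OF iG G'(1)])
    have "(\<lambda>m. L2_norm (\<lambda>x. fourier (G m) x - g x)) \<longlonglongrightarrow> 0"
    proof (rule Lim_null_comparison)
      show "\<forall>\<^sub>F m in sequentially. norm (L2_norm (\<lambda>x. fourier (G m) x - g x)) \<le>
          L2_norm (\<lambda>x. G m x - f x) + L2_norm (\<lambda>x. F m x - f x) +
          L2_norm (\<lambda>x. fourier (F m) x - g x)"
      proof (rule always_eventually, rule allI)
        fix m
        have "L2_norm (\<lambda>x. fourier (G m) x - g x) \<le> L2_norm (\<lambda>x. fourier (G m) x - fourier (F m) x) +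
            L2_norm (\<lambda>x. fourier (F m) x - g x)"
          by (rule L2_norm_triangle_via[OF FG g'(1) g'(2)])
        moreover have "L2_norm (\<lambda>x. G m x - F m x) \<le> L2_norm (\<lambda>x. G m x - f x) + L2_norm (\<lambda>x. F m x - f x)"
          using L2_norm_triangle_via[OF G'(1) F'(2) F'(1), of m m] L2_norm_minus_commute[of f "F m"]
          by simp
        ultimately show "norm (L2_norm (\<lambda>x. fourier (G m) x - g x)) \<le>
          L2_norm (\<lambda>x. G m x - f x) + L2_norm (\<lambda>x. F m x - f x) + L2_norm (\<lambda>x. fourier (F m) x - g x)"
          by (simp add: L2_norm_fourier_diff[OF iG G'(1) i F'(1)])
      qed
      show "(\<lambda>m. L2_norm (\<lambda>x. G m x - f x) + L2_norm (\<lambda>x. F m x - f x) +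
          L2_norm (\<lambda>x. fourier (F m) x - g x)) \<longlonglongrightarrow> 0"
        by (intro tendsto_add_zero G'(3) F'(3) g'(3))
    qed
    then show ?thesis
      using FG g'(2) by (simp add: L2_converges_def)
  qed
  then show ?thesis
    unfolding is_fourier_L2_def by blast
qed

text \<open>The working interface to the Hilbert choice: afterwards \<open>fourier_L2 f\<close> is
  handled only as a norm limit of transforms of integrable functions.\<close>

lemma fourier_L2_converges:
  assumes F: "L2_converges F f" and i: "\<And>m. integrable lborel (F m)"
  shows "L2_converges (\<lambda>m. fourier (F m)) (fourier_L2 f)"
proof -
  have "is_fourier_L2 f (fourier_L2 f)"
    unfolding fourier_L2_def by (rule someI_ex[OF is_fourier_L2_exists[OF L2_convergesD(2)[OF F]]])
  then show ?thesis
    using assms by (simp add: is_fourier_L2_def)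
qed

lemma fourier_L2_isometry:
  assumes f: "square_integrable f"
  shows "square_integrable (fourier_L2 f)" "L2_norm (fourier_L2 f) = L2_norm f"
proof -
  obtain F where i: "\<And>m. integrable lborel (F m)" and F: "L2_converges F f"
    by (rule that[OF L2_approx_integrable[OF f]])
  note lim = fourier_L2_converges[OF F i]
  show "square_integrable (fourier_L2 f)"
    by (rule L2_convergesD(2)[OF lim])
  show "L2_norm (fourier_L2 f) = L2_norm f"
    using L2_converges_norm[OF lim] L2_converges_norm[OF F]
    unfolding Plancherel_L1(2)[OF i L2_convergesD(1)[OF F]] by (rule LIMSEQ_unique)
qed

lemma L2_converges_bounded_mult:
  assumes F: "L2_converges F f" and h: "h \<in> borel_measurable borel" "\<And>x. cmod (h x) \<le> c"
  shows "L2_converges (\<lambda>m x. h x * F m x) (\<lambda>x. h x * f x)"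
proof -
  note F' = L2_convergesD[OF F]
  have "(\<lambda>m. L2_norm (\<lambda>x. h x * F m x - h x * f x)) \<longlonglongrightarrow> 0"
  proof (rule Lim_null_comparison)
    show "\<forall>\<^sub>F m in sequentially. norm (L2_norm (\<lambda>x. h x * F m x - h x * f x)) \<le> c * L2_norm (\<lambda>x. F m x - f x)"
      using square_integrable_bounded_mult(2)[OF h square_integrable_diff[OF F'(1) F'(2)]]
      by (simp add: right_diff_distrib)
    show "(\<lambda>m. c * L2_norm (\<lambda>x. F m x - f x)) \<longlonglongrightarrow> 0"
      by (rule tendsto_mult_right_zero[OF F'(3)])
  qed
  then show ?thesis
    using square_integrable_bounded_mult(1)[OF h] F' by (simp add: L2_converges_def)
qed

lemma L2_converges_translation_diff:
  assumes F: "L2_converges F f"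
  shows "L2_converges (\<lambda>m x. F m (x + h) - F m x) (\<lambda>x. f (x + h) - f x)"
proof -
  note F' = L2_convergesD[OF F]
  have "(\<lambda>m. L2_norm (\<lambda>x. F m (x + h) - F m x - (f (x + h) - f x))) \<longlonglongrightarrow> 0"
  proof (rule Lim_null_comparison)
    show "\<forall>\<^sub>F m in sequentially. norm (L2_norm (\<lambda>x. F m (x + h) - F m x - (f (x + h) - f x))) \<le>
        L2_norm (\<lambda>x. F m x - f x) + L2_norm (\<lambda>x. F m x - f x)"
    proof (rule always_eventually, rule allI)
      fix m
      note d = square_integrable_diff[OF F'(1)[of m] F'(2)]
      have eq: "(\<lambda>x. F m (x + h) - F m x - (f (x + h) - f x)) =
          (\<lambda>x. (F m (x + h) - f (x + h)) - (F m x - f x))"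
        by (rule ext) simp
      show "norm (L2_norm (\<lambda>x. F m (x + h) - F m x - (f (x + h) - f x))) \<le>
          L2_norm (\<lambda>x. F m x - f x) + L2_norm (\<lambda>x. F m x - f x)"
        using L2_norm_triangle_diff[OF L2_translation(1)[OF d, of h] d] L2_translation(2)[OF d, of h]
        unfolding eq by simp
    qed
    show "(\<lambda>m. L2_norm (\<lambda>x. F m x - f x) + L2_norm (\<lambda>x. F m x - f x)) \<longlonglongrightarrow> 0"
      by (intro tendsto_add_zero F'(3))
  qed
  then show ?thesis
    unfolding L2_converges_def
    by (intro conjI allI square_integrable_diff L2_translation(1) F'(1,2))
qed

lemma integrable_translation:
  fixes f :: "'a::euclidean_space \<Rightarrow> 'b::{banach, second_countable_topology}"
  assumes "integrable lborel f"
  shows "integrable lborel (\<lambda>x. f (x + h))"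
  using lborel_affine_change(1)[of 1 f h] assms borel_measurable_integrable[OF assms]
  by (simp add: add.commute)

lemma cis_mult_left: "cis a * (cis b * v) = cis (a + b) * v"
  by (simp add: cis_mult[symmetric] mult.assoc)

lemma fourier_translation:
  assumes f: "integrable lborel f"
  shows "fourier (\<lambda>x. f (x + h)) \<xi> = cis (2 * pi * (h \<bullet> \<xi>)) * fourier f \<xi>"
proof -
  have [measurable]: "f \<in> borel_measurable borel"
    using borel_measurable_integrable[OF f] by simp
  have "cis (2 * pi * (h \<bullet> \<xi>)) * fourier f \<xi> =
      (\<integral>x. cis (2 * pi * (h \<bullet> \<xi>)) * (cis (- 2 * pi * (x \<bullet> \<xi>)) * f x) \<partial>lborel)"
    by (simp add: fourier_def)
  also have "\<dots> = \<bar>1\<bar> ^ DIM(real ^ 'a) *\<^sub>R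
      (\<integral>x. cis (2 * pi * (h \<bullet> \<xi>)) * (cis (- 2 * pi * ((h + 1 *\<^sub>R x) \<bullet> \<xi>)) * f (h + 1 *\<^sub>R x)) \<partial>lborel)"
    by (rule lborel_affine_change(2)) auto
  also have "\<dots> = fourier (\<lambda>x. f (x + h)) \<xi>"
    unfolding cis_mult_left by (simp add: fourier_def inner_add_left algebra_simps)
  finally show ?thesis ..
qed

lemma cmod_cis_diff_1_le_2: "cmod (cis t - 1) \<le> 2"
  using norm_triangle_ineq4[of "cis t" 1] by simp

text \<open>For integrable approximants a translation becomes a factor of modulus 1 on the Fourier
  side; both sides then pass to the limit. Stating it for norms avoids an almost everywhere identity
  between chosen representatives.\<close>

lemma L2_norm_fourier_L2_translation_diff:
  assumes f: "square_integrable f"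
  shows "L2_norm (\<lambda>\<xi>. (cis (2 * pi * (h \<bullet> \<xi>)) - 1) * fourier_L2 f \<xi>) = L2_norm (\<lambda>x. f (x + h) - f x)"
proof -
  obtain F where i: "\<And>m. integrable lborel (F m)" and F: "L2_converges F f"
    by (rule that[OF L2_approx_integrable[OF f]])
  have "L2_converges (\<lambda>m \<xi>. (cis (2 * pi * (h \<bullet> \<xi>)) - 1) * fourier (F m) \<xi>)
      (\<lambda>\<xi>. (cis (2 * pi * (h \<bullet> \<xi>)) - 1) * fourier_L2 f \<xi>)"
    by (rule L2_converges_bounded_mult[OF fourier_L2_converges[OF F i], where c=2])
       (auto simp: cmod_cis_diff_1_le_2)
  moreover have "(\<lambda>\<xi>. (cis (2 * pi * (h \<bullet> \<xi>)) - 1) * fourier (F m) \<xi>) = fourier (\<lambda>x. F m (x + h) - F m x)" for m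
    by (simp add: fun_eq_iff fourier_diff[OF integrable_translation[OF i] i] fourier_translation[OF i]
        left_diff_distrib)
  ultimately have "(\<lambda>m. L2_norm (fourier (\<lambda>x. F m (x + h) - F m x))) \<longlonglongrightarrow>
      L2_norm (\<lambda>\<xi>. (cis (2 * pi * (h \<bullet> \<xi>)) - 1) * fourier_L2 f \<xi>)"
    using L2_converges_norm by (simp only:)
  moreover note D = L2_converges_translation_diff[OF F, of h]
  have "L2_norm (fourier (\<lambda>x. F m (x + h) - F m x)) = L2_norm (\<lambda>x. F m (x + h) - F m x)" for m
    by (rule Plancherel_L1(2)[OF _ L2_convergesD(1)[OF D]])
       (intro Bochner_Integration.integrable_diff integrable_translation i)
  ultimately have "(\<lambda>m. L2_norm (\<lambda>x. F m (x + h) - F m x)) \<longlonglongrightarrow>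
      L2_norm (\<lambda>\<xi>. (cis (2 * pi * (h \<bullet> \<xi>)) - 1) * fourier_L2 f \<xi>)"
    by simp
  then show ?thesis
    using L2_converges_norm[OF D] by (rule LIMSEQ_unique)
qed

section \<open>Fourier multipliers with bounded, boundedly supported symbols\<close>

text \<open>Such a symbol is itself square integrable, so its product with
  \<open>fourier_L2 f\<close> is both integrable and square integrable and can be inverted by an
  integral. \<open>M\<close> and \<open>R\<close> are kept as parameters because they enter the
  constants.\<close>

definition bounded_symbol :: "real \<Rightarrow> real \<Rightarrow> (real ^ 'n \<Rightarrow> complex) \<Rightarrow> bool" where
  "bounded_symbol M R \<psi> \<longleftrightarrow>
     \<psi> \<in> borel_measurable borel \<and> (\<forall>\<xi>. cmod (\<psi> \<xi>) \<le> M) \<and> (\<forall>\<xi>. R < norm \<xi> \<longrightarrow> \<psi> \<xi> = 0)"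

text \<open>\<open>LP_op\<close> with the dilated symbol abstracted, so that the adjoint, whose
  symbol is the conjugate, is an operator of the same kind.\<close>

definition multiplier_op :: "(real ^ 'n \<Rightarrow> complex) \<Rightarrow> (real ^ 'n \<Rightarrow> complex) \<Rightarrow> real ^ 'n \<Rightarrow> complex" where
  "multiplier_op \<psi> f = inv_fourier (\<lambda>\<xi>. \<psi> \<xi> * fourier_L2 f \<xi>)"

lemma bounded_symbolD:
  assumes "bounded_symbol M R \<psi>"
  shows "\<psi> \<in> borel_measurable borel" "cmod (\<psi> \<xi>) \<le> M" "0 \<le> M" "R < norm \<xi> \<Longrightarrow> \<psi> \<xi> = 0"
  using assms order_trans[OF norm_ge_zero, of "\<psi> undefined" M] unfolding bounded_symbol_def by auto

lemma bounded_symbol_cnj: "bounded_symbol M R \<psi> \<Longrightarrow> bounded_symbol M R (\<lambda>\<xi>. cnj (\<psi> \<xi>))"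
  by (auto simp: bounded_symbol_def)

lemma bounded_symbol_square_integrable:
  assumes "bounded_symbol M R \<psi>"
  shows "square_integrable \<psi>"
proof -
  note \<psi> = bounded_symbolD[OF assms]
  have "cmod (\<psi> \<xi>) \<le> M * cmod (indicator (cball 0 R) \<xi>)" for \<xi>
    using \<psi>(2)[of \<xi>] \<psi>(4)[of \<xi>] by (cases "norm \<xi> \<le> R") auto
  then show ?thesis
    using L2_norm_le[OF \<psi>(1) square_integrable_indicator_cball _ \<psi>(3)] by blast
qed

lemma multiplier_integrable:
  assumes \<psi>: "bounded_symbol M R \<psi>" and f: "square_integrable f"
  shows "integrable lborel (\<lambda>\<xi>. \<psi> \<xi> * fourier_L2 f \<xi>)" "square_integrable (\<lambda>\<xi>. \<psi> \<xi> * fourier_L2 f \<xi>)"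
    "L2_norm (\<lambda>\<xi>. \<psi> \<xi> * fourier_L2 f \<xi>) \<le> M * L2_norm f"
proof -
  note ff = fourier_L2_isometry[OF f]
  show "integrable lborel (\<lambda>\<xi>. \<psi> \<xi> * fourier_L2 f \<xi>)"
    by (rule integrable_mult_L2[OF bounded_symbol_square_integrable[OF \<psi>] ff(1)])
  show "square_integrable (\<lambda>\<xi>. \<psi> \<xi> * fourier_L2 f \<xi>)"
    "L2_norm (\<lambda>\<xi>. \<psi> \<xi> * fourier_L2 f \<xi>) \<le> M * L2_norm f"
    using square_integrable_bounded_mult[OF bounded_symbolD(1)[OF \<psi>] bounded_symbolD(2)[OF \<psi>] ff(1)] ff(2)
    by auto
qed

lemma multiplier_op_L2:
  assumes \<psi>: "bounded_symbol M R \<psi>" and f: "square_integrable f"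
  shows "square_integrable (multiplier_op \<psi> f)"
    "L2_norm (multiplier_op \<psi> f) = L2_norm (\<lambda>\<xi>. \<psi> \<xi> * fourier_L2 f \<xi>)"
  using inv_fourier_isometry[OF multiplier_integrable(1,2)[OF assms]]
  by (simp_all add: multiplier_op_def)

text \<open>By Plancherel the norm of the output depends only on the modulus of the symbol. This
  exchanges the adjoint for the original operator inside a norm.\<close>

lemma L2_norm_multiplier_op_cnj:
  assumes \<psi>: "bounded_symbol M R \<psi>" and f: "square_integrable f"
  shows "L2_norm (multiplier_op (\<lambda>\<xi>. cnj (\<psi> \<xi>)) f) = L2_norm (multiplier_op \<psi> f)"
  using multiplier_op_L2(2)[OF \<psi> f] multiplier_op_L2(2)[OF bounded_symbol_cnj[OF \<psi>] f]
  by (simp add: L2_norm_def norm_mult)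

text \<open>Only \<open>g\<close> needs approximants: the operator is an honest integral of an
  integrable function, so for integrable \<open>G m\<close> the multiplication formula applies
  directly.\<close>

lemma L2_inner_multiplier_op:
  assumes \<psi>: "bounded_symbol M R \<psi>" and f: "square_integrable f" and g: "square_integrable g"
  shows "L2_inner (multiplier_op \<psi> f) g = L2_inner (\<lambda>\<xi>. \<psi> \<xi> * fourier_L2 f \<xi>) (fourier_L2 g)"
proof -
  obtain G where i: "\<And>m. integrable lborel (G m)" and G: "L2_converges G g"
    by (rule that[OF L2_approx_integrable[OF g]])
  note p = multiplier_integrable[OF \<psi> f]
  have const: "L2_converges (\<lambda>_. u) u" if "square_integrable u" for u :: "real ^ 'a \<Rightarrow> complex"
    using that by (simp add: L2_converges_def L2_norm_def)
  have "L2_inner (multiplier_op \<psi> f) (G m) = L2_inner (\<lambda>\<xi>. \<psi> \<xi> * fourier_L2 f \<xi>) (fourier (G m))" for m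
  proof -
    have ci: "integrable lborel (\<lambda>x. cnj (G m x))"
      using i by (rule Bochner_Integration.integrable_cnj)
    have cnj_G: "(\<integral>x. cis (2 * pi * (x \<bullet> \<xi>)) * cnj (G m x) \<partial>lborel) = cnj (fourier (G m) \<xi>)" for \<xi>
      unfolding fourier_def by (subst Bochner_Integration.integral_cnj[symmetric]) (simp add: cis_cnj)
    have "L2_inner (multiplier_op \<psi> f) (G m) =
        (\<integral>x. cnj (G m x) * (\<integral>\<xi>. cis (2 * pi * (x \<bullet> \<xi>)) * (\<psi> \<xi> * fourier_L2 f \<xi>) \<partial>lborel) \<partial>lborel)"
      unfolding L2_inner_def multiplier_op_def inv_fourier_def by (simp only: mult.commute)
    also have "\<dots> = (\<integral>\<xi>. (\<psi> \<xi> * fourier_L2 f \<xi>) * (\<integral>x. cis (2 * pi * (x \<bullet> \<xi>)) * cnj (G m x) \<partial>lborel) \<partial>lborel)"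
      by (rule Fubini_cis[OF ci p(1)])
    also have "\<dots> = L2_inner (\<lambda>\<xi>. \<psi> \<xi> * fourier_L2 f \<xi>) (fourier (G m))"
      unfolding cnj_G L2_inner_def ..
    finally show ?thesis .
  qed
  then have "(\<lambda>m. L2_inner (\<lambda>\<xi>. \<psi> \<xi> * fourier_L2 f \<xi>) (fourier (G m))) \<longlonglongrightarrow> L2_inner (multiplier_op \<psi> f) g"
    using L2_converges_inner[OF const[OF multiplier_op_L2(1)[OF \<psi> f]] G] by simp
  then show ?thesis
    using L2_converges_inner[OF const[OF p(2)] fourier_L2_converges[OF G i]] by (rule LIMSEQ_unique)
qed

lemma multiplier_op_adjoint:
  assumes \<psi>: "bounded_symbol M R \<psi>" and f: "square_integrable f" and g: "square_integrable g"
  shows "L2_inner (multiplier_op \<psi> f) g = L2_inner f (multiplier_op (\<lambda>\<xi>. cnj (\<psi> \<xi>)) g)"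
proof -
  have "L2_inner (multiplier_op \<psi> f) g = L2_inner (\<lambda>\<xi>. \<psi> \<xi> * fourier_L2 f \<xi>) (fourier_L2 g)"
    by (rule L2_inner_multiplier_op[OF assms])
  also have "\<dots> = cnj (L2_inner (\<lambda>\<xi>. cnj (\<psi> \<xi>) * fourier_L2 g \<xi>) (fourier_L2 f))"
    by (subst L2_inner_commute[symmetric]) (simp add: L2_inner_def mult_ac)
  also have "\<dots> = cnj (L2_inner (multiplier_op (\<lambda>\<xi>. cnj (\<psi> \<xi>)) g) f)"
    by (simp only: L2_inner_multiplier_op[OF bounded_symbol_cnj[OF \<psi>] g f])
  finally show ?thesis
    by (simp flip: L2_inner_commute)
qed

lemma cmod_cis_diff_1_le: "cmod (cis t - 1) \<le> \<bar>t\<bar>"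
proof -
  have "(cmod (cis t - 1))\<^sup>2 = 2 - 2 * cos t"
    unfolding cmod_power2 using sin_cos_squared_add[of t]
    by (simp add: power2_eq_square algebra_simps)
  also have "\<dots> = (2 * sin (t / 2))\<^sup>2"
    using cos_double_sin[of "t / 2"] by (simp add: power_mult_distrib)
  also have "\<dots> \<le> t\<^sup>2"
    using power_mono[OF abs_sin_x_le_abs_x[of "t / 2"], of 2] by (simp add: power_mult_distrib power_divide)
  finally show ?thesis
    using abs_le_square_iff[of "cmod (cis t - 1)" t] by simp
qed

text \<open>A Bernstein inequality for differences: where the symbol is nonzero,
  \<open>|xi| <= R\<close>, and there \<open>cis (2 * pi * (h \<bullet> \<xi>)) - 1\<close> has
  modulus at most \<open>2 * pi * |h| * R\<close>.\<close>

lemma L2_norm_multiplier_op_translation_diff: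
  assumes \<psi>: "bounded_symbol M R \<psi>" and f: "square_integrable f"
  shows "L2_norm (\<lambda>x. multiplier_op \<psi> f (x + h) - multiplier_op \<psi> f x) \<le> 2 * pi * norm h * \<bar>R\<bar> * M * L2_norm f"
proof -
  note p = multiplier_integrable[OF \<psi> f] and \<psi>' = bounded_symbolD[OF \<psi>]
  define q where "q \<xi> = (cis (2 * pi * (h \<bullet> \<xi>)) - 1) * (\<psi> \<xi> * fourier_L2 f \<xi>)" for \<xi>
  have [measurable]: "\<psi> \<in> borel_measurable borel" "fourier_L2 f \<in> borel_measurable borel"
    using \<psi>'(1) fourier_L2_isometry(1)[OF f] by auto
  have q_eq: "q \<xi> = cis (2 * pi * (h \<bullet> \<xi>)) * (\<psi> \<xi> * fourier_L2 f \<xi>) - \<psi> \<xi> * fourier_L2 f \<xi>" for \<xi>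
    by (simp add: q_def algebra_simps)
  have "integrable lborel q"
    unfolding q_eq[abs_def] by (intro Bochner_Integration.integrable_diff integrable_cis_mult p) measurable
  moreover have "square_integrable q"
    unfolding q_def by (rule square_integrable_bounded_mult(1)[OF _ _ p(2), where c=2])
      (auto simp: cmod_cis_diff_1_le_2)
  ultimately have iso: "L2_norm (inv_fourier q) = L2_norm q"
    by (rule inv_fourier_isometry(2))
  have "multiplier_op \<psi> f (x + h) - multiplier_op \<psi> f x = inv_fourier q x" for x
  proof -
    note ip = integrable_cis_mult[OF p(1)]
    have "multiplier_op \<psi> f (x + h) - multiplier_op \<psi> f x =
        (\<integral>\<xi>. cis (2 * pi * ((x + h) \<bullet> \<xi>)) * (\<psi> \<xi> * fourier_L2 f \<xi>) -
          cis (2 * pi * (x \<bullet> \<xi>)) * (\<psi> \<xi> * fourier_L2 f \<xi>) \<partial>lborel)"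
      unfolding multiplier_op_def inv_fourier_def
      by (rule Bochner_Integration.integral_diff[symmetric]; rule ip) measurable
    also have "\<dots> = inv_fourier q x"
      unfolding inv_fourier_def q_eq
      by (simp add: right_diff_distrib cis_mult_left inner_add_left distrib_left)
    finally show ?thesis .
  qed
  then have "L2_norm (\<lambda>x. multiplier_op \<psi> f (x + h) - multiplier_op \<psi> f x) = L2_norm q"
    by (simp add: iso)
  also have "\<dots> \<le> (2 * pi * norm h * \<bar>R\<bar> * M) * L2_norm (fourier_L2 f)"
  proof (rule L2_norm_le[THEN conjunct2])
    show "cmod (q \<xi>) \<le> (2 * pi * norm h * \<bar>R\<bar> * M) * cmod (fourier_L2 f \<xi>)" for \<xi>
    proof (cases "norm \<xi> \<le> R")
      case True
      have "cmod (cis (2 * pi * (h \<bullet> \<xi>)) - 1) \<le> 2 * pi * \<bar>h \<bullet> \<xi>\<bar>"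
        using cmod_cis_diff_1_le[of "2 * pi * (h \<bullet> \<xi>)"] by (simp add: abs_mult)
      also have "\<dots> \<le> 2 * pi * (norm h * \<bar>R\<bar>)"
        using Cauchy_Schwarz_ineq2[of h \<xi>] True
        by (intro mult_left_mono order_trans[OF Cauchy_Schwarz_ineq2]) auto
      finally show ?thesis
        unfolding q_def norm_mult mult.assoc[symmetric]
        by (intro mult_right_mono mult_mono \<psi>'(2)) (auto simp: mult.assoc)
    next
      case False
      then show ?thesis
        using \<psi>'(3) \<psi>'(4)[of \<xi>] by (simp add: q_def)
    qed
    show "q \<in> borel_measurable borel"
      unfolding q_def by measurable
  qed (use \<psi>'(3) fourier_L2_isometry(1)[OF f] in auto)
  also have "\<dots> \<le> 2 * pi * norm h * \<bar>R\<bar> * M * L2_norm f"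
    by (simp add: fourier_L2_isometry(2)[OF f])
  finally show ?thesis .
qed

subsection \<open>Dyadic conditional expectations\<close>

text \<open>The index of the dyadic cube containing \<open>x\<close>. Cubes become fibres of this
  map, which reduces partition, nesting and measurability to facts about floors.\<close>

definition cell :: "int \<Rightarrow> real ^ 'n \<Rightarrow> int ^ 'n" where
  "cell k x = (\<chi> i. \<lfloor>2 powi k * x $ i\<rfloor>)"

lemma cell_eq_iff: "cell k x = cell k y \<longleftrightarrow> (\<forall>i. \<lfloor>2 powi k * x $ i\<rfloor> = \<lfloor>2 powi k * y $ i\<rfloor>)"
  by (simp add: cell_def vec_eq_iff)

lemma dyadic_cube_at_cell: "dyadic_cube_at k x = {y. cell k y = cell k x}"
  unfolding dyadic_cube_at_eq by (auto simp: mem_dyadic_cube_iff cell_def)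

text \<open>Nesting of the dyadic grids, from the fact that the floor of \<open>s / 2\<close> is
  determined by the floor of \<open>s\<close>.\<close>

lemma cell_coarser: "cell k x = cell k y \<Longrightarrow> cell (k - 1) x = cell (k - 1) y"
proof -
  have "\<lfloor>2 powi (k - 1) * t\<rfloor> = \<lfloor>2 powi k * t\<rfloor> div 2" for t :: real
    using floor_divide_real_eq_div[of 2 "2 powi k * t"] by (simp add: power_int_diff)
  then show "cell k x = cell k y \<Longrightarrow> cell (k - 1) x = cell (k - 1) y"
    by (simp add: cell_eq_iff)
qed

lemma borel_measurable_vec_nth [measurable (raw)]:
  fixes f :: "'a \<Rightarrow> real ^ 'n"
  shows "f \<in> borel_measurable M \<Longrightarrow> (\<lambda>x. f x $ i) \<in> borel_measurable M"
  by (rule borel_measurable_continuous_on[of "\<lambda>x. x $ i"]) (auto intro: continuous_intros)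

lemma cell_eq_measurable [measurable (raw)]:
  assumes [measurable]: "f \<in> borel_measurable M" "g \<in> borel_measurable M"
  shows "Measurable.pred M (\<lambda>z. cell k (f z) = cell k (g z))"
  unfolding cell_eq_iff by measurable

lemma emeasure_cbox_const:
  assumes "0 \<le> d"
  shows "emeasure lborel (cbox a (a + (\<chi> i::'n. d)) :: (real ^ 'n) set) = ennreal (d ^ CARD('n))"
    and "emeasure lborel (box a (a + (\<chi> i::'n. d)) :: (real ^ 'n) set) = ennreal (d ^ CARD('n))"
proof -
  have d: "(a + (\<chi> i::'n. d) - a) \<bullet> b = d" if "b \<in> Basis" for b
    using that by (auto simp: Basis_vec_def inner_axis)
  then have le: "\<forall>b\<in>Basis. a \<bullet> b \<le> (a + (\<chi> i::'n. d)) \<bullet> b"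
    using assms by (simp add: inner_add_left inner_diff_left)
  have "(\<Prod>b\<in>Basis. (a + (\<chi> i::'n. d) - a) \<bullet> b) = d ^ CARD('n)"
    by (subst prod.cong[OF refl d]) simp_all
  then show "emeasure lborel (cbox a (a + (\<chi> i::'n. d)) :: (real ^ 'n) set) = ennreal (d ^ CARD('n))"
    "emeasure lborel (box a (a + (\<chi> i::'n. d)) :: (real ^ 'n) set) = ennreal (d ^ CARD('n))"
    using le emeasure_lborel_cbox[of a "a + (\<chi> i::'n. d)"] emeasure_lborel_box[of a "a + (\<chi> i::'n. d)"]
    by simp_all
qed

text \<open>The half-open cube lies between an open and a closed box of equal volume.\<close>

lemma emeasure_cell:
  fixes x :: "real ^ 'n"
  shows "emeasure lborel {y. cell k y = cell k x} = ennreal ((2 powi (- k)) ^ CARD('n))"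
proof (rule antisym)
  let ?d = "2 powi (- k) :: real" and ?a = "\<chi> i. 2 powi (- k) * real_of_int (cell k x $ i)"
  have mem: "cell k y = cell k x \<longleftrightarrow> (\<forall>i. ?a $ i \<le> y $ i \<and> y $ i < ?a $ i + ?d)" for y
    using mem_dyadic_cube_iff[of y k "cell k x"]
    by (auto simp: dyadic_cube_def cell_def algebra_simps)
  have "{y. cell k y = cell k x} \<subseteq> cbox ?a (?a + (\<chi> i. ?d))"
    unfolding mem by (auto simp: mem_box_cart less_imp_le)
  then show "emeasure lborel {y. cell k y = cell k x} \<le> ennreal (?d ^ CARD('n))"
    unfolding emeasure_cbox_const(1)[of ?d ?a, OF zero_le_power_int[OF zero_le_numeral], symmetric]
    by (rule emeasure_mono) simp
  have "box ?a (?a + (\<chi> i. ?d)) \<subseteq> {y. cell k y = cell k x}"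
    unfolding mem by (auto simp: mem_box_cart less_imp_le)
  then show "ennreal (?d ^ CARD('n)) \<le> emeasure lborel {y. cell k y = cell k x}"
    unfolding emeasure_cbox_const(2)[of ?d ?a, OF zero_le_power_int[OF zero_le_numeral], symmetric]
    by (rule emeasure_mono) measurable
qed

text \<open>The integral kernel of \<open>cond_exp_op\<close>. It is nonnegative, symmetric and of
  total mass 1, and these properties give contraction and self-adjointness.\<close>

definition dyadic_kernel :: "int \<Rightarrow> real ^ 'n \<Rightarrow> real ^ 'n \<Rightarrow> real" where
  "dyadic_kernel k x y = (if cell k x = cell k y then (2 powi k) ^ CARD('n) else 0)"

lemma dyadic_kernel_measurable [measurable (raw)]:
  assumes [measurable]: "f \<in> borel_measurable M" "g \<in> borel_measurable M"
  shows "(\<lambda>z. dyadic_kernel k (f z) (g z)) \<in> borel_measurable M"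
  unfolding dyadic_kernel_def by measurable

lemma dyadic_kernel_nonneg [simp]: "0 \<le> dyadic_kernel k x y"
  by (simp add: dyadic_kernel_def)

lemma dyadic_kernel_commute: "dyadic_kernel k x y = dyadic_kernel k y x"
  by (auto simp: dyadic_kernel_def)

lemma nn_integral_dyadic_kernel: "(\<integral>\<^sup>+y. ennreal (dyadic_kernel k x y) \<partial>lborel) = 1"
proof -
  have m: "{y. cell k y = cell k x} \<in> sets lborel"
    by measurable
  have "(\<integral>\<^sup>+y. ennreal (dyadic_kernel k x y) \<partial>lborel) =
      (\<integral>\<^sup>+y. ennreal ((2 powi k) ^ CARD('a)) * indicator {y. cell k y = cell k x} y \<partial>lborel)"
    by (intro nn_integral_cong) (auto simp: dyadic_kernel_def indicator_def)
  also have "\<dots> = ennreal ((2 powi k) ^ CARD('a)) * ennreal ((2 powi (- k)) ^ CARD('a))"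
    using m by (simp add: nn_integral_cmult_indicator emeasure_cell)
  also have "\<dots> = 1"
    by (simp add: power_int_minus flip: ennreal_mult' power_mult_distrib)
  finally show ?thesis .
qed

lemma integrable_dyadic_kernel:
  "integrable lborel (dyadic_kernel k x)" "integral\<^sup>L lborel (dyadic_kernel k x) = 1"
proof -
  show i: "integrable lborel (dyadic_kernel k x)"
    by (rule integrableI_nonneg) (simp_all add: nn_integral_dyadic_kernel)
  have "ennreal (integral\<^sup>L lborel (dyadic_kernel k x)) = 1"
    using nn_integral_eq_integral[OF i] by (simp add: nn_integral_dyadic_kernel)
  then show "integral\<^sup>L lborel (dyadic_kernel k x) = 1"
    by simp
qed

lemma square_integrable_dyadic_kernel: "square_integrable (\<lambda>y. complex_of_real (dyadic_kernel k x y))"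
proof (rule square_integrable_bound)
  show "integrable lborel (\<lambda>y. (2 powi k) ^ CARD('a) * dyadic_kernel k x y)"
    by (intro integrable_mult_right integrable_dyadic_kernel(1))
  show "(\<lambda>y. complex_of_real (dyadic_kernel k x y)) \<in> borel_measurable borel"
    by measurable
qed (auto simp: dyadic_kernel_def power2_eq_square)

lemma cond_exp_op_eq:
  fixes g :: "real ^ 'n \<Rightarrow> complex"
  shows "cond_exp_op k g x = (\<integral>y. complex_of_real (dyadic_kernel k x y) * g y \<partial>lborel)"
proof -
  have m: "measure lborel {y. cell k y = cell k x} = (2 powi (- k)) ^ CARD('n)"
    by (simp add: measure_def emeasure_cell)
  have "cond_exp_op k g x = complex_of_real ((2 powi k) ^ CARD('n)) *
      (\<integral>y. indicator {y. cell k y = cell k x} y *\<^sub>R g y \<partial>lborel)"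
    unfolding cond_exp_op_def dyadic_cube_at_cell set_lebesgue_integral_def m
    by (simp add: power_int_minus field_simps)
  also have "\<dots> = (\<integral>y. complex_of_real (dyadic_kernel k x y) * g y \<partial>lborel)"
    unfolding integral_mult_right_zero[symmetric]
    by (rule Bochner_Integration.integral_cong) (auto simp: dyadic_kernel_def indicator_def)
  finally show ?thesis .
qed

lemma cond_exp_op_cell: "cell k x = cell k y \<Longrightarrow> cond_exp_op k g x = cond_exp_op k g y"
  by (simp add: cond_exp_op_eq dyadic_kernel_def)

lemma cond_exp_op_measurable [measurable]:
  assumes [measurable]: "g \<in> borel_measurable borel"
  shows "cond_exp_op k g \<in> borel_measurable borel"
  unfolding cond_exp_op_eq[abs_def] by measurable

text \<open>Jensen for the square, by Cauchy-Schwarz after splitting the kernel into two square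
  roots, one of which has total squared mass 1. If the integrand is not integrable, the integral on
  the left is 0 by convention and the bound is trivial.\<close>

lemma dyadic_kernel_Jensen:
  fixes g :: "real ^ 'n \<Rightarrow> complex"
  assumes [measurable]: "g \<in> borel_measurable borel"
  shows "ennreal ((cmod (\<integral>y. complex_of_real (dyadic_kernel k x y) * g y \<partial>lborel))\<^sup>2) \<le>
    (\<integral>\<^sup>+y. ennreal (dyadic_kernel k x y * (cmod (g y))\<^sup>2) \<partial>lborel)"
proof -
  let ?K = "dyadic_kernel k x"
  have "ennreal (cmod (\<integral>y. complex_of_real (?K y) * g y \<partial>lborel)) \<le>
      (\<integral>\<^sup>+y. ennreal (norm (complex_of_real (?K y) * g y)) \<partial>lborel)"
    by (cases "integrable lborel (\<lambda>y. complex_of_real (?K y) * g y)")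
       (auto simp: not_integrable_integral_eq intro: integral_norm_bound_ennreal)
  also have "\<dots> = (\<integral>\<^sup>+y. ennreal (sqrt (?K y)) * ennreal (sqrt (?K y) * cmod (g y)) \<partial>lborel)"
    by (intro nn_integral_cong) (simp add: norm_mult flip: ennreal_mult' mult.assoc)
  finally have "ennreal (cmod (\<integral>y. complex_of_real (?K y) * g y \<partial>lborel)) ^ 2 \<le>
      (\<integral>\<^sup>+y. ennreal (sqrt (?K y)) * ennreal (sqrt (?K y) * cmod (g y)) \<partial>lborel) ^ 2"
    by (intro power_mono) auto
  also have "\<dots> \<le> (\<integral>\<^sup>+y. ennreal (sqrt (?K y)) ^ 2 \<partial>lborel) *
      (\<integral>\<^sup>+y. ennreal (sqrt (?K y) * cmod (g y)) ^ 2 \<partial>lborel)"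
    by (rule Cauchy_Schwarz_nn_integral) measurable
  also have "\<dots> = (\<integral>\<^sup>+y. ennreal (?K y * (cmod (g y))\<^sup>2) \<partial>lborel)"
    by (simp add: ennreal_power power_mult_distrib nn_integral_dyadic_kernel)
  finally show ?thesis
    by (simp add: ennreal_power)
qed

text \<open>Integrate Jensen over \<open>x\<close> and exchange the integrals; by symmetry the
  kernel also has mass 1 in its first argument.\<close>

lemma cond_exp_op_L2:
  fixes g :: "real ^ 'n \<Rightarrow> complex"
  assumes g: "square_integrable g"
  shows "square_integrable (cond_exp_op k g) \<and> L2_norm (cond_exp_op k g) \<le> L2_norm g"
proof (rule L2_normI_nn_integral)
  have [measurable]: "g \<in> borel_measurable borel"
    using g by measurable
  show "cond_exp_op k g \<in> borel_measurable borel"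
    by measurable
  have "(\<integral>\<^sup>+x. ennreal ((cmod (cond_exp_op k g x))\<^sup>2) \<partial>lborel) \<le>
      (\<integral>\<^sup>+x. \<integral>\<^sup>+y. ennreal (dyadic_kernel k x y * (cmod (g y))\<^sup>2) \<partial>lborel \<partial>lborel)"
    unfolding cond_exp_op_eq by (intro nn_integral_mono dyadic_kernel_Jensen) measurable
  also have "\<dots> = (\<integral>\<^sup>+y. \<integral>\<^sup>+x. ennreal (dyadic_kernel k x y * (cmod (g y))\<^sup>2) \<partial>lborel \<partial>lborel)"
    by (rule lborel_pair.Fubini'[symmetric]) measurable
  also have "\<dots> = (\<integral>\<^sup>+y. ennreal ((cmod (g y))\<^sup>2) \<partial>lborel)"
  proof (intro nn_integral_cong)
    fix y :: "real ^ 'n"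
    have "(\<integral>\<^sup>+x. ennreal (dyadic_kernel k x y * (cmod (g y))\<^sup>2) \<partial>lborel) =
        (\<integral>\<^sup>+x. ennreal (dyadic_kernel k y x) * ennreal ((cmod (g y))\<^sup>2) \<partial>lborel)"
      by (simp add: ennreal_mult' dyadic_kernel_commute[of k y])
    also have "\<dots> = ennreal ((cmod (g y))\<^sup>2)"
      by (subst nn_integral_multc) (auto simp: nn_integral_dyadic_kernel)
    finally show "(\<integral>\<^sup>+x. ennreal (dyadic_kernel k x y * (cmod (g y))\<^sup>2) \<partial>lborel) = ennreal ((cmod (g y))\<^sup>2)" .
  qed
  also have "\<dots> = ennreal ((L2_norm g)\<^sup>2)"
    by (rule nn_integral_L2_norm[OF g])
  finally show "(\<integral>\<^sup>+x. ennreal ((cmod (cond_exp_op k g x))\<^sup>2) \<partial>lborel) \<le> ennreal ((L2_norm g)\<^sup>2)" .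
qed simp

lemma cond_exp_op_self_adjoint:
  fixes f g :: "real ^ 'n \<Rightarrow> complex"
  assumes f: "square_integrable f" and g: "square_integrable g"
  shows "L2_inner (cond_exp_op k f) g = L2_inner f (cond_exp_op k g)"
proof -
  have [measurable]: "f \<in> borel_measurable borel" "g \<in> borel_measurable borel"
    using f g by measurable
  define H where "H x y = complex_of_real (dyadic_kernel k x y) * f y * cnj (g x)" for x y
  have f': "square_integrable (\<lambda>y. complex_of_real (cmod (f y)))"
    by (rule L2_norm_cmod_cong(1)[OF _ f]) auto
  have "integrable (lborel \<Otimes>\<^sub>M lborel) (\<lambda>(x, y). H x y)"
  proof (rule lborel_pair.Fubini_integrable)
    show "(\<lambda>(x, y). H x y) \<in> borel_measurable (lborel \<Otimes>\<^sub>M lborel)"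
      unfolding H_def by measurable
    \<comment> \<open>The inner integral of \<open>|H|\<close> is the conditional expectation of
      \<open>|f|\<close> times \<open>|g|\<close>, hence a product of two square-integrable
      functions.\<close>
    have "(\<integral>y. cmod (H x y) \<partial>lborel) = cmod (cond_exp_op k (\<lambda>y. complex_of_real (cmod (f y))) x * g x)" for x
    proof -
      have "cond_exp_op k (\<lambda>y. complex_of_real (cmod (f y))) x =
          complex_of_real (\<integral>y. dyadic_kernel k x y * cmod (f y) \<partial>lborel)"
        unfolding cond_exp_op_eq by (simp flip: of_real_mult)
      then show ?thesis
        by (simp add: H_def norm_mult)
    qed
    then show "integrable lborel (\<lambda>x. \<integral>y. cmod (case (x, y) of (x, y) \<Rightarrow> H x y) \<partial>lborel)"
      using integrable_norm[OF integrable_mult_L2[OF cond_exp_op_L2[OF f', THEN conjunct1] g]] by simp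
    show "AE x in lborel. integrable lborel (\<lambda>y. case (x, y) of (x, y) \<Rightarrow> H x y)"
      unfolding H_def prod.case
      by (intro AE_I2 integrable_mult_left integrable_mult_L2 square_integrable_dyadic_kernel f)
  qed
  from lborel_pair.Fubini_integral[OF this]
  have swap: "(\<integral>y. \<integral>x. H x y \<partial>lborel \<partial>lborel) = (\<integral>x. \<integral>y. H x y \<partial>lborel \<partial>lborel)" .
  have "L2_inner (cond_exp_op k f) g = (\<integral>x. \<integral>y. H x y \<partial>lborel \<partial>lborel)"
    unfolding L2_inner_def cond_exp_op_eq H_def by simp
  also have "\<dots> = (\<integral>y. \<integral>x. H x y \<partial>lborel \<partial>lborel)"
    by (rule swap[symmetric])
  also have "\<dots> = (\<integral>y. f y * (\<integral>x. cnj (complex_of_real (dyadic_kernel k y x) * g x) \<partial>lborel) \<partial>lborel)"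
  proof -
    have "H x y = f y * cnj (complex_of_real (dyadic_kernel k y x) * g x)" for x y
      by (simp add: H_def dyadic_kernel_commute[of k y x])
    then show ?thesis
      by (simp only: integral_mult_right_zero)
  qed
  also have "\<dots> = L2_inner f (cond_exp_op k g)"
    unfolding L2_inner_def cond_exp_op_eq Bochner_Integration.integral_cnj ..
  finally show ?thesis .
qed

text \<open>The triangle inequality gives the factor 2, which is carried into the final
  constant.\<close>

lemma mart_diff_op_L2:
  assumes g: "square_integrable g"
  shows "square_integrable (mart_diff_op k g)" "L2_norm (mart_diff_op k g) \<le> 2 * L2_norm g"
proof -
  note E = cond_exp_op_L2[OF g]
  show "square_integrable (mart_diff_op k g)"
    unfolding mart_diff_op_def using E by blast
  show "L2_norm (mart_diff_op k g) \<le> 2 * L2_norm g"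
    using L2_norm_triangle_diff[of "cond_exp_op k g" "cond_exp_op (k - 1) g"] E[of k] E[of "k - 1"]
    unfolding mart_diff_op_def by simp
qed

lemma mart_diff_op_self_adjoint:
  assumes f: "square_integrable f" and g: "square_integrable g"
  shows "L2_inner (mart_diff_op k f) g = L2_inner f (mart_diff_op k g)"
proof -
  have eq: "mart_diff_op k h = (\<lambda>x. cond_exp_op k h x - cond_exp_op (k - 1) h x)" for h :: "real ^ 'a \<Rightarrow> complex"
    by (rule ext) (rule mart_diff_op_def)
  note Ef = cond_exp_op_L2[OF f, THEN conjunct1] and Eg = cond_exp_op_L2[OF g, THEN conjunct1]
  have "L2_inner (mart_diff_op k f) g = L2_inner (cond_exp_op k f) g - L2_inner (cond_exp_op (k - 1) f) g"
    unfolding eq by (rule L2_inner_diff_left[OF Ef Ef g])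
  also have "\<dots> = L2_inner f (cond_exp_op k g) - L2_inner f (cond_exp_op (k - 1) g)"
    by (simp only: cond_exp_op_self_adjoint[OF f g])
  also have "\<dots> = L2_inner f (mart_diff_op k g)"
    unfolding eq by (rule L2_inner_diff_right[OF Eg Eg f, symmetric])
  finally show ?thesis .
qed

text \<open>The coarser average is constant on cells of generation \<open>k - 1\<close>, and
  therefore also on the finer ones inside them.\<close>

lemma mart_diff_op_cell: "cell k x = cell k y \<Longrightarrow> mart_diff_op k g x = mart_diff_op k g y"
  unfolding mart_diff_op_def by (metis cond_exp_op_cell cell_coarser)

text \<open>Two points of a cell differ by some \<open>z\<close> in the cube of side
  \<open>2 * 2^-k\<close> centred at 0. Jensen bounds the squared norm by an integral over pairs in
  a common cell, and hence by an integral over such \<open>z\<close> of the squared norms of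
  \<open>f (x + z) - f x\<close>. The factor \<open>2^n\<close> is the ratio of the volumes of that
  cube and of a cell.\<close>

lemma cond_exp_op_oscillation:
  fixes f :: "real ^ 'n \<Rightarrow> complex"
  assumes f: "square_integrable f" and "0 \<le> B"
    and B: "\<And>z. (\<And>i. \<bar>z $ i\<bar> \<le> 2 powi (- k)) \<Longrightarrow> L2_norm (\<lambda>x. f (x + z) - f x) \<le> B"
  shows "L2_norm (\<lambda>x. f x - cond_exp_op k f x) \<le> sqrt (2 ^ CARD('n)) * B"
proof -
  have [measurable]: "f \<in> borel_measurable borel"
    using f by measurable
  let ?K = "dyadic_kernel k" and ?c = "(2 powi k :: real) ^ CARD('n)"
  define d where "d = (2 powi (- k) :: real)"
  define C where "C = cbox (\<chi> i::'n. - d) ((\<chi> i::'n. - d) + (\<chi> i. 2 * d))"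
  have d0: "0 < d" by (simp add: d_def)
  have C_iff: "z \<in> C \<longleftrightarrow> (\<forall>i. \<bar>z $ i\<bar> \<le> d)" for z
  proof -
    have "- d \<le> s \<and> s \<le> d \<longleftrightarrow> \<bar>s\<bar> \<le> d" for s
      by auto
    then show ?thesis
      by (simp add: C_def mem_box_cart)
  qed
  have [measurable]: "C \<in> sets borel"
    by (simp add: C_def)
  \<comment> \<open>Replaces the condition that \<open>x\<close> and \<open>x + z\<close> share a
    cell by one on \<open>z\<close> alone, so that the integral over \<open>x\<close> can be taken
    first and \<open>B\<close> applied.\<close>
  have K_le: "?K x (x + z) \<le> ?c * indicator C z" for x z
  proof (cases "cell k x = cell k (x + z)")
    case True
    have "\<bar>z $ i\<bar> \<le> d" for i
    proof -
      have "\<lfloor>2 powi k * x $ i\<rfloor> = \<lfloor>2 powi k * (x $ i + z $ i)\<rfloor>"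
        using True by (simp add: cell_eq_iff)
      then have "\<bar>2 powi k * (x $ i + z $ i) - 2 powi k * x $ i\<bar> < 1"
        by linarith
      then have "\<bar>2 powi k * z $ i\<bar> < 1"
        by (simp add: algebra_simps)
      then show ?thesis
        by (simp add: d_def power_int_minus abs_mult field_simps)
    qed
    then show ?thesis
      by (simp add: dyadic_kernel_def C_iff)
  qed (simp add: dyadic_kernel_def)
  have one: "(\<integral>y. complex_of_real (?K x y) * f x \<partial>lborel) = f x" for x
    by (simp add: integrable_dyadic_kernel(2))
  have diff: "f x - cond_exp_op k f x = (\<integral>y. complex_of_real (?K x y) * (f x - f y) \<partial>lborel)" for x
  proof -
    have "integrable lborel (\<lambda>y. complex_of_real (?K x y) * f x)"
      by (intro integrable_mult_left integrable_of_real integrable_dyadic_kernel(1))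
    moreover have "integrable lborel (\<lambda>y. complex_of_real (?K x y) * f y)"
      by (intro integrable_mult_L2 square_integrable_dyadic_kernel f)
    ultimately show ?thesis
      unfolding right_diff_distrib by (simp only: Bochner_Integration.integral_diff one cond_exp_op_eq)
  qed
  have "square_integrable (\<lambda>x. f x - cond_exp_op k f x) \<and>
      L2_norm (\<lambda>x. f x - cond_exp_op k f x) \<le> sqrt (2 ^ CARD('n)) * B"
  proof (rule L2_normI_nn_integral)
    have "(\<integral>\<^sup>+x. ennreal ((cmod (f x - cond_exp_op k f x))\<^sup>2) \<partial>lborel) \<le>
        (\<integral>\<^sup>+x. \<integral>\<^sup>+y. ennreal (?K x y * (cmod (f x - f y))\<^sup>2) \<partial>lborel \<partial>lborel)"
      unfolding diff by (intro nn_integral_mono dyadic_kernel_Jensen) measurable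
    also have "\<dots> \<le> (\<integral>\<^sup>+x. \<integral>\<^sup>+z. ennreal (?c * indicator C z * (cmod (f (x + z) - f x))\<^sup>2) \<partial>lborel \<partial>lborel)"
    proof (rule nn_integral_mono)
      fix x :: "real ^ 'n"
      have "(\<integral>\<^sup>+y. ennreal (?K x y * (cmod (f x - f y))\<^sup>2) \<partial>lborel) =
          (\<integral>\<^sup>+y. ennreal (?K x y * (cmod (f x - f y))\<^sup>2) \<partial>distr lborel borel ((+) x))"
        by (simp add: lborel_distr_plus)
      also have "\<dots> = (\<integral>\<^sup>+z. ennreal (?K x (x + z) * (cmod (f x - f (x + z)))\<^sup>2) \<partial>lborel)"
        by (rule nn_integral_distr) measurable
      also have "\<dots> \<le> (\<integral>\<^sup>+z. ennreal (?c * indicator C z * (cmod (f (x + z) - f x))\<^sup>2) \<partial>lborel)"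
        by (intro nn_integral_mono ennreal_leI) (simp add: norm_minus_commute mult_right_mono K_le)
      finally show "(\<integral>\<^sup>+y. ennreal (?K x y * (cmod (f x - f y))\<^sup>2) \<partial>lborel) \<le>
          (\<integral>\<^sup>+z. ennreal (?c * indicator C z * (cmod (f (x + z) - f x))\<^sup>2) \<partial>lborel)" .
    qed
    also have "\<dots> = (\<integral>\<^sup>+z. \<integral>\<^sup>+x. ennreal (?c * indicator C z * (cmod (f (x + z) - f x))\<^sup>2) \<partial>lborel \<partial>lborel)"
      by (rule lborel_pair.Fubini'[symmetric]) measurable
    also have "\<dots> \<le> (\<integral>\<^sup>+z. ennreal (?c * B\<^sup>2) * indicator C z \<partial>lborel)"
    proof (rule nn_integral_mono)
      fix z :: "real ^ 'n"
      note t = square_integrable_diff[OF L2_translation(1)[OF f] f, of z]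
      show "(\<integral>\<^sup>+x. ennreal (?c * indicator C z * (cmod (f (x + z) - f x))\<^sup>2) \<partial>lborel) \<le>
          ennreal (?c * B\<^sup>2) * indicator C z"
      proof (cases "z \<in> C")
        case True
        have "(\<integral>\<^sup>+x. ennreal (?c * indicator C z * (cmod (f (x + z) - f x))\<^sup>2) \<partial>lborel) =
            ennreal ?c * ennreal ((L2_norm (\<lambda>x. f (x + z) - f x))\<^sup>2)"
          using True by (simp add: ennreal_mult' nn_integral_cmult nn_integral_L2_norm[OF t])
        also have "\<dots> \<le> ennreal ?c * ennreal (B\<^sup>2)"
          using True B[of z] by (intro mult_left_mono ennreal_leI power_mono) (auto simp: C_iff d_def)
        finally show ?thesis
          using True by (simp add: ennreal_mult')
      qed simp
    qed
    also have "\<dots> = ennreal (?c * B\<^sup>2) * ennreal ((2 * d) ^ CARD('n))"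
      using emeasure_cbox_const(1)[of "2 * d" "\<chi> i::'n. - d"] d0
      by (subst nn_integral_cmult_indicator) (simp_all add: C_def)
    also have "\<dots> = ennreal ((sqrt (2 ^ CARD('n)) * B)\<^sup>2)"
    proof -
      have "?c * (2 * d) ^ CARD('n) = 2 ^ CARD('n)"
        unfolding power_mult_distrib[symmetric] d_def by (simp add: power_int_minus field_simps)
      then have "?c * B\<^sup>2 * (2 * d) ^ CARD('n) = (sqrt (2 ^ CARD('n)) * B)\<^sup>2"
        by (simp add: power_mult_distrib mult_ac)
      then show ?thesis
        using d0 by (simp flip: ennreal_mult')
    qed
    finally show "(\<integral>\<^sup>+x. ennreal ((cmod (f x - cond_exp_op k f x))\<^sup>2) \<partial>lborel) \<le>
        ennreal ((sqrt (2 ^ CARD('n)) * B)\<^sup>2)" .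
  qed (use \<open>0 \<le> B\<close> in auto)
  then show ?thesis ..
qed

section \<open>Shifts of functions that are constant on cells\<close>

lemma mod_succ_cases:
  fixes m N :: int
  assumes "0 < N"
  shows "(m + 1) mod N = (if m mod N = N - 1 then 0 else m mod N + 1)"
proof -
  define s where "s = m mod N"
  have "0 \<le> s" "s < N"
    using assms by (auto simp: s_def)
  moreover have "(m + 1) mod N = (s + 1) mod N"
    by (simp add: s_def mod_add_left_eq)
  ultimately show ?thesis
    unfolding s_def[symmetric] by (cases "s = N - 1") auto
qed

lemma div_succ_eq:
  fixes m N :: int
  assumes "0 < N" "m mod N \<noteq> N - 1"
  shows "(m + 1) div N = m div N"
proof -
  have "m + 1 = m div N * N + (m mod N + 1)"
    by simp
  then have "(m + 1) div N = m div N + (m mod N + 1) div N"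
    using assms(1) by (metis div_mult_self3 less_irrefl)
  moreover have "(m mod N + 1) div N = 0"
    using assms pos_mod_bound[of N m] pos_mod_sign[of N m] by (intro div_pos_pos_trivial) linarith+
  ultimately show ?thesis
    by simp
qed

text \<open>Slice every cell into \<open>N\<close> strips of width \<open>t\<close>. Shifting by \<open>t\<close> moves each strip but the last
  inside its cell, so all \<open>N\<close> residue classes of strips carry the same mass of \<open>h\<close>, and the
  difference only lives on the last class.\<close>

lemma L2_norm_cell_shift:
  fixes h :: "real ^ 'n \<Rightarrow> complex" and N :: nat
  assumes h: "square_integrable h" and const: "\<And>x y. cell k x = cell k y \<Longrightarrow> h x = h y"
    and N: "0 < N" and t: "real N * t = 2 powi (- k)"
  shows "(L2_norm (\<lambda>x. h (x + axis i t) - h x))\<^sup>2 \<le> 4 / real N * (L2_norm h)\<^sup>2"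
proof -
  have [measurable]: "h \<in> borel_measurable borel"
    using h by measurable
  have "0 < real N * t"
    unfolding t by simp
  then have t0: "0 < t"
    using N by (simp add: zero_less_mult_iff)
  have Nt: "2 powi k = 1 / (real N * t)"
    unfolding t by (simp add: power_int_minus field_simps)
  \<comment> \<open>Numbers the slabs of width \<open>t\<close> orthogonal to axis \<open>i\<close>
    through all of space: division by \<open>N\<close> gives the cell coordinate, the remainder the
    position inside the cell.\<close>
  define m :: "real ^ 'n \<Rightarrow> int" where "m x = \<lfloor>x $ i / t\<rfloor>" for x
  have [measurable]: "m \<in> borel \<rightarrow>\<^sub>M count_space UNIV"
    unfolding m_def by measurable
  have m_shift: "m (x + axis i t) = m x + 1" for x
    using t0 by (simp add: m_def add_divide_distrib)
  have m_div: "\<lfloor>2 powi k * x $ i\<rfloor> = m x div int N" for x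
    using floor_divide_real_eq_div[of "int N" "x $ i / t"] by (simp add: m_def Nt mult.commute)
  have h_shift: "h (x + axis i t) = h x" if "m x mod int N \<noteq> int N - 1" for x
  proof (rule const, unfold cell_eq_iff, rule allI)
    fix l
    show "\<lfloor>2 powi k * (x + axis i t) $ l\<rfloor> = \<lfloor>2 powi k * x $ l\<rfloor>"
      using m_div[of x] m_div[of "x + axis i t"] m_shift[of x] div_succ_eq[OF _ that] N
      by (cases "l = i") (simp_all add: axis_def)
  qed
  define F where "F r x = (if m x mod int N = r then (cmod (h x))\<^sup>2 else 0)" for r x
  have Fm [measurable]: "F r \<in> borel_measurable borel" for r
    unfolding F_def by measurable
  have Fi: "integrable lborel (F r)" for r
    by (rule Bochner_Integration.integrable_bound[OF square_integrable_integrable[OF h]])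
       (auto simp: F_def)
  have Fshift: "integrable lborel (\<lambda>x. F r (x + axis i t))"
    "integral\<^sup>L lborel (F r) = (\<integral>x. F r (x + axis i t) \<partial>lborel)" for r
    using lborel_affine_change[of 1 "F r" "axis i t"] Fi[of r] by (simp_all add: add.commute)
  \<comment> \<open>A point of class \<open>r\<close> with \<open>r + 1 < N\<close> is not in the
    last strip of its cell, so the shift keeps \<open>h\<close> and raises the class by one;
    translation invariance then equates the masses. The bound \<open>0 <= r\<close> excludes the
    wrap-around into class 0.\<close>
  have step: "integral\<^sup>L lborel (F (r + 1)) = integral\<^sup>L lborel (F r)" if "0 \<le> r" "r + 1 < int N" for r
  proof -
    have "F (r + 1) (x + axis i t) = F r x" for x
      using mod_succ_cases[of "int N" "m x"] h_shift[of x] that by (auto simp: F_def m_shift)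
    then show ?thesis
      by (subst Fshift(2)) simp
  qed
  have all_eq: "integral\<^sup>L lborel (F (int r)) = integral\<^sup>L lborel (F 0)" if "r < N" for r
    using that
  proof (induction r)
    case (Suc r)
    then show ?case
      using step[of "int r"] by (simp add: add.commute)
  qed simp
  have "(L2_norm h)\<^sup>2 = (\<integral>x. (\<Sum>r<N. F (int r) x) \<partial>lborel)"
    unfolding L2_norm_power2
  proof (rule Bochner_Integration.integral_cong[OF refl])
    fix x
    have "0 \<le> m x mod int N" "m x mod int N < int N"
      using N by auto
    then have "(\<Sum>r<N. F (int r) x) = (\<Sum>r\<in>{nat (m x mod int N)}. F (int r) x)"
      by (intro sum.mono_neutral_right) (auto simp: F_def)
    then show "(cmod (h x))\<^sup>2 = (\<Sum>r<N. F (int r) x)"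
      using \<open>0 \<le> m x mod int N\<close> by (simp add: F_def)
  qed
  also have "\<dots> = (\<Sum>r<N. integral\<^sup>L lborel (F (int r)))"
    by (rule Bochner_Integration.integral_sum) (rule Fi)
  also have "\<dots> = real N * integral\<^sup>L lborel (F 0)"
    using all_eq by simp
  finally have F0: "integral\<^sup>L lborel (F 0) = (L2_norm h)\<^sup>2 / real N"
    using N by simp
  have last: "integral\<^sup>L lborel (F (int N - 1)) = integral\<^sup>L lborel (F 0)"
    using all_eq[of "N - 1"] N by (simp add: of_nat_diff)
  have "(L2_norm (\<lambda>x. h (x + axis i t) - h x))\<^sup>2 \<le>
      (\<integral>x. 2 * F 0 (x + axis i t) + 2 * F (int N - 1) x \<partial>lborel)"
    unfolding L2_norm_power2
  proof (rule integral_mono)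
    show "integrable lborel (\<lambda>x. (cmod (h (x + axis i t) - h x))\<^sup>2)"
      by (intro square_integrable_integrable square_integrable_diff L2_translation(1) h)
    show "integrable lborel (\<lambda>x. 2 * F 0 (x + axis i t) + 2 * F (int N - 1) x)"
      by (intro Bochner_Integration.integrable_add integrable_mult_right Fshift(1) Fi)
    \<comment> \<open>From the last strip the shift enters the first strip of the next cell. Each of
      the two classes carries \<open>1 / N\<close> of the mass, and the two factors 2 add up to the
      4.\<close>
    show "(cmod (h (x + axis i t) - h x))\<^sup>2 \<le> 2 * F 0 (x + axis i t) + 2 * F (int N - 1) x" for x
    proof (cases "m x mod int N = int N - 1")
      case True
      then show ?thesis
        using norm_add_power2_le[of "h (x + axis i t)" "- h x"] mod_succ_cases[of "int N" "m x"] N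
        by (simp add: F_def m_shift)
    next
      case False
      then show ?thesis
        using h_shift by (simp add: F_def)
    qed
  qed
  also have "\<dots> = 4 / real N * (L2_norm h)\<^sup>2"
    using Fshift Fi last F0 by simp
  finally show ?thesis .
qed

subsection \<open>Almost orthogonality\<close>

lemma LP_function_bounded_symbol:
  assumes "LP_function \<phi>"
  shows "\<exists>M. bounded_symbol M 2 \<phi>" "norm \<xi> < 1 / 2 \<Longrightarrow> \<phi> \<xi> = 0"
proof -
  have "C_diff 0 \<phi>" and supp: "supp \<phi> \<subseteq> {\<xi>. 1 / 2 \<le> norm \<xi> \<and> norm \<xi> \<le> 2}"
    using assms unfolding LP_function_def Cc_smooth_def by blast+
  then have cont: "continuous_on UNIV \<phi>"
    by simp
  have *: "1 / 2 \<le> norm \<xi> \<and> norm \<xi> \<le> 2" if "\<phi> \<xi> \<noteq> 0" for \<xi>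
    using that supp closure_subset[of "{x. \<phi> x \<noteq> 0}"] by (auto simp: supp_def)
  then show "norm \<xi> < 1 / 2 \<Longrightarrow> \<phi> \<xi> = 0"
    by force
  have zero: "\<phi> \<xi> = 0" if "2 < norm \<xi>" for \<xi>
    using * that by force
  obtain M where M: "0 \<le> M" "\<And>x. cmod (\<phi> x) \<le> M * cmod (indicator (cball 0 2) x)"
    using continuous_compact_support_L2(2)[OF cont zero] by auto
  have "cmod (\<phi> x) \<le> M" for x
    using M(2)[of x] M(1) by (cases "x \<in> cball 0 2") auto
  then show "\<exists>M. bounded_symbol M 2 \<phi>"
    using zero borel_measurable_continuous_onI[OF cont] unfolding bounded_symbol_def by blast
qed

lemma bounded_symbol_dilation:
  assumes "bounded_symbol M R \<phi>"
  shows "bounded_symbol M (2 powi j * R) (\<lambda>\<xi>. \<phi> ((2 powi (- j)) *\<^sub>R \<xi>))"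
proof -
  note \<phi> = bounded_symbolD[OF assms]
  have [measurable]: "\<phi> \<in> borel_measurable borel"
    by (rule \<phi>(1))
  show ?thesis
    unfolding bounded_symbol_def
  proof (intro conjI allI impI)
    fix \<xi> :: "real ^ 'a" assume "2 powi j * R < norm \<xi>"
    then have "R < norm ((2 powi (- j)) *\<^sub>R \<xi>)"
      by (simp add: power_int_minus field_simps)
    then show "\<phi> ((2 powi (- j)) *\<^sub>R \<xi>) = 0"
      by (rule \<phi>(4))
  qed (use \<phi>(2) in measurable)
qed

lemma LP_op_eq: "LP_op \<phi> j = multiplier_op (\<lambda>\<xi>. \<phi> ((2 powi (- j)) *\<^sub>R \<xi>))"
  by (rule ext) (simp add: LP_op_def multiplier_op_def)

text \<open>Inserting the identity splits \<open>D_k\<close> into the oscillations at generations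
  \<open>k\<close> and \<open>k - 1\<close>. The second cell side is twice the first, so the factor
  \<open>2 * pi\<close> is multiplied by 1 + 2. The dimension enters when the Euclidean norm of a
  shift is bounded by the sum of its coordinates.\<close>

lemma mart_diff_op_multiplier_op_le:
  fixes f :: "real ^ 'n \<Rightarrow> complex"
  assumes \<psi>: "bounded_symbol M R \<psi>" and f: "square_integrable f" and "0 \<le> R"
  shows "L2_norm (mart_diff_op k (multiplier_op \<psi> f)) \<le>
    6 * pi * real CARD('n) * sqrt (2 ^ CARD('n)) * R * M * 2 powi (- k) * L2_norm f"
proof -
  let ?n = "real CARD('n)" and ?u = "multiplier_op \<psi> f"
  have u: "square_integrable ?u"
    by (rule multiplier_op_L2(1)[OF \<psi> f])
  note M = bounded_symbolD(3)[OF \<psi>]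
  have osc: "L2_norm (\<lambda>x. ?u x - cond_exp_op l ?u x) \<le>
      sqrt (2 ^ CARD('n)) * (2 * pi * (?n * 2 powi (- l)) * R * M * L2_norm f)" for l
  proof (rule cond_exp_op_oscillation[OF u])
    show "0 \<le> 2 * pi * (?n * 2 powi (- l)) * R * M * L2_norm f"
      using M \<open>0 \<le> R\<close> by simp
    fix z :: "real ^ 'n" assume z: "\<And>i. \<bar>z $ i\<bar> \<le> 2 powi (- l)"
    have "norm z \<le> (\<Sum>i\<in>UNIV. \<bar>z $ i\<bar>)"
      by (rule norm_le_l1_cart)
    also have "\<dots> \<le> (\<Sum>i\<in>(UNIV :: 'n set). 2 powi (- l))"
      by (intro sum_mono z)
    finally have "norm z \<le> ?n * 2 powi (- l)"
      by simp
    then have "2 * pi * norm z * \<bar>R\<bar> * M * L2_norm f \<le> 2 * pi * (?n * 2 powi (- l)) * R * M * L2_norm f"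
      using M \<open>0 \<le> R\<close> by (simp add: mult_right_mono mult_left_mono)
    then show "L2_norm (\<lambda>x. ?u (x + z) - ?u x) \<le> 2 * pi * (?n * 2 powi (- l)) * R * M * L2_norm f"
      using L2_norm_multiplier_op_translation_diff[OF \<psi> f, of z] by linarith
  qed
  note E = cond_exp_op_L2[OF u, THEN conjunct1]
  have "L2_norm (mart_diff_op k ?u) \<le> L2_norm (\<lambda>x. cond_exp_op k ?u x - ?u x) +
      L2_norm (\<lambda>x. ?u x - cond_exp_op (k - 1) ?u x)"
    unfolding mart_diff_op_def by (rule L2_norm_triangle_via[OF E u E])
  also have "L2_norm (\<lambda>x. cond_exp_op k ?u x - ?u x) = L2_norm (\<lambda>x. ?u x - cond_exp_op k ?u x)"
    by (rule L2_norm_minus_commute)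
  finally have "L2_norm (mart_diff_op k ?u) \<le>
      sqrt (2 ^ CARD('n)) * (2 * pi * (?n * 2 powi (- k)) * R * M * L2_norm f) +
      sqrt (2 ^ CARD('n)) * (2 * pi * (?n * 2 powi (- (k - 1))) * R * M * L2_norm f)"
    using osc[of k] osc[of "k - 1"] by linarith
  also have "2 powi (- (k - 1)) = 2 * (2 powi (- k) :: real)"
    by (simp add: power_int_diff power_int_minus divide_inverse)
  finally show ?thesis
    by (simp add: algebra_simps)
qed

section \<open>Lower bound for the translation factors on an annulus\<close>

text \<open>On this range \<open>cos\<close> is at least 1/2, so \<open>sin x - x / 2\<close> is
  nondecreasing from 0.\<close>

lemma half_le_sin:
  fixes x :: real
  assumes "0 \<le> x" "x \<le> pi / 3"
  shows "x / 2 \<le> sin x"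
proof -
  have "sin 0 - 0 / 2 \<le> sin x - x / 2"
  proof (rule DERIV_nonneg_imp_nondecreasing[OF assms(1)])
    fix y assume y: "0 \<le> y" "y \<le> x"
    have "cos (pi / 3) \<le> cos y"
      using y assms pi_gt_zero by (intro cos_monotone_0_pi_le) auto
    then have "0 \<le> cos y - 1 / 2"
      by (simp add: cos_60)
    moreover have "((\<lambda>y. sin y - y / 2) has_real_derivative cos y - 1 / 2) (at y)"
      by (auto intro!: derivative_eq_intros)
    ultimately show "\<exists>d. ((\<lambda>y. sin y - y / 2) has_real_derivative d) (at y) \<and> 0 \<le> d"
      by blast
  qed
  then show ?thesis by simp
qed

lemma cmod_cis_diff_1_ge:
  assumes "\<bar>t\<bar> \<le> pi / 3"
  shows "\<bar>t\<bar> / 2 \<le> cmod (cis t - 1)"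
proof -
  have "\<bar>t\<bar> / 2 \<le> sin \<bar>t\<bar>"
    by (rule half_le_sin) (use assms in auto)
  also have "\<dots> \<le> \<bar>sin t\<bar>"
    by (cases "0 \<le> t") auto
  also have "\<dots> = \<bar>Im (cis t - 1)\<bar>"
    by simp
  also have "\<dots> \<le> cmod (cis t - 1)"
    by (rule abs_Im_le_cmod)
  finally show ?thesis .
qed

text \<open>A largest coordinate of \<open>\<xi>\<close> is at least \<open>norm \<xi> / n\<close>,
  and the shift along that axis already has a phase bounded away from 0. Which axis it is depends on
  \<open>\<xi>\<close>, hence the sum over all of them.\<close>

lemma cis_diff_1_annulus:
  fixes \<xi> :: "real ^ 'n"
  assumes "2 powi (j - 1) \<le> norm \<xi>" "norm \<xi> \<le> 2 powi (j + 1)" and t: "t = 2 powi (- j - 4)"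
  shows "1 \<le> (16 * real CARD('n))\<^sup>2 * (\<Sum>i\<in>UNIV. (cmod (cis (2 * pi * (axis i t \<bullet> \<xi>)) - 1))\<^sup>2)"
proof -
  let ?n = "real CARD('n)"
  have n0: "0 < ?n"
    by simp
  have "\<exists>i. norm \<xi> / ?n \<le> \<bar>\<xi> $ i\<bar>"
  proof (rule ccontr)
    assume "\<nexists>i. norm \<xi> / ?n \<le> \<bar>\<xi> $ i\<bar>"
    then have "(\<Sum>i\<in>UNIV. \<bar>\<xi> $ i\<bar>) < (\<Sum>i\<in>(UNIV :: 'n set). norm \<xi> / ?n)"
      by (intro sum_strict_mono) (auto simp: not_le)
    then show False
      using norm_le_l1_cart[of \<xi>] by simp
  qed
  then obtain i where i: "norm \<xi> / ?n \<le> \<bar>\<xi> $ i\<bar>" ..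
  define \<theta> where "\<theta> = 2 * pi * (axis i t \<bullet> \<xi>)"
  have t0: "0 < t" by (simp add: t)
  have abs: "\<bar>\<theta>\<bar> = 2 * pi * (t * \<bar>\<xi> $ i\<bar>)"
    using t0 by (simp add: \<theta>_def inner_axis' abs_mult)
  \<comment> \<open>The 4 in the exponent of \<open>t\<close> keeps the phase within
    \<open>pi / 4\<close>, inside the range where \<open>cis\<close> minus 1 grows at least
    linearly.\<close>
  have "t * \<bar>\<xi> $ i\<bar> \<le> t * 2 powi (j + 1)"
    using component_le_norm_cart[of \<xi> i] assms(2) t0 by (intro mult_left_mono) auto
  also have "\<dots> = 1 / 8"
    by (simp add: t power_int_add power_int_diff power_int_minus)
  finally have "2 * pi * (t * \<bar>\<xi> $ i\<bar>) \<le> 2 * pi * (1 / 8)"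
    by (intro mult_left_mono) auto
  then have "\<bar>\<theta>\<bar> \<le> pi / 3"
    unfolding abs using pi_gt_zero by linarith
  then have "\<bar>\<theta>\<bar> / 2 \<le> cmod (cis \<theta> - 1)"
    by (rule cmod_cis_diff_1_ge)
  \<comment> \<open>At the inner radius \<open>t * 2^(j-1) = 1/32\<close>, so half the phase is at
    least \<open>pi / (32 n)\<close>; then \<open>pi >= 2\<close>.\<close>
  moreover have "1 / (16 * ?n) \<le> \<bar>\<theta>\<bar> / 2"
  proof -
    have "1 / 32 / ?n = t * (2 powi (j - 1) / ?n)"
      by (simp add: t power_int_add power_int_diff power_int_minus)
    also have "\<dots> \<le> t * \<bar>\<xi> $ i\<bar>"
      using assms(1) t0 i by (intro mult_left_mono order_trans[OF _ i] divide_right_mono) auto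
    finally have "2 * (1 / 32 / ?n) \<le> pi * (t * \<bar>\<xi> $ i\<bar>)"
      using pi_ge_two by (intro mult_mono) auto
    then show ?thesis
      unfolding abs by simp
  qed
  ultimately have "(1 / (16 * ?n))\<^sup>2 \<le> (cmod (cis \<theta> - 1))\<^sup>2"
    by (intro power_mono) auto
  also have "\<dots> \<le> (\<Sum>i\<in>UNIV. (cmod (cis (2 * pi * (axis i t \<bullet> \<xi>)) - 1))\<^sup>2)"
    unfolding \<theta>_def by (rule member_le_sum) auto
  finally have "(16 * ?n)\<^sup>2 * (1 / (16 * ?n))\<^sup>2 \<le>
      (16 * ?n)\<^sup>2 * (\<Sum>i\<in>UNIV. (cmod (cis (2 * pi * (axis i t \<bullet> \<xi>)) - 1))\<^sup>2)"
    by (rule mult_left_mono) simp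
  then show ?thesis
    by (simp add: power_mult_distrib power_divide)
qed

text \<open>On the support of the symbol the annulus bound trades the transform of \<open>h\<close>
  for the transforms of its \<open>n\<close> increments, each small by the strip estimate. In the
  squared constant the 4 of that estimate and the 4 from \<open>L2_norm h <= 2 * L2_norm g\<close>
  cancel the 16 in \<open>N\<close>, which leaves \<open>(16 * n)^2 * n^2 / 2^d\<close>.\<close>

lemma multiplier_op_mart_diff_op_le:
  fixes g :: "real ^ 'n \<Rightarrow> complex" and d :: nat
  assumes \<psi>: "bounded_symbol M (2 powi (j + 1)) \<psi>"
    and low: "\<And>\<xi>. norm \<xi> < 2 powi (j - 1) \<Longrightarrow> \<psi> \<xi> = 0"
    and g: "square_integrable g" and d: "j = k + int d"
  shows "L2_norm (multiplier_op \<psi> (mart_diff_op k g)) \<le>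
    16 * M * (real CARD('n))\<^sup>2 * sqrt (1 / 2 ^ d) * L2_norm g"
proof -
  let ?n = "real CARD('n)"
  define h where "h = mart_diff_op k g"
  define t :: real where "t = 2 powi (- j - 4)"
  \<comment> \<open>The cell side \<open>2^-k\<close> divided by \<open>t\<close>. It is an integer
    because \<open>k <= j\<close>, so the strips fit the cells exactly.\<close>
  define N :: nat where "N = 2 ^ (d + 4)"
  note M = bounded_symbolD(3)[OF \<psi>]
  have h: "square_integrable h" and h_le: "L2_norm h \<le> 2 * L2_norm g"
    unfolding h_def by (rule mart_diff_op_L2[OF g])+
  have "real N * t = 2 powi int (d + 4) * 2 powi (- j - 4)"
    by (simp only: N_def t_def power_int_of_nat of_nat_power of_nat_numeral)
  also have "\<dots> = 2 powi (- k)"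
    unfolding d by (subst power_int_add[symmetric]) (auto simp: algebra_simps)
  finally have Nt: "real N * t = 2 powi (- k)" .
  have shift: "(L2_norm (\<lambda>x. h (x + axis i t) - h x))\<^sup>2 \<le> 4 / real N * (L2_norm h)\<^sup>2" for i
  proof (rule L2_norm_cell_shift[OF h _ _ Nt])
    show "h x = h y" if "cell k x = cell k y" for x y
      unfolding h_def by (rule mart_diff_op_cell[OF that])
  qed (simp add: N_def)
  define q where "q i \<xi> = (cis (2 * pi * (axis i t \<bullet> \<xi>)) - 1) * fourier_L2 h \<xi>" for i \<xi>
  have q: "square_integrable (q i)" for i
    unfolding q_def
    by (rule square_integrable_bounded_mult(1)[OF _ _ fourier_L2_isometry(1)[OF h], where c=2])
       (auto simp: cmod_cis_diff_1_le_2)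
  have q_norm: "L2_norm (q i) = L2_norm (\<lambda>x. h (x + axis i t) - h x)" for i
    unfolding q_def by (rule L2_norm_fourier_L2_translation_diff[OF h])
  have "(L2_norm (multiplier_op \<psi> h))\<^sup>2 = (\<integral>\<xi>. (cmod (\<psi> \<xi> * fourier_L2 h \<xi>))\<^sup>2 \<partial>lborel)"
    by (simp add: multiplier_op_L2(2)[OF \<psi> h] L2_norm_power2)
  also have "\<dots> \<le> (\<integral>\<xi>. M\<^sup>2 * (16 * ?n)\<^sup>2 * (\<Sum>i\<in>UNIV. (cmod (q i \<xi>))\<^sup>2) \<partial>lborel)"
  proof (rule integral_mono)
    show "integrable lborel (\<lambda>\<xi>. (cmod (\<psi> \<xi> * fourier_L2 h \<xi>))\<^sup>2)"
      by (rule square_integrable_integrable[OF multiplier_integrable(2)[OF \<psi> h]])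
    show "integrable lborel (\<lambda>\<xi>. M\<^sup>2 * (16 * ?n)\<^sup>2 * (\<Sum>i\<in>UNIV. (cmod (q i \<xi>))\<^sup>2))"
      by (intro integrable_mult_right Bochner_Integration.integrable_sum square_integrable_integrable q)
    show "(cmod (\<psi> \<xi> * fourier_L2 h \<xi>))\<^sup>2 \<le> M\<^sup>2 * (16 * ?n)\<^sup>2 * (\<Sum>i\<in>UNIV. (cmod (q i \<xi>))\<^sup>2)" for \<xi>
    proof (cases "\<psi> \<xi> = 0")
      case True
      then show ?thesis by (simp add: sum_nonneg)
    next
      case False
      then have "2 powi (j - 1) \<le> norm \<xi>" "norm \<xi> \<le> 2 powi (j + 1)"
        using low bounded_symbolD(4)[OF \<psi>] by (meson not_le)+
      note ge = cis_diff_1_annulus[OF this t_def]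
      have "(cmod (\<psi> \<xi>))\<^sup>2 * 1 \<le> M\<^sup>2 * ((16 * ?n)\<^sup>2 * (\<Sum>i\<in>UNIV. (cmod (cis (2 * pi * (axis i t \<bullet> \<xi>)) - 1))\<^sup>2))"
        by (intro mult_mono power_mono bounded_symbolD(2)[OF \<psi>] ge) auto
      from mult_right_mono[OF this, of "(cmod (fourier_L2 h \<xi>))\<^sup>2"]
      show ?thesis
        by (simp add: q_def norm_mult power_mult_distrib sum_distrib_right sum_distrib_left mult.assoc)
    qed
  qed
  also have "\<dots> = M\<^sup>2 * (16 * ?n)\<^sup>2 * (\<Sum>i\<in>UNIV. (L2_norm (q i))\<^sup>2)"
    by (simp add: L2_norm_power2 Bochner_Integration.integral_sum square_integrable_integrable[OF q])
  also have "\<dots> \<le> M\<^sup>2 * (16 * ?n)\<^sup>2 * (\<Sum>i\<in>(UNIV :: 'n set). 4 / real N * (L2_norm h)\<^sup>2)"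
    unfolding q_norm by (intro mult_left_mono sum_mono shift) auto
  also have "\<dots> = M\<^sup>2 * (16 * ?n)\<^sup>2 * ?n * (4 / real N) * (L2_norm h)\<^sup>2"
    by simp
  \<comment> \<open>The number \<open>n\<close> of directions is enlarged to its square so that the
    bound is a perfect square in \<open>n\<close>.\<close>
  also have "\<dots> \<le> M\<^sup>2 * (16 * ?n)\<^sup>2 * ?n\<^sup>2 * (4 / real N) * (2 * L2_norm g)\<^sup>2"
  proof -
    have "?n \<le> ?n\<^sup>2"
      by (simp add: power2_eq_square)
    then show ?thesis
      using M by (intro mult_mono power_mono h_le) auto
  qed
  also have "\<dots> = (16 * M * ?n\<^sup>2 * sqrt (1 / 2 ^ d) * L2_norm g)\<^sup>2"
    by (simp add: N_def power_mult_distrib power_add field_simps)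
  finally show ?thesis
    unfolding h_def[symmetric] by (rule power2_le_imp_le) (use M in simp)
qed

section \<open>Operator norms, chirps and duality\<close>

text \<open>The condition on \<open>B\<close> inside the infimum of \<open>L2_op_norm\<close>.
  Operators with the same admissible bounds have the same norm, with no need to know beforehand that
  it is finite.\<close>

definition L2_bound :: "((real ^ 'n \<Rightarrow> complex) \<Rightarrow> (real ^ 'n \<Rightarrow> complex)) \<Rightarrow> real \<Rightarrow> bool" where
  "L2_bound T B \<longleftrightarrow>
     (\<forall>f. square_integrable f \<longrightarrow> square_integrable (T f) \<and> L2_norm (T f) \<le> B * L2_norm f)"

lemma L2_op_norm_cong: "(\<And>B. 0 \<le> B \<Longrightarrow> L2_bound S B \<longleftrightarrow> L2_bound T B) \<Longrightarrow> L2_op_norm S = L2_op_norm T"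
  unfolding L2_op_norm_def L2_bound_def by (intro arg_cong[where f=Inf]) blast

lemma L2_op_norm_le: "0 \<le> B \<Longrightarrow> L2_bound T B \<Longrightarrow> L2_op_norm T \<le> ennreal B"
  unfolding L2_op_norm_def L2_bound_def by (intro Inf_lower) blast

lemma chirp_L2:
  assumes "square_integrable f"
  shows "square_integrable (chirp \<alpha> f)" "L2_norm (chirp \<alpha> f) = L2_norm f"
    "square_integrable (chirp_inv \<alpha> f)" "L2_norm (chirp_inv \<alpha> f) = L2_norm f"
proof -
  have [measurable]: "f \<in> borel_measurable borel"
    using assms by measurable
  have m: "chirp \<alpha> f \<in> borel_measurable borel" "chirp_inv \<alpha> f \<in> borel_measurable borel"
    unfolding chirp_def chirp_inv_def by measurable
  show "square_integrable (chirp \<alpha> f)" "L2_norm (chirp \<alpha> f) = L2_norm f"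
    by (rule L2_norm_cmod_cong[OF m(1) assms]; simp add: chirp_def norm_mult)+
  show "square_integrable (chirp_inv \<alpha> f)" "L2_norm (chirp_inv \<alpha> f) = L2_norm f"
    by (rule L2_norm_cmod_cong[OF m(2) assms]; simp add: chirp_inv_def norm_mult)+
qed

lemma chirp_inverse: "chirp \<alpha> (chirp_inv \<alpha> f) = f" "chirp_inv \<alpha> (chirp \<alpha> f) = f"
  by (simp_all add: fun_eq_iff chirp_def chirp_inv_def cis_mult_left)

lemma L2_op_norm_chirp_conjugate: "L2_op_norm (chirp_inv \<alpha> \<circ> T \<circ> chirp \<alpha>) = L2_op_norm T"
proof (rule L2_op_norm_cong)
  fix B :: real
  show "L2_bound (chirp_inv \<alpha> \<circ> T \<circ> chirp \<alpha>) B \<longleftrightarrow> L2_bound T B"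
  proof
    assume L: "L2_bound (chirp_inv \<alpha> \<circ> T \<circ> chirp \<alpha>) B"
    show "L2_bound T B"
      unfolding L2_bound_def
    proof (intro allI impI)
      fix f :: "real ^ 'a \<Rightarrow> complex" assume f: "square_integrable f"
      have "square_integrable (chirp_inv \<alpha> (T f))" "L2_norm (chirp_inv \<alpha> (T f)) \<le> B * L2_norm f"
        using L[unfolded L2_bound_def, rule_format, OF chirp_L2(3)[OF f, of \<alpha>]]
        by (simp_all add: chirp_inverse chirp_L2[OF f])
      then show "square_integrable (T f) \<and> L2_norm (T f) \<le> B * L2_norm f"
        using chirp_L2(1,2)[of "chirp_inv \<alpha> (T f)" \<alpha>] by (simp add: chirp_inverse)
    qed
  next
    assume L: "L2_bound T B"
    show "L2_bound (chirp_inv \<alpha> \<circ> T \<circ> chirp \<alpha>) B"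
      unfolding L2_bound_def
    proof (intro allI impI)
      fix f :: "real ^ 'a \<Rightarrow> complex" assume f: "square_integrable f"
      have "square_integrable (T (chirp \<alpha> f))" "L2_norm (T (chirp \<alpha> f)) \<le> B * L2_norm f"
        using L[unfolded L2_bound_def, rule_format, OF chirp_L2(1)[OF f, of \<alpha>]]
        by (simp_all add: chirp_L2[OF f])
      then show "square_integrable ((chirp_inv \<alpha> \<circ> T \<circ> chirp \<alpha>) f) \<and>
          L2_norm ((chirp_inv \<alpha> \<circ> T \<circ> chirp \<alpha>) f) \<le> B * L2_norm f"
        by (simp add: chirp_L2)
    qed
  qed
qed

text \<open>Testing \<open>u\<close> against itself replaces a supremum over test functions; norm 0
  is separate because a factor \<open>L2_norm u\<close> is cancelled.\<close>

lemma L2_norm_le_by_duality: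
  assumes "square_integrable u" "cmod (L2_inner u u) \<le> c * L2_norm u" "0 \<le> c"
  shows "L2_norm u \<le> c"
proof (cases "L2_norm u = 0")
  case False
  then have "0 < L2_norm u"
    using L2_norm_nonneg[of u] by linarith
  then show ?thesis
    using assms(2) by (simp add: L2_inner_self norm_mult power2_eq_square)
qed (use assms in simp)

text \<open>Each direction tests a composition against itself and moves both operators across the
  inner product. The adjoint produces the conjugate symbol once, and it is removed inside a norm,
  where only its modulus counts.\<close>

lemma L2_op_norm_mart_diff_multiplier_commute:
  assumes \<psi>: "bounded_symbol M R \<psi>"
  shows "L2_op_norm (mart_diff_op k \<circ> multiplier_op \<psi>) = L2_op_norm (multiplier_op \<psi> \<circ> mart_diff_op k)"
proof (rule L2_op_norm_cong)
  let ?D = "mart_diff_op k" and ?L = "multiplier_op \<psi>" and ?A = "multiplier_op (\<lambda>\<xi>. cnj (\<psi> \<xi>))"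
  fix B :: real assume B: "0 \<le> B"
  note D = mart_diff_op_L2(1)[where k=k] and L = multiplier_op_L2(1)[OF \<psi>]
    and A = multiplier_op_L2(1)[OF bounded_symbol_cnj[OF \<psi>]]
  show "L2_bound (?D \<circ> ?L) B \<longleftrightarrow> L2_bound (?L \<circ> ?D) B"
  proof
    assume bound: "L2_bound (?D \<circ> ?L) B"
    show "L2_bound (?L \<circ> ?D) B"
      unfolding L2_bound_def
    proof (intro allI impI)
      fix f :: "real ^ 'a \<Rightarrow> complex" assume f: "square_integrable f"
      \<comment> \<open>Built with the conjugate symbol so that moving it across the inner product
        yields \<open>?L\<close>, to which the assumed bound applies. Only at the end is
        \<open>?A\<close> exchanged for \<open>?L\<close> in the norm.\<close>
      define u where "u = ?A (?D f)"
      have u: "square_integrable u"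
        unfolding u_def by (intro A D f)
      have "L2_inner u u = L2_inner (?L u) (?D f)"
        using multiplier_op_adjoint[OF \<psi> u D[OF f]] by (simp add: u_def)
      also have "\<dots> = L2_inner (?D (?L u)) f"
        by (rule mart_diff_op_self_adjoint[OF L[OF u] f, symmetric])
      finally have "cmod (L2_inner u u) \<le> L2_norm (?D (?L u)) * L2_norm f"
        using cmod_L2_inner_le[OF D[OF L[OF u]] f] by simp
      also have "\<dots> \<le> B * L2_norm u * L2_norm f"
        using bound u by (intro mult_right_mono) (auto simp: L2_bound_def)
      finally have "L2_norm u \<le> B * L2_norm f"
        using B by (intro L2_norm_le_by_duality[OF u]) (auto simp: mult_ac)
      then show "square_integrable ((?L \<circ> ?D) f) \<and> L2_norm ((?L \<circ> ?D) f) \<le> B * L2_norm f"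
        using L2_norm_multiplier_op_cnj[OF \<psi> D[OF f]] L[OF D[OF f]] by (simp add: u_def)
    qed
  next
    assume bound: "L2_bound (?L \<circ> ?D) B"
    show "L2_bound (?D \<circ> ?L) B"
      unfolding L2_bound_def
    proof (intro allI impI)
      fix f :: "real ^ 'a \<Rightarrow> complex" assume f: "square_integrable f"
      define u where "u = ?D (?L f)"
      have u: "square_integrable u"
        unfolding u_def by (intro L D f)
      have "L2_inner u u = L2_inner (?L f) (?D u)"
        using mart_diff_op_self_adjoint[OF L[OF f] u, of k] by (simp add: u_def)
      also have "\<dots> = L2_inner f (?A (?D u))"
        by (rule multiplier_op_adjoint[OF \<psi> f D[OF u]])
      finally have "cmod (L2_inner u u) \<le> L2_norm f * L2_norm (?A (?D u))"
        using cmod_L2_inner_le[OF f A[OF D[OF u]]] by simp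
      also have "L2_norm (?A (?D u)) = L2_norm (?L (?D u))"
        by (rule L2_norm_multiplier_op_cnj[OF \<psi> D[OF u]])
      also have "L2_norm f * L2_norm (?L (?D u)) \<le> L2_norm f * (B * L2_norm u)"
        using bound u by (intro mult_left_mono) (auto simp: L2_bound_def)
      finally have "L2_norm u \<le> B * L2_norm f"
        using B by (intro L2_norm_le_by_duality[OF u]) (auto simp: mult_ac)
      then show "square_integrable ((?D \<circ> ?L) f) \<and> L2_norm ((?D \<circ> ?L) f) \<le> B * L2_norm f"
        using u by (simp add: u_def)
    qed
  qed
qed

text \<open>The two lower bounds on \<open>C\<close> are the constants of the two regimes; 12 is 6
  times the radius 2 of the support of \<open>\<phi>\<close>.\<close>

lemma L2_op_norm_LP_op_mart_diff_op_le:
  fixes \<phi> :: "real ^ 'n \<Rightarrow> complex"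
  assumes \<phi>: "bounded_symbol M 2 \<phi>" and low: "\<And>\<xi>. norm \<xi> < 1 / 2 \<Longrightarrow> \<phi> \<xi> = 0"
    and C: "12 * pi * real CARD('n) * sqrt (2 ^ CARD('n)) * M \<le> C" "16 * M * (real CARD('n))\<^sup>2 \<le> C"
  shows "L2_op_norm (LP_op \<phi> j \<circ> mart_diff_op k) \<le>
    ennreal (C * 2 powr (- (1 / 2) * real_of_int \<bar>j - k\<bar>))"
proof -
  define \<psi> where "\<psi> \<xi> = \<phi> ((2 powi (- j)) *\<^sub>R \<xi>)" for \<xi>
  have \<psi>: "bounded_symbol M (2 powi j * 2) \<psi>"
    unfolding \<psi>_def by (rule bounded_symbol_dilation[OF \<phi>])
  have eq: "LP_op \<phi> j = multiplier_op \<psi>"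
    by (simp add: LP_op_eq \<psi>_def[abs_def])
  have M: "0 \<le> M"
    by (rule bounded_symbolD(3)[OF \<phi>])
  then have C0: "0 \<le> C"
    using C(2) by (meson mult_nonneg_nonneg order_trans zero_le_numeral zero_le_power2)
  let ?r = "2 powr (- (1 / 2) * real_of_int \<bar>j - k\<bar>)"
  show ?thesis
  proof (cases "k \<le> j")
    case True
    define d where "d = nat (j - k)"
    have d: "j = k + int d"
      using True by (simp add: d_def)
    have r: "sqrt (1 / 2 ^ d) = ?r"
      using d by (simp add: powr_half_sqrt[symmetric] powr_powr powr_realpow[symmetric]
          powr_minus_divide[symmetric] real_sqrt_divide)
    have low': "\<psi> \<xi> = 0" if "norm \<xi> < 2 powi (j - 1)" for \<xi>
      unfolding \<psi>_def by (rule low)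
        (use that in \<open>simp add: power_int_minus power_int_diff field_simps\<close>)
    have \<psi>': "bounded_symbol M (2 powi (j + 1)) \<psi>"
      using \<psi> by (simp add: power_int_add)
    have "L2_bound (multiplier_op \<psi> \<circ> mart_diff_op k) (C * ?r)"
      unfolding L2_bound_def comp_apply
    proof (intro allI impI conjI)
      fix g :: "real ^ 'n \<Rightarrow> complex" assume g: "square_integrable g"
      show "square_integrable (multiplier_op \<psi> (mart_diff_op k g))"
        by (rule multiplier_op_L2(1)[OF \<psi> mart_diff_op_L2(1)[OF g]])
      have "L2_norm (multiplier_op \<psi> (mart_diff_op k g)) \<le> 16 * M * (real CARD('n))\<^sup>2 * ?r * L2_norm g"
        using multiplier_op_mart_diff_op_le[OF \<psi>' low' g d] unfolding r .
      also have "\<dots> \<le> C * ?r * L2_norm g"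
        by (intro mult_right_mono C) auto
      finally show "L2_norm (multiplier_op \<psi> (mart_diff_op k g)) \<le> C * ?r * L2_norm g" .
    qed
    then show ?thesis
      unfolding eq using C0 by (intro L2_op_norm_le) auto
  next
    case False
    have "2 powi j * 2 powi (- k) = (2 powi (j - k) :: real)"
      by (simp add: power_int_diff power_int_minus field_simps)
    also have "\<dots> = 2 powr real_of_int (j - k)"
      by (rule powr_real_of_int'[symmetric]) auto
    \<comment> \<open>Here \<open>j - k\<close> is negative, so the full decay is better than the
      square root that is claimed.\<close>
    also have "\<dots> \<le> ?r"
    proof (rule powr_mono)
      have "real_of_int j < real_of_int k"
        using False by simp
      then have *: "real_of_int \<bar>j - k\<bar> = real_of_int k - real_of_int j"
        by simp
      show "real_of_int (j - k) \<le> - (1 / 2) * real_of_int \<bar>j - k\<bar>"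
        unfolding * of_int_diff using \<open>real_of_int j < real_of_int k\<close> by (simp add: field_simps)
    qed simp
    finally have r: "2 powi j * 2 powi (- k) \<le> ?r" .
    have "L2_bound (mart_diff_op k \<circ> multiplier_op \<psi>) (C * ?r)"
      unfolding L2_bound_def comp_apply
    proof (intro allI impI conjI)
      fix g :: "real ^ 'n \<Rightarrow> complex" assume g: "square_integrable g"
      show "square_integrable (mart_diff_op k (multiplier_op \<psi> g))"
        by (rule mart_diff_op_L2(1)[OF multiplier_op_L2(1)[OF \<psi> g]])
      have "L2_norm (mart_diff_op k (multiplier_op \<psi> g)) \<le>
          6 * pi * real CARD('n) * sqrt (2 ^ CARD('n)) * (2 powi j * 2) * M * 2 powi (- k) * L2_norm g"
        by (rule mart_diff_op_multiplier_op_le[OF \<psi> g]) simp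
      also have "\<dots> = (12 * pi * real CARD('n) * sqrt (2 ^ CARD('n)) * M) * (2 powi j * 2 powi (- k)) * L2_norm g"
        by simp
      also have "\<dots> \<le> C * ?r * L2_norm g"
        by (intro mult_right_mono mult_mono C r C0) auto
      finally show "L2_norm (mart_diff_op k (multiplier_op \<psi> g)) \<le> C * ?r * L2_norm g" .
    qed
    \<comment> \<open>In this regime the bound was found for the opposite order of the operators;
      equality of the norms carries it over.\<close>
    then show ?thesis
      unfolding eq L2_op_norm_mart_diff_multiplier_commute[OF \<psi>, symmetric]
      using C0 by (intro L2_op_norm_le) auto
  qed
qed

theorem theorem7p6:
  fixes \<phi> :: "real ^ 'n \<Rightarrow> complex" and \<alpha> :: real
  assumes "\<forall>m::int. \<alpha> \<noteq> of_int m * pi"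
    and "LP_function \<phi>"
  shows "\<exists>C::real. \<forall>j k :: int.
           L2_op_norm (frac_mart_diff_op \<alpha> k \<circ> frac_LP_op \<phi> \<alpha> j) =
             L2_op_norm (frac_LP_op \<phi> \<alpha> j \<circ> frac_mart_diff_op \<alpha> k) \<and>
           L2_op_norm (frac_LP_op \<phi> \<alpha> j \<circ> frac_mart_diff_op \<alpha> k) \<le>
             ennreal (C * 2 powr (- (1 / 2) * real_of_int \<bar>j - k\<bar>))"
proof -
  obtain M where \<phi>: "bounded_symbol M 2 \<phi>"
    using LP_function_bounded_symbol(1)[OF assms(2)] by blast
  \<comment> \<open>The inner pair of chirps cancels, so each composition is a single chirp
    conjugate of a classical one.\<close>
  have conj: "frac_mart_diff_op \<alpha> k \<circ> frac_LP_op \<phi> \<alpha> j =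
        chirp_inv \<alpha> \<circ> (mart_diff_op k \<circ> LP_op \<phi> j) \<circ> chirp \<alpha>"
      "frac_LP_op \<phi> \<alpha> j \<circ> frac_mart_diff_op \<alpha> k =
        chirp_inv \<alpha> \<circ> (LP_op \<phi> j \<circ> mart_diff_op k) \<circ> chirp \<alpha>" for j k
    by (simp_all add: fun_eq_iff frac_mart_diff_op_def frac_LP_op_def chirp_inverse)
  let ?C = "max (12 * pi * real CARD('n) * sqrt (2 ^ CARD('n)) * M) (16 * M * (real CARD('n))\<^sup>2)"
  show ?thesis
  proof (intro exI[of _ ?C] allI conjI)
    fix j k :: int
    show "L2_op_norm (frac_mart_diff_op \<alpha> k \<circ> frac_LP_op \<phi> \<alpha> j) =
        L2_op_norm (frac_LP_op \<phi> \<alpha> j \<circ> frac_mart_diff_op \<alpha> k)"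
      unfolding conj L2_op_norm_chirp_conjugate LP_op_eq
      by (rule L2_op_norm_mart_diff_multiplier_commute[OF bounded_symbol_dilation[OF \<phi>]])
    show "L2_op_norm (frac_LP_op \<phi> \<alpha> j \<circ> frac_mart_diff_op \<alpha> k) \<le>
        ennreal (?C * 2 powr (- (1 / 2) * real_of_int \<bar>j - k\<bar>))"
      unfolding conj L2_op_norm_chirp_conjugate
      by (rule L2_op_norm_LP_op_mart_diff_op_le[OF \<phi> LP_function_bounded_symbol(2)[OF assms(2)]]) simp_all
  qed
qed

end
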